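(* Let $\mathbf{k}$ be a field of characteristic $p>0$, let $q$ be a power of $p$, and let $G$ be a finite group with a normal subgroup $H$ such that $p\nmid|H|$ and $G/H\cong C_q$ is cyclic of order $q$ with generator $\rho$. Let $A$ be a $\mathbf{k}G$-module algebra and $M$ an $(\mathbf{m},\mathbf{h})$-degenerated $A^eG$-module algebra. Then there are two filtrations by graded $\mathcal{A}_M^G$-bimodules $$0=X_{q-1}\subset X_{q-2}\subset\cdots\subset X_1\subset X_0=X_M^G$$ and $$0=Y_{q-1}\subset Y_{q-2}\subset\cdots\subset Y_1\subset Y_0=Y_M^G$$ such that $Y_i/Y_{i+1}\cong X_{q-2-i}/X_{q-1-i}$ for $0\le i\le q-2$. Moreover, these filtrations can be taken so that, if $\Delta_\rho^i\,\mathrm{HH}^*(A,M)^H=\mathrm{HH}^*(A,M)^G$ for some $0\le i\le q-1$, then $X_{q-1-i}=0=Y_{i+1}$ and $X_{q-2-i}=X_M^G\cong Y_M^G=Y_i$ (with the conventions $X_{-1}=X_M^G$ and $Y_q=0$).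
   Context: All algebras are unital. A $\mathbf{k}G$-module algebra is an algebra with $G$ acting by algebra automorphisms. $A^e=A\otimes A^{\mathrm{op}}$ carries the diagonal $G$-action and $A^eG=A^e\#\mathbf{k}G$ is the skew group algebra; an $A^eG$-module is an $A$-bimodule with a compatible $G$-action. An $A^eG$-module algebra is an $A^eG$-module $M$ with a unital associative $\mathbf{k}$-algebra structure such that $G$ acts by algebra automorphisms and the multiplication is induced by an $A$-bimodule map $M\otimes_AM\to M$. $C^n(A,M)\cong\mathrm{Hom}_{\mathbf{k}}(A^{\otimes n},M)$ is the Hochschild cochain complex with $G$-action $({}^\alpha f)(a_1\otimes\cdots\otimes a_n)={}^\alpha\big(f({}^{\alpha^{-1}}a_1\otimes\cdots\otimes{}^{\alpha^{-1}}a_n)\big)$ and cup product $\smile$; $\mathrm{HH}^*(A,M)$ is its cohomology, a graded algebra with $G$-action. If $G$ acts on $V$, then $C_q=G/H$ acts on $V^H$. Put $\Delta_\rho=1-\rho\in\mathbf{k}C_q$ (so $\Delta_\rho^{q-1}=\sum_{i=0}^{q-1}\rho^i$). For $x\in M$, $\phi_x(a)=ax-xa$ is the inner derivation; $\mathrm{Der}(A,M)$ is the space of $\mathbf{k}$-linear derivations. $M$ is called $(\mathbf{m},\mathbf{h})$-degenerated if $\mathbf{m}\in M^H$ and $\mathbf{h}\in\mathrm{Der}(A,M)^H$ satisfy $\Delta_\rho^{q-1}\mathbf{m}=1_M$ and $\Delta_\rho\mathbf{h}+\phi_{\mathbf{m}}=0$. $\mathrm{HH}^*(A,M)^{G\uparrow}$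 is the cohomology of the invariant complex $C(A,M)^G$, and $\Theta_M^G:\mathrm{HH}^*(A,M)^{G\uparrow}\to\mathrm{HH}^*(A,M)^G$ is the graded algebra homomorphism induced by $C(A,M)^G\hookrightarrow C(A,M)$. Put $\mathcal{A}_M^G=\mathrm{Im}\,\Theta_M^G$, $X_M^G=\mathrm{Ker}\,\Theta_M^G$ and $Y_M^G=\mathrm{HH}^*(A,M)^G/\mathcal{A}_M^G$. Under the assumption on $M$ one has $(X_M^G)^2=0$, so $X_M^G$ is a graded $\mathcal{A}_M^G$-bimodule; $Y_M^G$ is a graded $\mathcal{A}_M^G$-bimodule as a quotient of $\mathrm{HH}^*(A,M)^G$. Isomorphisms are of graded $\mathcal{A}_M^G$-bimodules. *)

theory Defs
  imports "HOL-Algebra.Algebra" "HOL-Algebra.Algebraic_Closure_Type"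
begin

section \<open>Graded vector spaces, algebras and bimodules\<close>

text \<open>
  A graded object is given by the family of its homogeneous components. Each component is a vector
  space over the field \<open>'k\<close>, stored in a HOL-Algebra \<open>module\<close> record; the multiplicative
  fields \<open>mult\<close> and \<open>one\<close> of these records are not used.
  Products and actions carry the degrees of their two arguments.
\<close>

record ('k, 'v) gr_space =
  gcomp :: "nat \<Rightarrow> ('k, 'v) module"

record ('k, 'v) gr_alg = "('k, 'v) gr_space" +
  gmult :: "nat \<Rightarrow> nat \<Rightarrow> 'v \<Rightarrow> 'v \<Rightarrow> 'v"
  gone :: 'v

record ('k, 'v, 'b) gr_bimod = "('k, 'v) gr_space" +
  glact :: "nat \<Rightarrow> nat \<Rightarrow> 'b \<Rightarrow> 'v \<Rightarrow> 'v"
  gract :: "nat \<Rightarrow> nat \<Rightarrow> 'v \<Rightarrow> 'b \<Rightarrow> 'v"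

abbreviation vspace :: "('k::field, 'v) module \<Rightarrow> bool" where
  "vspace V \<equiv> Module.module (ring_of_type_algebra :: 'k ring) V"

abbreviation gcar :: "('k, 'v, 'z) gr_space_scheme \<Rightarrow> nat \<Rightarrow> 'v set" where
  "gcar M n \<equiv> carrier (gcomp M n)"

abbreviation gzero :: "('k, 'v, 'z) gr_space_scheme \<Rightarrow> nat \<Rightarrow> 'v set" where
  "gzero M n \<equiv> {\<zero>\<^bsub>gcomp M n\<^esub>}"

locale graded_algebra =
  fixes B :: "('k::field, 'b) gr_alg"
  assumes vspace_alg: "vspace (gcomp B n)"
    and mult_closed: "\<lbrakk>a \<in> gcar B i; b \<in> gcar B j\<rbrakk> \<Longrightarrow> gmult B i j a b \<in> gcar B (i + j)"
    and mult_add_left: "\<lbrakk>a \<in> gcar B i; a' \<in> gcar B i; b \<in> gcar B j\<rbrakk> \<Longrightarrow>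
      gmult B i j (a \<oplus>\<^bsub>gcomp B i\<^esub> a') b = gmult B i j a b \<oplus>\<^bsub>gcomp B (i + j)\<^esub> gmult B i j a' b"
    and mult_add_right: "\<lbrakk>a \<in> gcar B i; b \<in> gcar B j; b' \<in> gcar B j\<rbrakk> \<Longrightarrow>
      gmult B i j a (b \<oplus>\<^bsub>gcomp B j\<^esub> b') = gmult B i j a b \<oplus>\<^bsub>gcomp B (i + j)\<^esub> gmult B i j a b'"
    and mult_smult_left: "\<lbrakk>a \<in> gcar B i; b \<in> gcar B j\<rbrakk> \<Longrightarrow>
      gmult B i j (c \<odot>\<^bsub>gcomp B i\<^esub> a) b = c \<odot>\<^bsub>gcomp B (i + j)\<^esub> gmult B i j a b"
    and mult_smult_right: "\<lbrakk>a \<in> gcar B i; b \<in> gcar B j\<rbrakk> \<Longrightarrow>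
      gmult B i j a (c \<odot>\<^bsub>gcomp B j\<^esub> b) = c \<odot>\<^bsub>gcomp B (i + j)\<^esub> gmult B i j a b"
    and mult_assoc: "\<lbrakk>a \<in> gcar B i; b \<in> gcar B j; c' \<in> gcar B l\<rbrakk> \<Longrightarrow>
      gmult B (i + j) l (gmult B i j a b) c' = gmult B i (j + l) a (gmult B j l b c')"
    and one_closed: "gone B \<in> gcar B 0"
    and one_left: "a \<in> gcar B i \<Longrightarrow> gmult B 0 i (gone B) a = a"
    and one_right: "a \<in> gcar B i \<Longrightarrow> gmult B i 0 a (gone B) = a"

locale graded_bimodule = graded_algebra B
  for B :: "('k::field, 'b) gr_alg" +
  fixes M :: "('k, 'v, 'b) gr_bimod"
  assumes vspace_bimod: "vspace (gcomp M n)"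
    and lact_closed: "\<lbrakk>b \<in> gcar B i; v \<in> gcar M j\<rbrakk> \<Longrightarrow> glact M i j b v \<in> gcar M (i + j)"
    and ract_closed: "\<lbrakk>v \<in> gcar M j; b \<in> gcar B i\<rbrakk> \<Longrightarrow> gract M j i v b \<in> gcar M (j + i)"
    and lact_add_left: "\<lbrakk>b \<in> gcar B i; b' \<in> gcar B i; v \<in> gcar M j\<rbrakk> \<Longrightarrow>
      glact M i j (b \<oplus>\<^bsub>gcomp B i\<^esub> b') v = glact M i j b v \<oplus>\<^bsub>gcomp M (i + j)\<^esub> glact M i j b' v"
    and lact_add_right: "\<lbrakk>b \<in> gcar B i; v \<in> gcar M j; v' \<in> gcar M j\<rbrakk> \<Longrightarrow>
      glact M i j b (v \<oplus>\<^bsub>gcomp M j\<^esub> v') = glact M i j b v \<oplus>\<^bsub>gcomp M (i + j)\<^esub> glact M i j b v'"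
    and ract_add_left: "\<lbrakk>v \<in> gcar M j; v' \<in> gcar M j; b \<in> gcar B i\<rbrakk> \<Longrightarrow>
      gract M j i (v \<oplus>\<^bsub>gcomp M j\<^esub> v') b = gract M j i v b \<oplus>\<^bsub>gcomp M (j + i)\<^esub> gract M j i v' b"
    and ract_add_right: "\<lbrakk>v \<in> gcar M j; b \<in> gcar B i; b' \<in> gcar B i\<rbrakk> \<Longrightarrow>
      gract M j i v (b \<oplus>\<^bsub>gcomp B i\<^esub> b') = gract M j i v b \<oplus>\<^bsub>gcomp M (j + i)\<^esub> gract M j i v b'"
    and lact_smult_left: "\<lbrakk>b \<in> gcar B i; v \<in> gcar M j\<rbrakk> \<Longrightarrow>
      glact M i j (c \<odot>\<^bsub>gcomp B i\<^esub> b) v = c \<odot>\<^bsub>gcomp M (i + j)\<^esub> glact M i j b v"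
    and lact_smult_right: "\<lbrakk>b \<in> gcar B i; v \<in> gcar M j\<rbrakk> \<Longrightarrow>
      glact M i j b (c \<odot>\<^bsub>gcomp M j\<^esub> v) = c \<odot>\<^bsub>gcomp M (i + j)\<^esub> glact M i j b v"
    and ract_smult_left: "\<lbrakk>v \<in> gcar M j; b \<in> gcar B i\<rbrakk> \<Longrightarrow>
      gract M j i (c \<odot>\<^bsub>gcomp M j\<^esub> v) b = c \<odot>\<^bsub>gcomp M (j + i)\<^esub> gract M j i v b"
    and ract_smult_right: "\<lbrakk>v \<in> gcar M j; b \<in> gcar B i\<rbrakk> \<Longrightarrow>
      gract M j i v (c \<odot>\<^bsub>gcomp B i\<^esub> b) = c \<odot>\<^bsub>gcomp M (j + i)\<^esub> gract M j i v b"
    and lact_assoc: "\<lbrakk>b \<in> gcar B i; b' \<in> gcar B j; v \<in> gcar M l\<rbrakk> \<Longrightarrow>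
      glact M (i + j) l (gmult B i j b b') v = glact M i (j + l) b (glact M j l b' v)"
    and ract_assoc: "\<lbrakk>v \<in> gcar M l; b \<in> gcar B i; b' \<in> gcar B j\<rbrakk> \<Longrightarrow>
      gract M l (i + j) v (gmult B i j b b') = gract M (l + i) j (gract M l i v b) b'"
    and lract_assoc: "\<lbrakk>b \<in> gcar B i; v \<in> gcar M l; b' \<in> gcar B j\<rbrakk> \<Longrightarrow>
      gract M (i + l) j (glact M i l b v) b' = glact M i (l + j) b (gract M l j v b')"
    and lact_one: "v \<in> gcar M l \<Longrightarrow> glact M 0 l (gone B) v = v"
    and ract_one: "v \<in> gcar M l \<Longrightarrow> gract M l 0 v (gone B) = v"

definition graded_subbimodule ::
    "('k::field, 'b) gr_alg \<Rightarrow> ('k, 'v, 'b) gr_bimod \<Rightarrow> (nat \<Rightarrow> 'v set) \<Rightarrow> bool" where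
  "graded_subbimodule B M S \<longleftrightarrow>
     graded_bimodule B M \<and>
     (\<forall>n. submodule (S n) (ring_of_type_algebra :: 'k ring) (gcomp M n)) \<and>
     (\<forall>i j. \<forall>b \<in> gcar B i. \<forall>v \<in> S j.
        glact M i j b v \<in> S (i + j) \<and> gract M j i v b \<in> S (j + i))"

definition gr_restrict ::
    "('k, 'v, 'z) gr_space_scheme \<Rightarrow> (nat \<Rightarrow> 'v set) \<Rightarrow> ('k, 'v, 'z) gr_space_scheme" where
  "gr_restrict M S = M\<lparr>gcomp := (\<lambda>n. (gcomp M n)\<lparr>carrier := S n\<rparr>)\<rparr>"

definition vquot :: "('k, 'v) module \<Rightarrow> 'v set \<Rightarrow> ('k, 'v set) module" where
  "vquot V W =
     \<lparr>carrier = a_rcosets\<^bsub>V\<^esub> W, monoid.mult = undefined, one = undefined,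
      ring.zero = W, add = (\<lambda>S T. S <+>\<^bsub>V\<^esub> T),
      module.smult = (\<lambda>c S. W <+>\<^bsub>V\<^esub> ((\<lambda>v. c \<odot>\<^bsub>V\<^esub> v) ` S))\<rparr>"

definition gr_quot ::
    "('k, 'v, 'b) gr_bimod \<Rightarrow> (nat \<Rightarrow> 'v set) \<Rightarrow> ('k, 'v set, 'b) gr_bimod" where
  "gr_quot M S =
     \<lparr>gcomp = (\<lambda>n. vquot (gcomp M n) (S n)),
      glact = (\<lambda>i j b T. S (i + j) <+>\<^bsub>gcomp M (i + j)\<^esub> (glact M i j b ` T)),
      gract = (\<lambda>j i T b. S (j + i) <+>\<^bsub>gcomp M (j + i)\<^esub> ((\<lambda>v. gract M j i v b) ` T))\<rparr>"

text \<open>Isomorphisms of graded bimodules preserve degrees.\<close>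

definition gr_bimod_iso ::
    "('k, 'b) gr_alg \<Rightarrow> ('k, 'v, 'b) gr_bimod \<Rightarrow> ('k, 'w, 'b) gr_bimod \<Rightarrow> bool" where
  "gr_bimod_iso B M N \<longleftrightarrow>
     (\<exists>\<phi>. (\<forall>n. \<phi> n \<in> iso (add_monoid (gcomp M n)) (add_monoid (gcomp N n))) \<and>
          (\<forall>n c. \<forall>v \<in> gcar M n. \<phi> n (c \<odot>\<^bsub>gcomp M n\<^esub> v) = c \<odot>\<^bsub>gcomp N n\<^esub> \<phi> n v) \<and>
          (\<forall>i j. \<forall>b \<in> gcar B i. \<forall>v \<in> gcar M j.
             \<phi> (i + j) (glact M i j b v) = glact N i j b (\<phi> j v) \<and>
             \<phi> (j + i) (gract M j i v b) = gract N j i (\<phi> j v) b))"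

text \<open>
  A descending filtration \<open>0 = F N \<subseteq> \<dots> \<subseteq> F 1 \<subseteq> F 0 = M\<close>. The index is an integer only because
  the terms \<open>F (-1)\<close> and \<open>F (N + 1)\<close> are referred to by convention.
\<close>

definition graded_filtration ::
    "('k::field, 'b) gr_alg \<Rightarrow> ('k, 'v, 'b) gr_bimod \<Rightarrow> nat \<Rightarrow> (int \<Rightarrow> nat \<Rightarrow> 'v set) \<Rightarrow> bool" where
  "graded_filtration B M N F \<longleftrightarrow>
     F 0 = gcar M \<and> F (int N) = gzero M \<and>
     (\<forall>i \<in> {0..int N}. graded_subbimodule B M (F i)) \<and>
     (\<forall>i \<in> {0..<int N}. \<forall>n. F (i + 1) n \<subseteq> F i n)"

abbreviation gr_subquot ::
    "('k, 'v, 'b) gr_bimod \<Rightarrow> (nat \<Rightarrow> 'v set) \<Rightarrow> (nat \<Rightarrow> 'v set) \<Rightarrow> ('k, 'v set, 'b) gr_bimod" where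
  "gr_subquot M S T \<equiv> gr_quot (gr_restrict M S) T"

definition cocycles ::
    "(nat \<Rightarrow> ('k, 'c) module) \<Rightarrow> (nat \<Rightarrow> 'c \<Rightarrow> 'c) \<Rightarrow> nat \<Rightarrow> 'c set" where
  "cocycles V d n = {f \<in> carrier (V n). d n f = \<zero>\<^bsub>V (Suc n)\<^esub>}"

definition coboundaries ::
    "(nat \<Rightarrow> ('k, 'c) module) \<Rightarrow> (nat \<Rightarrow> 'c \<Rightarrow> 'c) \<Rightarrow> nat \<Rightarrow> 'c set" where
  "coboundaries V d n = (case n of 0 \<Rightarrow> {\<zero>\<^bsub>V 0\<^esub>} | Suc m \<Rightarrow> d m ` carrier (V m))"

text \<open>
  The cohomology algebra of a cochain complex \<open>(V, d)\<close> with product \<open>cup\<close> and unit cochain \<open>e\<close>;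
  classes are cosets of the coboundaries in the cocycles.
\<close>

definition cohomology ::
    "(nat \<Rightarrow> ('k, 'c) module) \<Rightarrow> (nat \<Rightarrow> 'c \<Rightarrow> 'c) \<Rightarrow> (nat \<Rightarrow> nat \<Rightarrow> 'c \<Rightarrow> 'c \<Rightarrow> 'c) \<Rightarrow> 'c
      \<Rightarrow> ('k, 'c set) gr_alg" where
  "cohomology V d cup e =
     \<lparr>gcomp = (\<lambda>n. vquot ((V n)\<lparr>carrier := cocycles V d n\<rparr>) (coboundaries V d n)),
      gmult = (\<lambda>i j S T. coboundaries V d (i + j) <+>\<^bsub>V (i + j)\<^esub> {cup i j f g | f g. f \<in> S \<and> g \<in> T}),
      gone = coboundaries V d 0 +>\<^bsub>V 0\<^esub> e\<rparr>"

section \<open>Module algebras\<close>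

record ('g, 'k, 'a) mod_alg =
  scl :: "'k \<Rightarrow> 'a \<Rightarrow> 'a"
  act :: "'g \<Rightarrow> 'a \<Rightarrow> 'a"

record ('g, 'k, 'a, 'm) bimod_alg = "('g, 'k, 'm) mod_alg" +
  lmul :: "'a \<Rightarrow> 'm \<Rightarrow> 'm"
  rmul :: "'m \<Rightarrow> 'a \<Rightarrow> 'm"

text \<open>
  The sort \<open>{ring, monoid_mult}\<close> is that of unital associative rings; unlike \<open>ring_1\<close> it
  allows the zero ring.
\<close>

locale kG_module_algebra =
  fixes G :: "('g, 'y) monoid_scheme"
    and A :: "('g, 'k::field, 'a::{ring,monoid_mult}, 'z) mod_alg_scheme"
  assumes vector_space: "vector_space (scl A)"
    and scl_mult_left: "scl A c x * y = scl A c (x * y)"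
    and scl_mult_right: "x * scl A c y = scl A c (x * y)"
    and action: "group_action G UNIV (act A)"
    and act_linear: "g \<in> carrier G \<Longrightarrow> Vector_Spaces.linear (scl A) (scl A) (act A g)"
    and act_mult: "g \<in> carrier G \<Longrightarrow> act A g (x * y) = act A g x * act A g y"
    and act_one: "g \<in> carrier G \<Longrightarrow> act A g 1 = 1"

locale AeG_module_algebra =
  A: kG_module_algebra G A + M: kG_module_algebra G M
  for G :: "('g, 'y) monoid_scheme"
    and A :: "('g, 'k::field, 'a::{ring,monoid_mult}) mod_alg"
    and M :: "('g, 'k, 'a, 'm::{ring,monoid_mult}) bimod_alg" +
  assumes lmul_linear_left: "Vector_Spaces.linear (scl A) (scl M) (\<lambda>a. lmul M a x)"
    and lmul_linear_right: "Vector_Spaces.linear (scl M) (scl M) (\<lambda>x. lmul M a x)"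
    and rmul_linear_left: "Vector_Spaces.linear (scl M) (scl M) (\<lambda>x. rmul M x a)"
    and rmul_linear_right: "Vector_Spaces.linear (scl A) (scl M) (\<lambda>a. rmul M x a)"
    and lmul_assoc: "lmul M (a * b) x = lmul M a (lmul M b x)"
    and rmul_assoc: "rmul M x (a * b) = rmul M (rmul M x a) b"
    and lrmul_assoc: "rmul M (lmul M a x) b = lmul M a (rmul M x b)"
    and lmul_one: "lmul M 1 x = x"
    and rmul_one: "rmul M x 1 = x"
    and act_lmul: "g \<in> carrier G \<Longrightarrow> act M g (lmul M a x) = lmul M (act A g a) (act M g x)"
    and act_rmul: "g \<in> carrier G \<Longrightarrow> act M g (rmul M x a) = rmul M (act M g x) (act A g a)"
    and mult_lmul: "lmul M a (x * y) = lmul M a x * y"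
    and mult_rmul: "rmul M (x * y) a = x * rmul M y a"
    and mult_balanced: "rmul M x a * y = x * lmul M a y"

definition fixed_by :: "('g \<Rightarrow> 'v \<Rightarrow> 'v) \<Rightarrow> 'g set \<Rightarrow> 'v set \<Rightarrow> 'v set" where
  "fixed_by a S V = {v \<in> V. \<forall>g \<in> S. a g v = v}"

text \<open>
  For a normal subgroup \<open>H\<close>, an element of \<open>G Mod H\<close> (a coset) acts on \<open>H\<close>-fixed vectors through
  any of its representatives.
\<close>

definition coset_act :: "('g \<Rightarrow> 'v \<Rightarrow> 'v) \<Rightarrow> 'g set \<Rightarrow> 'v \<Rightarrow> 'v" where
  "coset_act a \<rho> v = a (SOME g. g \<in> \<rho>) v"

text \<open>The operator \<open>1 - \<rho>\<close>, for the subtraction \<open>sub\<close> of the space acted upon.\<close>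

definition Delta :: "('v \<Rightarrow> 'v \<Rightarrow> 'v) \<Rightarrow> ('g \<Rightarrow> 'v \<Rightarrow> 'v) \<Rightarrow> 'g set \<Rightarrow> 'v \<Rightarrow> 'v" where
  "Delta sub a \<rho> v = sub v (coset_act a \<rho> v)"

definition Der :: "('g, 'k::field, 'a::{ring,monoid_mult}) mod_alg \<Rightarrow>
    ('g, 'k, 'a, 'm::{ring,monoid_mult}) bimod_alg \<Rightarrow> ('a \<Rightarrow> 'm) set" where
  "Der A M = {f. Vector_Spaces.linear (scl A) (scl M) f \<and>
                 (\<forall>a b. f (a * b) = lmul M a (f b) + rmul M (f a) b)}"

definition inner_der :: "('g, 'k, 'a, 'm::{ring,monoid_mult}) bimod_alg \<Rightarrow> 'm \<Rightarrow> 'a \<Rightarrow> 'm" where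
  "inner_der M x = (\<lambda>a. lmul M a x - rmul M x a)"

definition hom_act :: "('g, 'y) monoid_scheme \<Rightarrow> ('g, 'k, 'a) mod_alg \<Rightarrow>
    ('g, 'k, 'a, 'm) bimod_alg \<Rightarrow> 'g \<Rightarrow> ('a \<Rightarrow> 'm) \<Rightarrow> 'a \<Rightarrow> 'm" where
  "hom_act G A M g f = (\<lambda>a. act M g (f (act A (inv\<^bsub>G\<^esub> g) a)))"

definition degenerated :: "('g, 'y) monoid_scheme \<Rightarrow> 'g set \<Rightarrow> 'g set \<Rightarrow> nat \<Rightarrow>
    ('g, 'k::field, 'a::{ring,monoid_mult}) mod_alg \<Rightarrow>
    ('g, 'k, 'a, 'm::{ring,monoid_mult}) bimod_alg \<Rightarrow> 'm \<Rightarrow> ('a \<Rightarrow> 'm) \<Rightarrow> bool" where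
  "degenerated G H \<rho> q A M m h \<longleftrightarrow>
     m \<in> fixed_by (act M) H UNIV \<and>
     h \<in> fixed_by (hom_act G A M) H (Der A M) \<and>
     (Delta (-) (act M) \<rho> ^^ (q - 1)) m = 1 \<and>
     (\<forall>a. Delta (\<lambda>f f' a. f a - f' a) (hom_act G A M) \<rho> h a + inner_der M m a = 0)"

section \<open>Hochschild cohomology\<close>

text \<open>
  Linear maps on the \<open>n\<close>-fold tensor power of \<open>A\<close> are represented by \<open>n\<close>-multilinear maps, that is,
  by functions on lists that are multilinear on lists of length \<open>n\<close> and vanish on all other lists.
\<close>

definition Cochains :: "('g, 'k::field, 'a::{ring,monoid_mult}) mod_alg \<Rightarrow>
    ('g, 'k, 'a, 'm::{ring,monoid_mult}) bimod_alg \<Rightarrow> nat \<Rightarrow> ('k, 'a list \<Rightarrow> 'm) module" where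
  "Cochains A M n =
     \<lparr>carrier = {f. (\<forall>xs. length xs \<noteq> n \<longrightarrow> f xs = 0) \<and>
                    (\<forall>xs i. length xs = n \<and> i < n \<longrightarrow>
                       Vector_Spaces.linear (scl A) (scl M) (\<lambda>a. f (xs[i := a])))},
      monoid.mult = undefined, one = undefined,
      ring.zero = (\<lambda>_. 0), add = (\<lambda>f g xs. f xs + g xs), module.smult = (\<lambda>c f xs. scl M c (f xs))\<rparr>"

definition hdiff :: "('g, 'k::field, 'a::{ring,monoid_mult}, 'm::{ring,monoid_mult}) bimod_alg \<Rightarrow>
    nat \<Rightarrow> ('a list \<Rightarrow> 'm) \<Rightarrow> 'a list \<Rightarrow> 'm" where
  "hdiff M n f = (\<lambda>xs. if length xs = Suc n then
       lmul M (hd xs) (f (tl xs))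
       + (\<Sum>i<n. scl M ((-1) ^ Suc i) (f (take i xs @ [xs ! i * xs ! Suc i] @ drop (i + 2) xs)))
       + scl M ((-1) ^ Suc n) (rmul M (f (butlast xs)) (last xs))
     else 0)"

definition cup :: "nat \<Rightarrow> nat \<Rightarrow> ('a list \<Rightarrow> 'm::{ring,monoid_mult}) \<Rightarrow> ('a list \<Rightarrow> 'm) \<Rightarrow> 'a list \<Rightarrow> 'm" where
  "cup i j f g = (\<lambda>xs. if length xs = i + j then f (take i xs) * g (drop i xs) else 0)"

definition unit_cochain :: "'a list \<Rightarrow> 'm::{ring,monoid_mult}" where
  "unit_cochain = (\<lambda>xs. if xs = [] then 1 else 0)"

definition coch_act :: "('g, 'y) monoid_scheme \<Rightarrow> ('g, 'k, 'a) mod_alg \<Rightarrow>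
    ('g, 'k, 'a, 'm) bimod_alg \<Rightarrow> 'g \<Rightarrow> ('a list \<Rightarrow> 'm) \<Rightarrow> 'a list \<Rightarrow> 'm" where
  "coch_act G A M g f = (\<lambda>xs. act M g (f (map (act A (inv\<^bsub>G\<^esub> g)) xs)))"

definition inv_Cochains :: "('g, 'y) monoid_scheme \<Rightarrow> ('g, 'k::field, 'a::{ring,monoid_mult}) mod_alg \<Rightarrow>
    ('g, 'k, 'a, 'm::{ring,monoid_mult}) bimod_alg \<Rightarrow> nat \<Rightarrow> ('k, 'a list \<Rightarrow> 'm) module" where
  "inv_Cochains G A M n = (Cochains A M n)
     \<lparr>carrier := fixed_by (coch_act G A M) (carrier G) (carrier (Cochains A M n))\<rparr>"

definition HH :: "('g, 'k::field, 'a::{ring,monoid_mult}) mod_alg \<Rightarrow>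
    ('g, 'k, 'a, 'm::{ring,monoid_mult}) bimod_alg \<Rightarrow> ('k, ('a list \<Rightarrow> 'm) set) gr_alg" where
  "HH A M = cohomology (Cochains A M) (hdiff M) cup unit_cochain"

text \<open>The cohomology of the \<open>G\<close>-invariant cochains.\<close>

definition HH_up :: "('g, 'y) monoid_scheme \<Rightarrow> ('g, 'k::field, 'a::{ring,monoid_mult}) mod_alg \<Rightarrow>
    ('g, 'k, 'a, 'm::{ring,monoid_mult}) bimod_alg \<Rightarrow> ('k, ('a list \<Rightarrow> 'm) set) gr_alg" where
  "HH_up G A M = cohomology (inv_Cochains G A M) (hdiff M) cup unit_cochain"

definition HH_act :: "('g, 'y) monoid_scheme \<Rightarrow> ('g, 'k, 'a) mod_alg \<Rightarrow>
    ('g, 'k, 'a, 'm) bimod_alg \<Rightarrow> 'g \<Rightarrow> ('a list \<Rightarrow> 'm) set \<Rightarrow> ('a list \<Rightarrow> 'm) set" where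
  "HH_act G A M g S = coch_act G A M g ` S"

text \<open>The \<open>S\<close>-invariants in degree \<open>n\<close>, used for \<open>S = H\<close> and \<open>S = carrier G\<close>.\<close>

definition HH_inv :: "('g, 'y) monoid_scheme \<Rightarrow> 'g set \<Rightarrow> ('g, 'k::field, 'a::{ring,monoid_mult}) mod_alg \<Rightarrow>
    ('g, 'k, 'a, 'm::{ring,monoid_mult}) bimod_alg \<Rightarrow> nat \<Rightarrow> ('a list \<Rightarrow> 'm) set set" where
  "HH_inv G S A M n = fixed_by (HH_act G A M) S (gcar (HH A M) n)"

definition HH_Delta :: "('g, 'y) monoid_scheme \<Rightarrow> 'g set \<Rightarrow> ('g, 'k::field, 'a::{ring,monoid_mult}) mod_alg \<Rightarrow>
    ('g, 'k, 'a, 'm::{ring,monoid_mult}) bimod_alg \<Rightarrow> nat \<Rightarrow>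
    ('a list \<Rightarrow> 'm) set \<Rightarrow> ('a list \<Rightarrow> 'm) set" where
  "HH_Delta G \<rho> A M n = Delta (\<lambda>x y. x \<ominus>\<^bsub>gcomp (HH A M) n\<^esub> y) (HH_act G A M) \<rho>"

text \<open>The map \<open>HH_up \<rightarrow> HH\<close> induced by the inclusion of complexes, in degree \<open>n\<close>.\<close>

definition Theta :: "('g, 'k::field, 'a::{ring,monoid_mult}) mod_alg \<Rightarrow>
    ('g, 'k, 'a, 'm::{ring,monoid_mult}) bimod_alg \<Rightarrow> nat \<Rightarrow>
    ('a list \<Rightarrow> 'm) set \<Rightarrow> ('a list \<Rightarrow> 'm) set" where
  "Theta A M n S = coboundaries (Cochains A M) (hdiff M) n <+>\<^bsub>Cochains A M n\<^esub> S"

definition AG :: "('g, 'y) monoid_scheme \<Rightarrow> ('g, 'k::field, 'a::{ring,monoid_mult}) mod_alg \<Rightarrow>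
    ('g, 'k, 'a, 'm::{ring,monoid_mult}) bimod_alg \<Rightarrow> ('k, ('a list \<Rightarrow> 'm) set) gr_alg" where
  "AG G A M = gr_restrict (HH A M) (\<lambda>n. Theta A M n ` gcar (HH_up G A M) n)"

text \<open>
  \<open>AG\<close> acts on the kernel \<open>XG\<close> of \<open>Theta\<close> through lifts along \<open>Theta\<close>; this does not depend on the
  lift as soon as the kernel has square zero.
\<close>

definition AG_lift :: "('g, 'y) monoid_scheme \<Rightarrow> ('g, 'k::field, 'a::{ring,monoid_mult}) mod_alg \<Rightarrow>
    ('g, 'k, 'a, 'm::{ring,monoid_mult}) bimod_alg \<Rightarrow> nat \<Rightarrow>
    ('a list \<Rightarrow> 'm) set \<Rightarrow> ('a list \<Rightarrow> 'm) set" where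
  "AG_lift G A M n b = (SOME b'. b' \<in> gcar (HH_up G A M) n \<and> Theta A M n b' = b)"

definition XG :: "('g, 'y) monoid_scheme \<Rightarrow> ('g, 'k::field, 'a::{ring,monoid_mult}) mod_alg \<Rightarrow>
    ('g, 'k, 'a, 'm::{ring,monoid_mult}) bimod_alg \<Rightarrow>
    ('k, ('a list \<Rightarrow> 'm) set, ('a list \<Rightarrow> 'm) set) gr_bimod" where
  "XG G A M =
     \<lparr>gcomp = gcomp (gr_restrict (HH_up G A M)
                (\<lambda>n. {x \<in> gcar (HH_up G A M) n. Theta A M n x = \<zero>\<^bsub>gcomp (HH A M) n\<^esub>})),
      glact = (\<lambda>i j b x. gmult (HH_up G A M) i j (AG_lift G A M i b) x),
      gract = (\<lambda>j i x b. gmult (HH_up G A M) j i x (AG_lift G A M i b))\<rparr>"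

definition YG :: "('g, 'y) monoid_scheme \<Rightarrow> ('g, 'k::field, 'a::{ring,monoid_mult}) mod_alg \<Rightarrow>
    ('g, 'k, 'a, 'm::{ring,monoid_mult}) bimod_alg \<Rightarrow>
    ('k, ('a list \<Rightarrow> 'm) set set, ('a list \<Rightarrow> 'm) set) gr_bimod" where
  "YG G A M = gr_quot
     \<lparr>gcomp = gcomp (gr_restrict (HH A M) (HH_inv G (carrier G) A M)),
      glact = gmult (HH A M), gract = gmult (HH A M)\<rparr>
     (gcar (AG G A M))"

end

theory Submission
  imports Defs "HOL-Library.Function_Algebras"
begin

text \<open>
  Let \<open>C\<close> be the complex of \<open>H\<close>-invariant Hochschild cochains and \<open>T\<close> the operator \<open>1 - \<rho>\<close> on it.
  As \<open>p\<close> does not divide \<open>|H|\<close>, averaging identifies the cohomology of \<open>C\<close> with the \<open>H\<close>-invariants of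
  Hochschild cohomology. As \<open>q\<close> is a power of the characteristic, \<open>T^q = 1 - \<rho>^q = 0\<close>, and
  \<open>ker T\<close> is the complex of \<open>G\<close>-invariant cochains, whose elements are called fixed below.
  The pair \<open>(m, h)\<close> enters through two facts only. A fixed cochain \<open>x\<close> is the norm
  \<open>T^(q-1) (x \<smile> m)\<close>; hence \<open>ker T^k = im T^(q-k)\<close> for all \<open>k\<close>. A fixed cocycle \<open>x\<close> satisfies
  \<open>d (x \<smile> m) = \<plusminus> x \<smile> dm = T (\<minusplus> x \<smile> h)\<close>, so that this coboundary is \<open>T\<close> of a cocycle. The locale
  \<open>norm_complex\<close> records these two facts, and the filtrations are built in it.

  The kernel \<open>X\<close> of the comparison map consists of the fixed coboundaries \<open>dy\<close> modulo the coboundaries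
  of fixed cochains. It is filtered by the power of \<open>T\<close> that kills \<open>y\<close>: the term \<open>X_j\<close> asks for
  \<open>T^(q-j) y = 0\<close>. An element of \<open>Y\<close> is represented by a cocycle \<open>z\<close> with \<open>T z = db\<close>; then
  \<open>T^(q-1) b\<close> is a fixed cocycle one degree below, and \<open>z\<close> lies in \<open>Y_i\<close> if it equals
  \<open>T^(i+1) y\<close> for some \<open>y\<close> with \<open>dy\<close> fixed. The rule \<open>z \<mapsto> dy\<close> induces the isomorphism
  \<open>Y_i / Y_(i+1) \<cong> X_(q-2-i) / X_(q-1-i)\<close>. It is onto because the fixed cocycle \<open>T^(i+1) y\<close> has
  some \<open>z\<close> above it (\<open>Xlevel_zigzag\<close>), its kernel is computed in \<open>zigzag_kernel\<close>, and it preserves degrees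
  because it passes one degree down and up again. Multiplication by a fixed cocycle commutes with every
  step, up to a sign that goes into \<open>y\<close> and \<open>b\<close>; so the isomorphism is one of bimodules.

  Suppose now that \<open>T^i\<close> maps the cohomology \<open>HH\<^sup>H\<close> onto the kernel of \<open>T\<close>. Every \<open>z\<close> as above is
  cohomologous to some \<open>T^i w\<close>, and \<open>T^(i+1) w = db\<close>. For \<open>i \<le> q - 2\<close>, taking \<open>y = T^(q-2-i) b\<close> shows
  \<open>z \<in> Y_i\<close>, with \<open>dy = T^(q-1) w\<close> a norm of a cocycle; for \<open>i = q - 1\<close>, the cocycle \<open>T^i w\<close> is fixed,
  and so \<open>Y = 0\<close>. Thus \<open>Y_i = Y\<close>, the layers before \<open>i\<close> vanish,
  \<open>X_(q-1-i) = 0\<close>, and \<open>X_(q-2-i)\<close> consists of norms of cocycles. The remaining claims \<open>Y_(i+1) = 0\<close>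
  and \<open>X_(q-2-i) = X\<close> are proved together by induction on the degree: \<open>Y_(i+1)\<close> in degree \<open>n\<close> is
  controlled by \<open>X\<close> in degree \<open>n - 1\<close> (\<open>Ylevel_vanish_step\<close>), and it controls \<open>X\<close> in degree \<open>n\<close> through
  the isomorphisms of layers.

  The graded objects are cosets, cosets of cosets, and so on, of functions on lists. They are all
  treated as linear images of spaces of cochains (\<open>lin_onto\<close>), so that module axioms,
  compatibility with the actions and the isomorphisms are checked on cochains.
\<close>

section \<open>Filtrations from a nilpotent operator on a complex\<close>

text \<open>
  The complex is indexed one step up: \<open>E 0 = 0\<close> and \<open>E (Suc n)\<close> stands for the cochains of degree \<open>n\<close>.
  The coboundaries of degree \<open>n\<close> are then \<open>D n ` E n\<close> in every degree, zero included. In the last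
  two conditions \<open>b\<close> stands for \<open>x \<smile> m\<close> and \<open>z\<close> for \<open>x \<smile> h\<close> up to sign.
\<close>

locale norm_complex =
  fixes E :: "nat \<Rightarrow> 'c::ab_group_add set"
    and D :: "nat \<Rightarrow> 'c \<Rightarrow> 'c"
    and T :: "'c \<Rightarrow> 'c"
    and q :: nat
  assumes q_pos: "0 < q"
    and E_0: "E 0 = {0}"
    and zero_in: "0 \<in> E n"
    and diff_in: "\<lbrakk>x \<in> E n; y \<in> E n\<rbrakk> \<Longrightarrow> x - y \<in> E n"
    and D_in: "x \<in> E n \<Longrightarrow> D n x \<in> E (Suc n)"
    and D_diff: "D n (x - y) = D n x - D n y"
    and D_D: "D (Suc n) (D n x) = 0"
    and T_in: "x \<in> E n \<Longrightarrow> T x \<in> E n"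
    and T_diff: "T (x - y) = T x - T y"
    and T_D: "T (D n x) = D n (T x)"
    and T_nilpotent: "x \<in> E n \<Longrightarrow> (T ^^ q) x = 0"
    and norm_onto: "\<lbrakk>x \<in> E n; T x = 0\<rbrakk> \<Longrightarrow> \<exists>b \<in> E n. (T ^^ (q - 1)) b = x"
    and norm_transgression: "\<lbrakk>x \<in> E n; T x = 0; D n x = 0\<rbrakk> \<Longrightarrow>
      \<exists>b \<in> E n. \<exists>z \<in> E (Suc n). D (Suc n) z = 0 \<and> (T ^^ (q - 1)) b = x \<and> D n b = T z"
begin

lemma D_0: "D n 0 = 0"
  using D_diff[of n 0 0] by simp

lemma T_0: "T 0 = 0"
  using T_diff[of 0 0] by simp

lemma D_uminus: "D n (- x) = - D n x"
  using D_diff[of n 0 x] by (simp add: D_0)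

lemma T_uminus: "T (- x) = - T x"
  using T_diff[of 0 x] by (simp add: T_0)

lemma D_add: "D n (x + y) = D n x + D n y"
  using D_diff[of n x "- y"] by (simp add: D_uminus)

lemma T_add: "T (x + y) = T x + T y"
  using T_diff[of x "- y"] by (simp add: T_uminus)

lemma uminus_in: "x \<in> E n \<Longrightarrow> - x \<in> E n"
  using diff_in[OF zero_in, of x] by simp

lemma add_in: "\<lbrakk>x \<in> E n; y \<in> E n\<rbrakk> \<Longrightarrow> x + y \<in> E n"
  using diff_in[OF _ uminus_in, of x n y] by simp

lemma Tp_in: "x \<in> E n \<Longrightarrow> (T ^^ k) x \<in> E n"
  by (induction k) (auto intro: T_in)

lemma Tp_diff: "(T ^^ k) (x - y) = (T ^^ k) x - (T ^^ k) y"
  by (induction k) (auto simp: T_diff)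

lemma Tp_0: "(T ^^ k) 0 = 0"
  by (induction k) (auto simp: T_0)

lemma Tp_add: "(T ^^ k) (x + y) = (T ^^ k) x + (T ^^ k) y"
  by (induction k) (auto simp: T_add)

lemma Tp_D: "(T ^^ k) (D n x) = D n ((T ^^ k) x)"
  by (induction k) (auto simp: T_D)

lemma Tp_T: "(T ^^ k) (T x) = (T ^^ Suc k) x"
  by (simp add: funpow_swap1)

lemma Tp_Tp: "(T ^^ k) ((T ^^ l) x) = (T ^^ (k + l)) x"
  by (simp add: funpow_add)

lemma Tp_nilpotent:
  assumes "x \<in> E n" "q \<le> k"
  shows "(T ^^ k) x = 0"
proof -
  have "(T ^^ k) x = (T ^^ (k - q)) ((T ^^ q) x)"
    using assms(2) by (simp add: Tp_Tp)
  then show ?thesis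
    using T_nilpotent[OF assms(1)] by (simp add: Tp_0)
qed

lemma T_norm:
  assumes "x \<in> E n"
  shows "T ((T ^^ (q - 1)) x) = 0"
proof -
  have "T ((T ^^ (q - 1)) x) = (T ^^ Suc (q - 1)) x" by simp
  also have "\<dots> = 0" by (rule Tp_nilpotent[OF assms]) simp
  finally show ?thesis .
qed

lemma Tp_ker_mono: "\<lbrakk>(T ^^ k) x = 0; k \<le> l\<rbrakk> \<Longrightarrow> (T ^^ l) x = 0"
  by (metis Tp_0 Tp_Tp le_add_diff_inverse2)

text \<open>
  The complex is free over the truncated polynomial ring in \<open>T\<close>. For the induction, \<open>T^k x\<close> is fixed
  and hence a norm \<open>T^(q-1) b\<close>; subtracting \<open>T^(q-1-k) b\<close> from \<open>x\<close> lowers the power of \<open>T\<close> that kills it.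
\<close>

lemma Tp_ker_eq_image:
  assumes "x \<in> E n" "(T ^^ k) x = 0" "k \<le> q"
  shows "\<exists>y \<in> E n. x = (T ^^ (q - k)) y"
  using assms
proof (induction k arbitrary: x)
  case 0
  then show ?case using zero_in[of n] by (auto simp: Tp_0 intro!: bexI[of _ 0])
next
  case (Suc k)
  have "T ((T ^^ k) x) = 0" using Suc.prems by simp
  then obtain b where b: "b \<in> E n" "(T ^^ (q - 1)) b = (T ^^ k) x"
    using norm_onto[OF Tp_in[OF Suc.prems(1)]] by blast
  define y where "y = (T ^^ (q - Suc k)) b"
  have y: "y \<in> E n" "(T ^^ k) y = (T ^^ k) x"
    using b Suc.prems(3) by (auto simp: y_def Tp_Tp intro: Tp_in)
  then have "(T ^^ k) (x - y) = 0" by (simp add: Tp_diff)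
  then obtain c where c: "c \<in> E n" "x - y = (T ^^ (q - k)) c"
    using Suc.IH[of "x - y"] Suc.prems y diff_in by auto
  have "x = (T ^^ (q - Suc k)) (b + T c)"
    using c(2) Suc.prems(3) by (simp add: Tp_add Tp_T y_def[symmetric] algebra_simps Suc_diff_Suc)
  then show ?case using b(1) c(1) add_in T_in by blast
qed

definition Z :: "nat \<Rightarrow> 'c set" where
  "Z n = {z \<in> E n. D n z = 0}"

lemma Z_diff: "\<lbrakk>x \<in> Z n; y \<in> Z n\<rbrakk> \<Longrightarrow> x - y \<in> Z n"
  by (auto simp: Z_def diff_in D_diff)

lemma Z_add: "\<lbrakk>x \<in> Z n; y \<in> Z n\<rbrakk> \<Longrightarrow> x + y \<in> Z n"
  by (auto simp: Z_def add_in D_add)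

lemma Z_Tp: "x \<in> Z n \<Longrightarrow> (T ^^ k) x \<in> Z n"
  by (auto simp: Z_def Tp_in Tp_D[symmetric] Tp_0)

lemma D_in_Z: "x \<in> E n \<Longrightarrow> D n x \<in> Z (Suc n)"
  by (auto simp: Z_def D_in D_D)

text \<open>
  The norm of \<open>g\<close> is a fixed cocycle, and \<open>g\<close> differs by an element of the image of \<open>T\<close> from the \<open>b\<close> that
  \<open>norm_transgression\<close> provides for it. This extends the transgression from fixed cocycles to all \<open>g\<close>
  whose coboundary has norm zero.
\<close>

lemma coboundary_in_T_image: 
  assumes g: "g \<in> E n" "(T ^^ (q - 1)) (D n g) = 0"
  shows "\<exists>z \<in> Z (Suc n). D n g = T z"
proof -
  define x where "x = (T ^^ (q - 1)) g"
  have x: "x \<in> E n" "T x = 0" "D n x = 0"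
    using g T_norm[OF g(1)] by (auto simp: x_def Tp_in Tp_D[symmetric])
  then obtain b z where b: "b \<in> E n" "z \<in> E (Suc n)" "D (Suc n) z = 0"
      "(T ^^ (q - 1)) b = x" "D n b = T z"
    using norm_transgression by blast
  have "(T ^^ (q - 1)) (g - b) = 0"
    using b(4) by (simp add: Tp_diff x_def)
  then obtain e where e: "e \<in> E n" "g - b = T e"
    using Tp_ker_eq_image[of "g - b" n "q - 1"] g b diff_in q_pos by auto
  have "D n g = D n (b + T e)" using e(2) by (simp add: algebra_simps)
  also have "\<dots> = T (z + D n e)"
    using b(5) by (simp add: D_add T_add T_D)
  finally show ?thesis
    using b e by (intro bexI[of _ "z + D n e"]) (auto simp: Z_def D_add D_D add_in D_in)
qed

text \<open>
  For \<open>l = 1\<close> these are the coboundaries of the fixed complex, for \<open>l = q\<close> all coboundaries that are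
  fixed. The quotient of the latter by the former is the kernel of the comparison map.
\<close>

definition Xlevel :: "nat \<Rightarrow> nat \<Rightarrow> 'c set" where
  "Xlevel l n = {D n y | y. y \<in> E n \<and> (T ^^ l) y = 0 \<and> T (D n y) = 0}"

text \<open>
  The correspondence between the two filtrations: from \<open>z\<close> down to \<open>b\<close> by \<open>T z = D n b\<close>, then by the norm of \<open>b\<close>
  to \<open>y\<close>, and up again to \<open>D n y\<close>, which stands in the degree of \<open>z\<close>.
\<close>

definition zigzag :: "nat \<Rightarrow> nat \<Rightarrow> 'c \<Rightarrow> 'c \<Rightarrow> bool" where
  "zigzag i n z y \<longleftrightarrow> z \<in> Z (Suc n) \<and> y \<in> E n \<and> T (D n y) = 0 \<and>
     (\<exists>b \<in> E n. T z = D n b \<and> (T ^^ (q - 1)) b = (T ^^ Suc i) y)"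

definition Ylevel :: "nat \<Rightarrow> nat \<Rightarrow> 'c set" where
  "Ylevel i n = {z. \<exists>y. zigzag i n z y}"

definition invariant_class :: "nat \<Rightarrow> 'c set" where
  "invariant_class n = {z \<in> Z (Suc n). \<exists>b \<in> E n. T z = D n b}"

definition invariant_rep :: "nat \<Rightarrow> 'c set" where
  "invariant_rep n = {z + D n c | z c. z \<in> Z (Suc n) \<and> T z = 0 \<and> c \<in> E n}"

lemma Xlevel_I: "\<lbrakk>y \<in> E n; (T ^^ l) y = 0; T (D n y) = 0\<rbrakk> \<Longrightarrow> D n y \<in> Xlevel l n"
  by (auto simp: Xlevel_def)

lemma Xlevel_mono: "l \<le> l' \<Longrightarrow> Xlevel l n \<subseteq> Xlevel l' n"
  unfolding Xlevel_def using Tp_ker_mono by blast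

lemma Xlevel_diff:
  assumes "x \<in> Xlevel l n" "x' \<in> Xlevel l n"
  shows "x - x' \<in> Xlevel l n"
proof -
  obtain y y' where "y \<in> E n" "(T ^^ l) y = 0" "T (D n y) = 0" "x = D n y"
    "y' \<in> E n" "(T ^^ l) y' = 0" "T (D n y') = 0" "x' = D n y'"
    using assms by (auto simp: Xlevel_def)
  then show ?thesis
    using Xlevel_I[of "y - y'" n l] by (simp add: D_diff T_diff Tp_diff diff_in)
qed

lemma Xlevel_in: "x \<in> Xlevel l n \<Longrightarrow> x \<in> Z (Suc n) \<and> T x = 0"
  by (auto simp: Xlevel_def D_in_Z)

lemma Xlevel_q: "Xlevel q n = {x. T x = 0 \<and> x \<in> D n ` E n}"
  by (auto simp: Xlevel_def T_nilpotent)

lemma Xlevel_1: "Xlevel 1 n = D n ` {y \<in> E n. T y = 0}"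
  by (auto simp: Xlevel_def T_D D_0)

lemma zigzagI: "\<lbrakk>z \<in> Z (Suc n); y \<in> E n; T (D n y) = 0; b \<in> E n; T z = D n b;
    (T ^^ (q - 1)) b = (T ^^ Suc i) y\<rbrakk> \<Longrightarrow> zigzag i n z y"
  unfolding zigzag_def by blast

lemma zigzagE:
  assumes "zigzag i n z y"
  obtains b where "z \<in> Z (Suc n)" "y \<in> E n" "T (D n y) = 0" "b \<in> E n" "T z = D n b"
    "(T ^^ (q - 1)) b = (T ^^ Suc i) y"
  using assms unfolding zigzag_def by blast

lemma zigzag_diff:
  assumes "zigzag i n z y" "zigzag i n z' y'"
  shows "zigzag i n (z - z') (y - y')"
proof -
  obtain b b' where
    b: "z \<in> Z (Suc n)" "y \<in> E n" "T (D n y) = 0" "b \<in> E n" "T z = D n b"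
    "(T ^^ (q - 1)) b = (T ^^ Suc i) y" and
    b': "z' \<in> Z (Suc n)" "y' \<in> E n" "T (D n y') = 0" "b' \<in> E n" "T z' = D n b'"
    "(T ^^ (q - 1)) b' = (T ^^ Suc i) y'"
    using assms by (meson zigzagE)
  show ?thesis
    by (rule zigzagI[of _ _ _ "b - b'"])
      (use b b' in \<open>auto simp: Z_diff diff_in D_diff T_diff Tp_diff simp del: funpow.simps\<close>)
qed

lemma zigzag_0: "zigzag i n 0 0"
  by (rule zigzagI[of _ _ _ 0]) (auto simp: Z_def zero_in D_0 T_0 Tp_0 simp del: funpow.simps)

lemma zigzag_add: "\<lbrakk>zigzag i n z y; zigzag i n z' y'\<rbrakk> \<Longrightarrow> zigzag i n (z + z') (y + y')"
  using zigzag_diff[OF _ zigzag_diff[OF zigzag_0], of i n z y z' y'] by simp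

lemma Ylevel_diff: "\<lbrakk>z \<in> Ylevel i n; z' \<in> Ylevel i n\<rbrakk> \<Longrightarrow> z - z' \<in> Ylevel i n"
  unfolding Ylevel_def using zigzag_diff by blast

lemma Ylevel_in: "z \<in> Ylevel i n \<Longrightarrow> z \<in> invariant_class n"
  by (auto simp: Ylevel_def invariant_class_def zigzag_def)

lemma Ylevel_sub: "Ylevel i n \<subseteq> invariant_class n"
  using Ylevel_in by blast

lemma zigzag_invariant_rep: 
  assumes "z \<in> invariant_rep n"
  shows "zigzag i n z 0"
proof -
  obtain u c where u: "z = u + D n c" "u \<in> Z (Suc n)" "T u = 0" "c \<in> E n"
    using assms by (auto simp: invariant_rep_def)
  show ?thesis
    by (rule zigzagI[of _ _ _ "T c"])
      (use u q_pos in \<open>auto simp: Z_add D_in_Z zero_in T_in D_0 T_0 T_add T_D Tp_0 Tp_T T_nilpotent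
        simp del: funpow.simps\<close>)
qed

lemma invariant_rep_subset: "invariant_rep n \<subseteq> Ylevel i n"
  using zigzag_invariant_rep by (auto simp: Ylevel_def)

text \<open>
  At the last level the norm of \<open>b\<close> is \<open>T^q y = 0\<close>; so \<open>b = T c\<close>, and \<open>z - D n c\<close> is fixed.
\<close>

lemma Ylevel_last: "Ylevel (q - 1) n = invariant_rep n"
proof
  show "Ylevel (q - 1) n \<subseteq> invariant_rep n"
  proof
    fix z assume "z \<in> Ylevel (q - 1) n"
    then obtain y where "zigzag (q - 1) n z y" by (auto simp: Ylevel_def)
    then obtain b where b: "z \<in> Z (Suc n)" "y \<in> E n" "b \<in> E n" "T z = D n b"
      "(T ^^ (q - 1)) b = (T ^^ Suc (q - 1)) y"
      by (meson zigzagE)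
    have "(T ^^ (q - 1)) b = 0"
      using b q_pos T_nilpotent[OF b(2)] by simp
    then obtain c where c: "c \<in> E n" "b = T c"
      using Tp_ker_eq_image[of b n "q - 1"] b q_pos by auto
    have "T (z - D n c) = 0" using b c by (simp add: T_diff T_D)
    then have "(z - D n c) + D n c \<in> invariant_rep n"
      unfolding invariant_rep_def using b(1) c(1) Z_diff D_in_Z by blast
    then show "z \<in> invariant_rep n" by simp
  qed
qed (rule invariant_rep_subset)

lemma Ylevel_first: "Ylevel 0 n = invariant_class n"
proof
  show "invariant_class n \<subseteq> Ylevel 0 n"
  proof
    fix z assume "z \<in> invariant_class n"
    then obtain b where b: "z \<in> Z (Suc n)" "b \<in> E n" "T z = D n b"
      by (auto simp: invariant_class_def)
    show "z \<in> Ylevel 0 n"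
    \<comment> \<open>For \<open>q = 1\<close> the exponent \<open>q - 2\<close> of the general argument truncates; but then \<open>T = 0\<close>.\<close>
    proof (cases "q = 1")
      case True
      then have "T z = 0" using T_nilpotent[of z "Suc n"] b by (simp add: Z_def)
      then have "zigzag 0 n z 0"
        by (intro zigzagI[of _ _ _ 0]) (use b in \<open>auto simp: zero_in D_0 T_0 Tp_0\<close>)
      then show ?thesis by (auto simp: Ylevel_def)
    next
      case False
      define y where "y = (T ^^ (q - 2)) b"
      have q: "Suc (q - 2) = q - 1" "Suc (q - 1) = q" using False q_pos by auto
      have "T (D n y) = (T ^^ q) z"
        using b(3) q by (metis Tp_D Tp_T funpow.simps(2) o_apply y_def)
      also have "\<dots> = 0" using b(1) T_nilpotent[of z "Suc n"] by (simp add: Z_def)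
      finally have "zigzag 0 n z y"
        by (intro zigzagI[of _ _ _ b])
          (use b q(1)[symmetric] in \<open>auto simp: y_def Tp_in\<close>)
      then show ?thesis by (auto simp: Ylevel_def)
    qed
  qed
qed (rule Ylevel_sub)

lemma Ylevel_Suc: "Ylevel (Suc i) n \<subseteq> Ylevel i n"
proof
  fix z assume "z \<in> Ylevel (Suc i) n"
  then obtain y where "zigzag (Suc i) n z y" by (auto simp: Ylevel_def)
  then obtain b where b: "z \<in> Z (Suc n)" "y \<in> E n" "T (D n y) = 0" "b \<in> E n" "T z = D n b"
      "(T ^^ (q - 1)) b = (T ^^ Suc (Suc i)) y" 
    by (meson zigzagE)
  have "zigzag i n z (T y)"
    by (rule zigzagI[of _ _ _ b]) (use b in \<open>auto simp: T_in T_D D_0 T_0 Tp_T simp del: funpow.simps\<close>)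
  then show "z \<in> Ylevel i n" by (auto simp: Ylevel_def)
qed

lemma zigzag_Xlevel:
  assumes "zigzag i n z y"
  shows "D n y \<in> Xlevel (i + 2) n"
proof -
  obtain b where b: "y \<in> E n" "T (D n y) = 0" "b \<in> E n"
      "(T ^^ (q - 1)) b = (T ^^ Suc i) y" 
    using assms by (meson zigzagE)
  have "(T ^^ (i + 2)) y = T ((T ^^ (q - 1)) b)" using b(4) by simp
  also have "\<dots> = 0" by (rule T_norm[OF b(3)])
  finally show ?thesis using b Xlevel_I by blast
qed

lemma Xlevel_zigzag:
  assumes "x \<in> Xlevel (i + 2) n"
  shows "\<exists>z y. zigzag i n z y \<and> x = D n y"
proof -
  obtain y where y: "y \<in> E n" "(T ^^ (i + 2)) y = 0" "T (D n y) = 0" "x = D n y"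
    using assms by (auto simp: Xlevel_def)
  define u where "u = (T ^^ Suc i) y"
  have "D n u = (T ^^ i) (T (D n y))"
    by (metis Tp_D Tp_T u_def)
  then have u: "u \<in> E n" "T u = 0" "D n u = 0"
    using y Tp_in[OF y(1), of "Suc i"] by (auto simp: u_def Tp_0)
  then obtain b z where b: "b \<in> E n" "z \<in> E (Suc n)" "D (Suc n) z = 0"
      "(T ^^ (q - 1)) b = u" "D n b = T z"
    using norm_transgression by blast
  have "zigzag i n z y"
    by (rule zigzagI[of _ _ _ b]) (use b y in \<open>auto simp: Z_def u_def\<close>)
  then show ?thesis using y by blast
qed

text \<open>
  The correspondence is injective on layers. If \<open>z\<close> has a zigzag of the next level to some \<open>y'\<close>, then \<open>y\<close>
  can be corrected by elements with zero coboundary, namely \<open>T y'\<close> and a power of \<open>T\<close> applied to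
  \<open>b - b'\<close>, until \<open>T^(i+1)\<close> kills it. Conversely, if \<open>D n y = D n y'\<close> with \<open>y'\<close> killed by \<open>T^(i+1)\<close>, then
  the cocycle \<open>v = y - y'\<close> has the same image under \<open>T^(i+1)\<close> as \<open>y\<close>. If \<open>i + 2 < q\<close>, then \<open>v\<close> is in the
  image of \<open>T\<close>, which raises the level. If \<open>i + 2 = q\<close>, then \<open>b - v\<close> has norm zero.
\<close>

lemma zigzag_kernel:
  assumes r: "zigzag i n z y" and i: "i + 2 \<le> q"
  shows "z \<in> Ylevel (Suc i) n \<longleftrightarrow> D n y \<in> Xlevel (Suc i) n"
proof
  obtain b where b: "z \<in> Z (Suc n)" "y \<in> E n" "T (D n y) = 0" "b \<in> E n" "T z = D n b"
      "(T ^^ (q - 1)) b = (T ^^ Suc i) y" 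
    using r by (meson zigzagE)
  {
    assume "z \<in> Ylevel (Suc i) n"
    then obtain y' where "zigzag (Suc i) n z y'" by (auto simp: Ylevel_def)
    then obtain b' where b': "y' \<in> E n" "T (D n y') = 0" "b' \<in> E n" "T z = D n b'"
      "(T ^^ (q - 1)) b' = (T ^^ Suc (Suc i)) y'" 
      by (meson zigzagE)
    define y1 where "y1 = y - ((T ^^ (q - 2 - i)) (b - b') + T y')"
    have y1: "y1 \<in> E n" using b b' by (auto simp: y1_def intro!: diff_in add_in Tp_in T_in)
    have "(T ^^ Suc i) y1 = (T ^^ Suc i) y - ((T ^^ (Suc i + (q - 2 - i))) (b - b') + (T ^^ Suc (Suc i)) y')"
      by (simp only: y1_def Tp_diff Tp_add Tp_Tp Tp_T)
    also have "Suc i + (q - 2 - i) = q - 1" using i by simp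
    finally have T1: "(T ^^ Suc i) y1 = 0" using b(6) b'(5) by (simp add: Tp_diff)
    have "D n (b - b') = 0" using b(5) b'(4) by (simp add: D_diff)
    then have "D n y1 = D n y"
      using b'(2) by (simp add: y1_def D_diff D_add Tp_D[symmetric] T_D[symmetric] Tp_0)
    then show "D n y \<in> Xlevel (Suc i) n"
      using Xlevel_I[OF y1 T1] b(3) by simp
  next
    assume "D n y \<in> Xlevel (Suc i) n"
    then obtain y' where y': "y' \<in> E n" "(T ^^ Suc i) y' = 0" "D n y = D n y'"
      by (auto simp: Xlevel_def)
    define v where "v = y - y'"
    have v: "v \<in> E n" "D n v = 0" "(T ^^ Suc i) v = (T ^^ (q - 1)) b"
      using b y' by (auto simp: v_def diff_in D_diff Tp_diff simp del: funpow.simps)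
    show "z \<in> Ylevel (Suc i) n"
    proof (cases "i + 2 = q")
      case True
      then have [simp]: "Suc i = q - 1" by simp
      have "zigzag (Suc i) n z 0"
        by (rule zigzagI[of _ _ _ "b - v"])
          (use b v in \<open>auto simp: zero_in D_0 T_0 Tp_0 D_diff Tp_diff diff_in simp del: funpow.simps\<close>)
      then show ?thesis by (auto simp: Ylevel_def)
    next
      case False
      have "(T ^^ (i + 2)) v = T ((T ^^ (q - 1)) b)" using v(3) by simp
      also have "\<dots> = 0" by (rule T_norm[OF b(4)])
      finally obtain w where w: "w \<in> E n" "v = (T ^^ (q - (i + 2))) w"
        using Tp_ker_eq_image[of v n "i + 2"] v(1) i by auto
      define u where "u = (T ^^ (q - (i + 2) - 1)) w"
      have "q - (i + 2) = Suc (q - (i + 2) - 1)" using False i by simp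
      then have "(T ^^ (q - (i + 2))) w = T u"
        unfolding u_def by (metis funpow.simps(2) o_apply)
      then have u: "u \<in> E n" "v = T u"
        using w Tp_in by (auto simp: u_def)
      have "zigzag (Suc i) n z u"
        by (rule zigzagI[of _ _ _ b])
          (use b v u in \<open>auto simp: T_D Tp_T simp del: funpow.simps(2)\<close>)
      then show ?thesis by (auto simp: Ylevel_def)
    qed
  }
qed

lemma Ylevel_mono: "i \<le> j \<Longrightarrow> Ylevel j n \<subseteq> Ylevel i n"
  by (induction j rule: dec_induct) (use Ylevel_Suc in blast)+

text \<open>
  If two adjacent terms of the filtration of \<open>Y\<close> agree, so do the corresponding terms of that of \<open>X\<close>, by
  surjectivity of the correspondence and \<open>zigzag_kernel\<close>.
\<close>

lemma Xlevel_step: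
  assumes "i + 2 \<le> q" "Ylevel i n \<subseteq> Ylevel (Suc i) n"
  shows "Xlevel (i + 2) n \<subseteq> Xlevel (Suc i) n"
proof
  fix x assume "x \<in> Xlevel (i + 2) n"
  then obtain z y where r: "zigzag i n z y" "x = D n y" using Xlevel_zigzag by blast
  then have "z \<in> Ylevel (Suc i) n" using assms(2) by (auto simp: Ylevel_def)
  then show "x \<in> Xlevel (Suc i) n" using zigzag_kernel[OF r(1) assms(1)] r(2) by simp
qed

lemma Xlevel_collapse:
  assumes "i \<le> j" "j < q" "Ylevel i n \<subseteq> Ylevel j n"
  shows "Xlevel (Suc j) n \<subseteq> Xlevel (Suc i) n"
  using assms
proof (induction j rule: dec_induct)
  case (step j)
  have "Ylevel j n \<subseteq> Ylevel (Suc j) n" "Ylevel i n \<subseteq> Ylevel j n"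
    using step.prems step.hyps Ylevel_mono[of i j n] Ylevel_Suc[of j n] by auto
  then have "Xlevel (j + 2) n \<subseteq> Xlevel (Suc j) n"
    using Xlevel_step[of j n] step.prems by simp
  moreover have "Xlevel (Suc j) n \<subseteq> Xlevel (Suc i) n"
    using step.IH step.prems \<open>Ylevel i n \<subseteq> Ylevel j n\<close> by simp
  ultimately show ?case by auto
qed simp

text \<open>
  The two hypotheses below express on cocycles that \<open>T^i\<close> maps the cohomology of the complex onto its
  classes fixed by \<open>T\<close>, in all degrees.
\<close>

context
  fixes i
  assumes i: "i < q"
    and hyp_im: "\<And>n z. z \<in> invariant_class n \<Longrightarrow> \<exists>w \<in> Z (Suc n). \<exists>c \<in> E n. z = (T ^^ i) w + D n c"
    and hyp_ker: "\<And>n w. w \<in> Z (Suc n) \<Longrightarrow> \<exists>c \<in> E n. (T ^^ Suc i) w = D n c"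
begin

text \<open>
  If \<open>z\<close> is cohomologous to \<open>T^i w\<close> and \<open>T^(i+1) w = D n b\<close>, then \<open>y = T^(q-2-i) b\<close> completes a zigzag, because
  the powers of \<open>T\<close> on both sides add up to the norm.
\<close>

lemma zigzag_of_power:
  assumes "i + 2 \<le> q" "z \<in> invariant_class n"
  shows "\<exists>w \<in> Z (Suc n). \<exists>y. zigzag i n z y \<and> D n y = (T ^^ (q - 1)) w"
proof -
  obtain w c where w: "w \<in> Z (Suc n)" "c \<in> E n" "z = (T ^^ i) w + D n c"
    using hyp_im[OF assms(2)] by blast
  obtain b where b: "b \<in> E n" "(T ^^ Suc i) w = D n b"
    using hyp_ker[OF w(1)] by blast
  define y where "y = (T ^^ (q - 2 - i)) b"
  have "D n y = (T ^^ (q - 2 - i + Suc i)) w"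
    by (simp only: y_def Tp_D[symmetric] b(2)[symmetric] Tp_Tp)
  also have "q - 2 - i + Suc i = q - 1" using assms(1) by simp
  finally have y: "D n y = (T ^^ (q - 1)) w" .
  have "T ((T ^^ (q - 1)) w) = 0" using w(1) T_norm by (auto simp: Z_def)
  then have Ty: "T (D n y) = 0" by (simp add: y)
  have "zigzag i n z y"
  proof (rule zigzagI[of _ _ _ "b + T c"])
    show "T z = D n (b + T c)" using w(3) b(2) by (simp add: T_add D_add T_D)
    have "(T ^^ (q - 1)) (T c) = 0"
      unfolding Tp_T using w(2) by (intro Tp_nilpotent) auto
    moreover have "Suc i + (q - 2 - i) = q - 1" using assms(1) by simp
    then have "(T ^^ Suc i) y = (T ^^ (q - 1)) b" by (simp only: y_def Tp_Tp)
    ultimately show "(T ^^ (q - 1)) (b + T c) = (T ^^ Suc i) y" by (simp add: Tp_add)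
  qed (use assms b w Ty in \<open>auto simp: invariant_class_def y_def Tp_in T_in add_in\<close>)
  then show ?thesis using y w(1) by blast
qed

lemma Ylevel_full: "Ylevel i n = invariant_class n"
proof
  show "invariant_class n \<subseteq> Ylevel i n"
  proof
    fix z assume z: "z \<in> invariant_class n"
    show "z \<in> Ylevel i n"
    proof (cases "i + 2 \<le> q")
      case True
      then show ?thesis using zigzag_of_power[OF True z] by (auto simp: Ylevel_def)
    next
      case False
      then have iq: "i = q - 1" using i by simp
      obtain w c where w: "w \<in> Z (Suc n)" "c \<in> E n" "z = (T ^^ i) w + D n c"
        using hyp_im[OF z] by blast
      have "T ((T ^^ i) w) = 0" using w(1) T_norm iq by (auto simp: Z_def)
      then have "z \<in> invariant_rep n"
        unfolding invariant_rep_def using w Z_Tp by blast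
      then show ?thesis using invariant_rep_subset by blast
    qed
  qed
qed (rule Ylevel_sub)

lemma Xlevel_vanish: "Xlevel (Suc i) n \<subseteq> Xlevel 1 n"
  using Xlevel_collapse[of 0 i n] Ylevel_full[of n] Ylevel_first[of n] i by simp

lemma Xlevel_norm:
  assumes "i + 2 \<le> q" "x \<in> Xlevel (i + 2) n"
  shows "\<exists>w \<in> Z (Suc n). x - (T ^^ (q - 1)) w \<in> Xlevel 1 n"
proof -
  obtain z y where r: "zigzag i n z y" "x = D n y" using Xlevel_zigzag[OF assms(2)] by blast
  then have "z \<in> invariant_class n" using Ylevel_in by (auto simp: Ylevel_def)
  then obtain w y' where w: "w \<in> Z (Suc n)" "zigzag i n z y'" "D n y' = (T ^^ (q - 1)) w"
    using zigzag_of_power[OF assms(1)] by blast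
  have "zigzag i n 0 (y - y')" using zigzag_diff[OF r(1) w(2)] by simp
  moreover have "0 \<in> Ylevel (Suc i) n" using zigzag_0 by (auto simp: Ylevel_def)
  ultimately have "D n (y - y') \<in> Xlevel (Suc i) n" using zigzag_kernel assms(1) by blast
  then show ?thesis using w r(2) Xlevel_vanish by (auto simp: D_diff)
qed

text \<open>
  The common value \<open>x\<close> of the norm of \<open>b\<close> and of \<open>T^(i+1) (T y)\<close> is a fixed coboundary by hypothesis. In
  the degree below, all fixed coboundaries are norms of cocycles modulo coboundaries of fixed cochains; as fixed
  cochains are norms too, \<open>x\<close> is the norm of a cocycle \<open>w\<close>. Replacing \<open>b\<close> by \<open>b - w\<close> makes the norm vanish.
\<close>

lemma Ylevel_vanish_step:
  assumes "i + 2 \<le> q" and prev: "n \<noteq> 0 \<Longrightarrow> Xlevel q (n - 1) \<subseteq> Xlevel (i + 2) (n - 1)"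
  shows "Ylevel (Suc i) n \<subseteq> Ylevel (q - 1) n"
proof
  fix z assume "z \<in> Ylevel (Suc i) n"
  then obtain y where "zigzag (Suc i) n z y" by (auto simp: Ylevel_def)
  then obtain b where b: "z \<in> Z (Suc n)" "y \<in> E n" "T (D n y) = 0" "b \<in> E n" "T z = D n b"
      "(T ^^ (q - 1)) b = (T ^^ Suc (Suc i)) y" 
    by (meson zigzagE)
  have "\<exists>w \<in> Z n. (T ^^ (q - 1)) b = (T ^^ (q - 1)) w"
  proof (cases n)
    case 0
    then have "b = 0" using b E_0 by simp
    then show ?thesis by (intro bexI[of _ 0]) (auto simp: Z_def zero_in D_0)
  next
    case (Suc k)
    have Ty: "T y \<in> Z n" using b by (auto simp: Z_def T_in T_D)
    define x where "x = (T ^^ (q - 1)) b"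
    have x: "x = (T ^^ Suc i) (T y)" by (simp only: x_def b(6) Tp_T)
    obtain f where f: "f \<in> E k" "x = D k f" using hyp_ker[of "T y" k] Ty Suc x by auto
    have "T x = 0" unfolding x_def by (rule T_norm[OF b(4)])
    then have "x \<in> Xlevel q k" using f by (auto simp: Xlevel_q)
    then obtain w where w: "w \<in> Z (Suc k)" "x - (T ^^ (q - 1)) w \<in> Xlevel 1 k"
      using Xlevel_norm[OF assms(1), of x k] prev Suc by auto
    then obtain c where c: "c \<in> E k" "T c = 0" "x - (T ^^ (q - 1)) w = D k c"
      unfolding Xlevel_1 by auto
    obtain e where e: "e \<in> E k" "(T ^^ (q - 1)) e = c" using norm_onto c by blast
    have "x = (T ^^ (q - 1)) (w + D k e)"
      using c(3) e(2) by (simp add: Tp_add Tp_D algebra_simps)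
    moreover have "w + D k e \<in> Z n" using w(1) D_in_Z[OF e(1)] Suc by (simp add: Z_add)
    ultimately show ?thesis unfolding x_def by blast
  qed
  then obtain w where w: "w \<in> Z n" "(T ^^ (q - 1)) b = (T ^^ (q - 1)) w" by blast
  have "zigzag (q - 1) n z 0"
    by (rule zigzagI[of _ _ _ "b - w"])
      (use b w in \<open>auto simp: Z_def zero_in D_0 T_0 Tp_0 D_diff Tp_diff diff_in simp del: funpow.simps\<close>)
  then show "z \<in> Ylevel (q - 1) n" by (auto simp: Ylevel_def)
qed

lemma Xlevel_full:
  assumes "i + 2 \<le> q"
  shows "Xlevel q n \<subseteq> Xlevel (i + 2) n"
proof (induction n)
  case 0
  show ?case
    using Xlevel_collapse[of "Suc i" "q - 1" 0] Ylevel_vanish_step[OF assms, of 0] assms by simp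
next
  case (Suc n)
  then show ?case
    using Xlevel_collapse[of "Suc i" "q - 1" "Suc n"] Ylevel_vanish_step[OF assms, of "Suc n"] assms by simp
qed

lemma Ylevel_vanish: "i + 2 \<le> q \<Longrightarrow> Ylevel (Suc i) n = invariant_rep n"
  using Ylevel_vanish_step[of n] Xlevel_full[of "n - 1"] Ylevel_last[of n] invariant_rep_subset[of n "Suc i"] by auto

end

text \<open>
  The pair \<open>(L0, L1)\<close> is defined in two adjacent degrees only, which is all that a zigzag sees. The cases of
  interest are scalar multiplication and multiplication by a fixed cocycle; in the latter, \<open>L0\<close> absorbs the
  sign of the Leibniz rule.
\<close>

definition chain_map :: "nat \<Rightarrow> nat \<Rightarrow> ('c \<Rightarrow> 'c) \<Rightarrow> ('c \<Rightarrow> 'c) \<Rightarrow> bool" where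
  "chain_map n n' L0 L1 \<longleftrightarrow>
     (\<forall>y \<in> E n. L0 y \<in> E n' \<and> D n' (L0 y) = L1 (D n y) \<and> T (L0 y) = L0 (T y)) \<and>
     (\<forall>z \<in> E (Suc n). T (L1 z) = L1 (T z)) \<and> (\<forall>z \<in> Z (Suc n). L1 z \<in> Z (Suc n')) \<and>
     L0 0 = 0 \<and> L1 0 = 0"

context
  fixes n n' :: nat and L0 L1 :: "'c \<Rightarrow> 'c"
  assumes chain: "chain_map n n' L0 L1"
begin

lemma L0_in: "y \<in> E n \<Longrightarrow> L0 y \<in> E n'"
  and L1_in: "z \<in> Z (Suc n) \<Longrightarrow> L1 z \<in> Z (Suc n')"
  and L0_0: "L0 0 = 0"
  and L1_0: "L1 0 = 0"
  and L_D: "y \<in> E n \<Longrightarrow> D n' (L0 y) = L1 (D n y)"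
  and T_L0: "y \<in> E n \<Longrightarrow> T (L0 y) = L0 (T y)"
  and T_L1: "z \<in> E (Suc n) \<Longrightarrow> T (L1 z) = L1 (T z)"
  using chain unfolding chain_map_def by blast+

lemma Tp_L0: "y \<in> E n \<Longrightarrow> (T ^^ k) (L0 y) = L0 ((T ^^ k) y)"
  by (induction k) (auto simp: T_L0 Tp_in)

lemma zigzag_chain_map: "zigzag i n z y \<Longrightarrow> zigzag i n' (L1 z) (L0 y)"
proof -
  assume "zigzag i n z y"
  then obtain b where b: "z \<in> Z (Suc n)" "y \<in> E n" "T (D n y) = 0" "b \<in> E n" "T z = D n b"
      "(T ^^ (q - 1)) b = (T ^^ Suc i) y" 
    by (meson zigzagE)
  show ?thesis
    by (rule zigzagI[of _ _ _ "L0 b"])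
      (use b L1_in in \<open>auto simp: L0_in L_D T_L1 D_in L1_0 Tp_L0 Z_def simp del: funpow.simps\<close>)
qed

lemma Ylevel_chain_map: "z \<in> Ylevel i n \<Longrightarrow> L1 z \<in> Ylevel i n'"
  using zigzag_chain_map by (auto simp: Ylevel_def)

lemma Xlevel_chain_map:
  assumes "x \<in> Xlevel l n"
  shows "L1 x \<in> Xlevel l n'"
proof -
  obtain y where y: "y \<in> E n" "(T ^^ l) y = 0" "T (D n y) = 0" "x = D n y"
    using assms unfolding Xlevel_def by blast
  have "T (D n' (L0 y)) = 0" by (simp add: L_D[OF y(1)] T_L1[OF D_in[OF y(1)]] y(3) L1_0)
  then have "D n' (L0 y) \<in> Xlevel l n'"
    using y(2) by (intro Xlevel_I) (simp_all add: L0_in[OF y(1)] Tp_L0[OF y(1)] L0_0)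
  then show ?thesis by (simp add: L_D[OF y(1)] y(4))
qed

end

end

section \<open>Graded objects presented by representatives\<close>

text \<open>
  A record \<open>V\<close> is the image of the subspace \<open>Z\<close> under a map \<open>\<pi>\<close> compatible with the operations. Identities
  in \<open>V\<close> thus follow from identities of representatives, which hold by the vector space laws of their type.
\<close>

definition lin_onto :: "('k::field \<Rightarrow> 'c::ab_group_add \<Rightarrow> 'c) \<Rightarrow> 'c set \<Rightarrow> ('c \<Rightarrow> 'v) \<Rightarrow>
    ('k, 'v) module \<Rightarrow> bool" where
  "lin_onto sc Z \<pi> V \<longleftrightarrow> module.subspace sc Z \<and> carrier V = \<pi> ` Z \<and> \<zero>\<^bsub>V\<^esub> = \<pi> 0 \<and>
     (\<forall>a \<in> Z. \<forall>b \<in> Z. \<pi> a \<oplus>\<^bsub>V\<^esub> \<pi> b = \<pi> (a + b)) \<and>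
     (\<forall>c. \<forall>a \<in> Z. c \<odot>\<^bsub>V\<^esub> \<pi> a = \<pi> (sc c a))"

definition coset_proj :: "('k, 'v) module \<Rightarrow> ('c \<Rightarrow> 'v) \<Rightarrow> 'c set \<Rightarrow> 'c \<Rightarrow> 'v set" where
  "coset_proj V \<pi> W z = (\<pi> ` W) +>\<^bsub>V\<^esub> \<pi> z"

context vector_space
begin

lemma lin_ontoD:
  assumes "lin_onto scale Z \<pi> V"
  shows "subspace Z" "carrier V = \<pi> ` Z" "\<zero>\<^bsub>V\<^esub> = \<pi> 0"
    "\<lbrakk>a \<in> Z; b \<in> Z\<rbrakk> \<Longrightarrow> \<pi> a \<oplus>\<^bsub>V\<^esub> \<pi> b = \<pi> (a + b)"
    "a \<in> Z \<Longrightarrow> c \<odot>\<^bsub>V\<^esub> \<pi> a = \<pi> (scale c a)"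
  using assms by (auto simp: lin_onto_def)

lemma lin_onto_abelian_group:
  assumes "lin_onto scale Z \<pi> V"
  shows "abelian_group V"
proof (rule abelian_groupI)
  note [simp] = lin_ontoD[OF assms] subspace_add[OF lin_ontoD(1)[OF assms]]
    subspace_0[OF lin_ontoD(1)[OF assms]] subspace_neg[OF lin_ontoD(1)[OF assms]]
  fix x assume "x \<in> carrier V"
  then obtain a where a: "a \<in> Z" "x = \<pi> a" by auto
  then show "\<exists>y \<in> carrier V. y \<oplus>\<^bsub>V\<^esub> x = \<zero>\<^bsub>V\<^esub>"
    by (auto intro!: bexI[of _ "- a"])
qed (use lin_ontoD(1)[OF assms] in \<open>auto simp: lin_ontoD(2-)[OF assms] subspace_add subspace_0 add_ac\<close>)

lemma lin_onto_vspace: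
  assumes "lin_onto scale Z \<pi> V"
  shows "vspace V"
proof (rule moduleI)
  show "abelian_group V" by (rule lin_onto_abelian_group[OF assms])
qed (use lin_ontoD(1)[OF assms] in \<open>auto simp: lin_ontoD(2-)[OF assms] subspace_add subspace_scale
  ring_of_type_algebra_def scale_left_distrib scale_right_distrib\<close>,
  use cring_from_type_algebra in \<open>simp add: ring_of_type_algebra_def\<close>)

lemma lin_onto_eq_iff:
  assumes V: "lin_onto scale Z \<pi> V" and a: "a \<in> Z" and b: "b \<in> Z"
  shows "\<pi> a = \<pi> b \<longleftrightarrow> \<pi> (a - b) = \<pi> 0"
proof -
  interpret abelian_group V by (rule lin_onto_abelian_group[OF V])
  note Z = lin_ontoD(1)[OF V]
  have ab: "a - b \<in> Z" "0 \<in> Z" using a b Z by (auto intro: subspace_diff subspace_0)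
  have "\<pi> a = \<pi> (a - b) \<oplus>\<^bsub>V\<^esub> \<pi> b" "\<pi> b = \<pi> 0 \<oplus>\<^bsub>V\<^esub> \<pi> b"
    using ab b by (simp_all add: lin_ontoD(4)[OF V])
  then show ?thesis
    using ab b by (metis add.r_cancel imageI lin_ontoD(2)[OF V])
qed

lemma lin_onto_restrict:
  assumes V: "lin_onto scale Z \<pi> V" and W: "subspace W" "W \<subseteq> Z"
  shows "lin_onto scale W \<pi> (V\<lparr>carrier := \<pi> ` W\<rparr>)"
  using W lin_ontoD[OF V] by (auto simp: lin_onto_def subset_iff)

lemma lin_onto_submodule:
  assumes V: "lin_onto scale Z \<pi> V" and W: "subspace W" "W \<subseteq> Z"
  shows "submodule (\<pi> ` W) (ring_of_type_algebra :: 'a ring) V"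
proof -
  interpret module "ring_of_type_algebra :: 'a ring" V by (rule lin_onto_vspace[OF V])
  have inv: "\<ominus>\<^bsub>V\<^esub> \<pi> a = \<pi> (- a)" if "a \<in> W" for a
  proof (rule minus_equality)
    show "\<pi> (- a) \<oplus>\<^bsub>V\<^esub> \<pi> a = \<zero>\<^bsub>V\<^esub>"
      using that W by (subst lin_ontoD(4)[OF V]) (auto simp: subspace_neg lin_ontoD(3)[OF V])
  qed (use that W in \<open>auto simp: lin_ontoD(2)[OF V] subspace_neg subset_iff\<close>)
  show ?thesis
  proof (rule submoduleI)
    show "a \<in> \<pi> ` W \<Longrightarrow> \<ominus>\<^bsub>V\<^esub> a \<in> \<pi> ` W" for a
      using W by (auto simp: inv subspace_neg)
  qed (use W lin_ontoD(2-)[OF V] in \<open>auto simp: subset_iff subspace_0 subspace_add subspace_scale\<close>)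
qed

lemma coset_proj_eq:
  assumes V: "lin_onto scale Z \<pi> V" and W: "W \<subseteq> Z" "z \<in> Z"
  shows "coset_proj V \<pi> W z = (\<lambda>w. \<pi> (w + z)) ` W"
  using W lin_ontoD(4)[OF V] by (force simp: coset_proj_def a_r_coset_def')

text \<open>
  Operations on quotients are given as \<open>W' + F (coset)\<close>. If \<open>L\<close> describes \<open>F\<close> on representatives and maps \<open>W\<close>
  into \<open>W'\<close>, the summand \<open>W'\<close> absorbs the image of \<open>W\<close>, and what remains is the coset of \<open>L v\<close>. Scalar
  multiplication and the actions of a graded algebra are the cases \<open>F\<close> of interest.
\<close>

lemma coset_proj_map:
  assumes V: "lin_onto scale Z \<pi> V" "subspace W" "W \<subseteq> Z" and V': "lin_onto scale Z' \<pi>' V'" "subspace W'" "W' \<subseteq> Z'"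
    and F: "\<And>v. v \<in> Z \<Longrightarrow> F (\<pi> v) = \<pi>' (L v)"
    and L: "\<And>v. v \<in> Z \<Longrightarrow> L v \<in> Z'" "\<And>v. v \<in> W \<Longrightarrow> L v \<in> W'"
      "\<And>u v. \<lbrakk>u \<in> Z; v \<in> Z\<rbrakk> \<Longrightarrow> L (u + v) = L u + L v"
    and v: "v \<in> Z"
  shows "(\<pi>' ` W') <+>\<^bsub>V'\<^esub> (F ` coset_proj V \<pi> W v) = coset_proj V' \<pi>' W' (L v)"
proof -
  note [simp] = lin_ontoD(4)[OF V'(1)] subspace_add[OF V'(2)]
  have "F ` coset_proj V \<pi> W v = (\<lambda>w. \<pi>' (L w + L v)) ` W"
  proof -
    have "F (\<pi> (w + v)) = \<pi>' (L w + L v)" if "w \<in> W" for w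
      using that v V(3) L(3) by (auto simp: F subspace_add[OF lin_ontoD(1)[OF V(1)]])
    then show ?thesis using v V by (auto simp: coset_proj_eq[OF V(1)] image_image)
  qed
  moreover have "(\<pi>' ` W') <+>\<^bsub>V'\<^esub> ((\<lambda>w. \<pi>' (L w + L v)) ` W) = (\<lambda>w. \<pi>' (w + L v)) ` W'"
  proof -
    have "\<pi>' w' \<oplus>\<^bsub>V'\<^esub> \<pi>' (L w + L v) = \<pi>' ((w' + L w) + L v)" if "w' \<in> W'" "w \<in> W" for w w'
      using that L(1)[OF v] L(2) V(3) V'(3) subspace_add[OF lin_ontoD(1)[OF V'(1)]]
      by (subst lin_ontoD(4)[OF V'(1)]) (auto simp: add_ac subset_iff)
    then have "(\<pi>' ` W') <+>\<^bsub>V'\<^esub> ((\<lambda>w. \<pi>' (L w + L v)) ` W) =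
        (\<Union>w' \<in> W'. \<Union>w \<in> W. {\<pi>' ((w' + L w) + L v)})"
      by (simp add: set_add_def')
    also have "\<dots> = (\<lambda>w. \<pi>' (w + L v)) ` W'"
    proof (intro equalityI subsetI)
      fix x assume "x \<in> (\<lambda>w. \<pi>' (w + L v)) ` W'"
      then obtain w where w: "w \<in> W'" "x = \<pi>' (w + L v)" by blast
      have "w - L 0 \<in> W'" "0 \<in> W"
        using w V'(2) L(2) subspace_0[OF V(2)] by (auto intro: subspace_diff)
      moreover have "x = \<pi>' ((w - L 0) + L 0 + L v)" using w by simp
      ultimately show "x \<in> (\<Union>w' \<in> W'. \<Union>w \<in> W. {\<pi>' ((w' + L w) + L v)})" by blast
    qed (use L(2) subspace_add[OF V'(2)] in blast)
    finally show ?thesis .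
  qed
  ultimately show ?thesis
    using L(1)[OF v] V'(3) by (simp add: coset_proj_eq[OF V'(1)])
qed

lemma lin_onto_quot:
  assumes V: "lin_onto scale Z \<pi> V" and W: "subspace W" "W \<subseteq> Z"
  shows "lin_onto scale Z (coset_proj V \<pi> W) (vquot V (\<pi> ` W))"
  unfolding lin_onto_def
proof (intro conjI ballI allI)
  note Z = lin_ontoD(1)[OF V]
  show "subspace Z" by (rule Z)
  show "carrier (vquot V (\<pi> ` W)) = coset_proj V \<pi> W ` Z"
    by (auto simp: vquot_def A_RCOSETS_def' lin_ontoD(2)[OF V] coset_proj_def)
  show "\<zero>\<^bsub>vquot V (\<pi> ` W)\<^esub> = coset_proj V \<pi> W 0"
    by (simp add: vquot_def coset_proj_eq[OF V W(2) subspace_0[OF Z]])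
  show "c \<odot>\<^bsub>vquot V (\<pi> ` W)\<^esub> coset_proj V \<pi> W a = coset_proj V \<pi> W (scale c a)" if "a \<in> Z" for a c
    unfolding vquot_def module.simps
    by (rule coset_proj_map[OF V W V W, of _ "scale c"])
      (use that Z W in \<open>auto simp: lin_ontoD(5)[OF V] subspace_scale scale_right_distrib\<close>)
  show "coset_proj V \<pi> W a \<oplus>\<^bsub>vquot V (\<pi> ` W)\<^esub> coset_proj V \<pi> W b = coset_proj V \<pi> W (a + b)"
    if ab: "a \<in> Z" "b \<in> Z" for a b
  proof -
    have *: "\<pi> (w + a) \<oplus>\<^bsub>V\<^esub> \<pi> (w' + b) = \<pi> ((w + w') + (a + b))" if "w \<in> W" "w' \<in> W" for w w'
      using that ab W Z by (subst lin_ontoD(4)[OF V]) (auto simp: add_ac subspace_add subset_iff)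
    have "coset_proj V \<pi> W a \<oplus>\<^bsub>vquot V (\<pi> ` W)\<^esub> coset_proj V \<pi> W b =
        (\<Union>w \<in> W. \<Union>w' \<in> W. {\<pi> ((w + w') + (a + b))})"
      using * ab W by (simp add: vquot_def set_add_def' coset_proj_eq[OF V])
    also have "\<dots> = (\<lambda>w. \<pi> (w + (a + b))) ` W"
    proof (intro equalityI subsetI)
      fix x assume "x \<in> (\<lambda>w. \<pi> (w + (a + b))) ` W"
      then obtain w where "w \<in> W" "x = \<pi> ((w + 0) + (a + b))" by auto
      then show "x \<in> (\<Union>w \<in> W. \<Union>w' \<in> W. {\<pi> ((w + w') + (a + b))})"
        using subspace_0[OF W(1)] by blast
    qed (use subspace_add[OF W(1)] in blast)
    finally show ?thesis using ab Z W by (simp add: coset_proj_eq[OF V] subspace_add)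
  qed
qed

lemma coset_proj_eq_0_iff:
  assumes V: "lin_onto scale Z \<pi> V" and W: "subspace W" "W \<subseteq> Z" and z: "z \<in> Z"
  shows "coset_proj V \<pi> W z = coset_proj V \<pi> W 0 \<longleftrightarrow> \<pi> z \<in> \<pi> ` W"
proof
  note Z = lin_ontoD(1)[OF V]
  have 0: "coset_proj V \<pi> W 0 = \<pi> ` W" using coset_proj_eq[OF V W(2) subspace_0[OF Z]] by simp
  {
    assume "coset_proj V \<pi> W z = coset_proj V \<pi> W 0"
    moreover have "\<pi> (0 + z) \<in> coset_proj V \<pi> W z"
      using coset_proj_eq[OF V W(2) z] subspace_0[OF W(1)] by blast
    ultimately show "\<pi> z \<in> \<pi> ` W" using 0 by simp
  next
    assume "\<pi> z \<in> \<pi> ` W"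
    then obtain w where w: "w \<in> W" "\<pi> z = \<pi> w" by auto
    have *: "\<pi> (x + z) = \<pi> (x + w)" if "x \<in> W" for x
      using that w z W by (metis lin_ontoD(4)[OF V] subset_iff)
    have "coset_proj V \<pi> W z = (\<lambda>x. \<pi> (x + w)) ` W"
      using * coset_proj_eq[OF V W(2) z] by auto
    also have "\<dots> = \<pi> ` W"
    proof (intro equalityI subsetI)
      fix x assume "x \<in> \<pi> ` W"
      then obtain u where "u \<in> W" "x = \<pi> ((u - w) + w)" by auto
      then show "x \<in> (\<lambda>x. \<pi> (x + w)) ` W" using w(1) subspace_diff[OF W(1)] by blast
    qed (use w(1) subspace_add[OF W(1)] in auto)
    finally show "coset_proj V \<pi> W z = coset_proj V \<pi> W 0" by (simp add: 0)
  }
qed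

end

text \<open>
  One multiplication \<open>mu\<close> on representatives serves for the algebra and for both actions on its bimodules, so
  a single associativity law yields the three laws of a bimodule.
\<close>

locale graded_reps = vector_space scale
  for scale :: "'k::field \<Rightarrow> 'c::ab_group_add \<Rightarrow> 'c" +
  fixes mu :: "nat \<Rightarrow> nat \<Rightarrow> 'c \<Rightarrow> 'c \<Rightarrow> 'c" and e :: 'c
  assumes mu_add_left: "mu i j (a + a') b = mu i j a b + mu i j a' b"
    and mu_add_right: "mu i j a (b + b') = mu i j a b + mu i j a b'"
    and mu_scale_left: "mu i j (scale c a) b = scale c (mu i j a b)"
    and mu_scale_right: "mu i j a (scale c b) = scale c (mu i j a b)"
    and mu_assoc: "mu (i + j) l (mu i j a b) d = mu i (j + l) a (mu j l b d)"
begin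

definition alg_rep :: "(nat \<Rightarrow> 'c set) \<Rightarrow> (nat \<Rightarrow> 'c \<Rightarrow> 'b) \<Rightarrow> ('k, 'b) gr_alg \<Rightarrow> bool" where
  "alg_rep Zb \<beta> B \<longleftrightarrow> (\<forall>n. lin_onto scale (Zb n) (\<beta> n) (gcomp B n)) \<and>
     (\<forall>i j. \<forall>a \<in> Zb i. \<forall>b \<in> Zb j. mu i j a b \<in> Zb (i + j) \<and>
        gmult B i j (\<beta> i a) (\<beta> j b) = \<beta> (i + j) (mu i j a b)) \<and>
     e \<in> Zb 0 \<and> gone B = \<beta> 0 e \<and>
     (\<forall>n. \<forall>a \<in> Zb n. mu 0 n e a = a \<and> mu n 0 a e = a)"

definition bimod_rep :: "(nat \<Rightarrow> 'c set) \<Rightarrow> (nat \<Rightarrow> 'c \<Rightarrow> 'b) \<Rightarrow> (nat \<Rightarrow> 'c set) \<Rightarrow> (nat \<Rightarrow> 'c \<Rightarrow> 'v) \<Rightarrow>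
    ('k, 'v, 'b) gr_bimod \<Rightarrow> bool" where
  "bimod_rep Zb \<beta> Zm \<pi> M \<longleftrightarrow> (\<forall>n. lin_onto scale (Zm n) (\<pi> n) (gcomp M n)) \<and>
     (\<forall>i j. \<forall>a \<in> Zb i. \<forall>v \<in> Zm j.
        mu i j a v \<in> Zm (i + j) \<and> glact M i j (\<beta> i a) (\<pi> j v) = \<pi> (i + j) (mu i j a v) \<and>
        mu j i v a \<in> Zm (j + i) \<and> gract M j i (\<pi> j v) (\<beta> i a) = \<pi> (j + i) (mu j i v a)) \<and>
     (\<forall>n. \<forall>v \<in> Zm n. mu 0 n e v = v \<and> mu n 0 v e = v)"

definition stable :: "(nat \<Rightarrow> 'c set) \<Rightarrow> (nat \<Rightarrow> 'c set) \<Rightarrow> bool" where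
  "stable Zb W \<longleftrightarrow> (\<forall>n. subspace (W n)) \<and>
     (\<forall>i j. \<forall>a \<in> Zb i. \<forall>v \<in> W j. mu i j a v \<in> W (i + j) \<and> mu j i v a \<in> W (j + i))"

lemma alg_repD:
  assumes "alg_rep Zb \<beta> B"
  shows "lin_onto scale (Zb n) (\<beta> n) (gcomp B n)"
    "\<lbrakk>a \<in> Zb i; b \<in> Zb j\<rbrakk> \<Longrightarrow> mu i j a b \<in> Zb (i + j)"
    "\<lbrakk>a \<in> Zb i; b \<in> Zb j\<rbrakk> \<Longrightarrow> gmult B i j (\<beta> i a) (\<beta> j b) = \<beta> (i + j) (mu i j a b)"
    "e \<in> Zb 0" "gone B = \<beta> 0 e" "a \<in> Zb n \<Longrightarrow> mu 0 n e a = a" "a \<in> Zb n \<Longrightarrow> mu n 0 a e = a"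
  using assms by (auto simp: alg_rep_def)

lemma bimod_repD:
  assumes "bimod_rep Zb \<beta> Zm \<pi> M"
  shows "lin_onto scale (Zm n) (\<pi> n) (gcomp M n)"
    "\<lbrakk>a \<in> Zb i; v \<in> Zm j\<rbrakk> \<Longrightarrow> mu i j a v \<in> Zm (i + j)"
    "\<lbrakk>a \<in> Zb i; v \<in> Zm j\<rbrakk> \<Longrightarrow> glact M i j (\<beta> i a) (\<pi> j v) = \<pi> (i + j) (mu i j a v)"
    "\<lbrakk>a \<in> Zb i; v \<in> Zm j\<rbrakk> \<Longrightarrow> mu j i v a \<in> Zm (j + i)"
    "\<lbrakk>a \<in> Zb i; v \<in> Zm j\<rbrakk> \<Longrightarrow> gract M j i (\<pi> j v) (\<beta> i a) = \<pi> (j + i) (mu j i v a)"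
    "v \<in> Zm n \<Longrightarrow> mu 0 n e v = v" "v \<in> Zm n \<Longrightarrow> mu n 0 v e = v"
  using assms by (auto simp: bimod_rep_def)

lemma graded_algebra_of_rep:
  assumes B: "alg_rep Zb \<beta> B"
  shows "graded_algebra B"
proof -
  note D = alg_repD[OF B]
  note l = lin_ontoD[OF D(1)]
  have car: "gcar B n = \<beta> n ` Zb n" for n by (rule l(2))
  show ?thesis
  proof (rule graded_algebra.intro, goal_cases)
    case 1 then show ?case by (rule lin_onto_vspace[OF D(1)])
  qed (auto simp: car D(2-) l(4,5) subspace_add[OF l(1)] subspace_scale[OF l(1)]
      mu_add_left mu_add_right mu_scale_left mu_scale_right mu_assoc add.assoc[where ?'a = nat])
qed

lemma graded_bimodule_of_rep:
  assumes B: "alg_rep Zb \<beta> B" and M: "bimod_rep Zb \<beta> Zm \<pi> M"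
  shows "graded_bimodule B M"
proof -
  note D = alg_repD[OF B] and E = bimod_repD[OF M]
  note l = lin_ontoD[OF D(1)] and k = lin_ontoD[OF E(1)]
  have car: "gcar B n = \<beta> n ` Zb n" "gcar M n = \<pi> n ` Zm n" for n by (rule l(2), rule k(2))
  show ?thesis
  proof (rule graded_bimodule.intro[OF graded_algebra_of_rep[OF B] graded_bimodule_axioms.intro], goal_cases)
    case 1 then show ?case by (rule lin_onto_vspace[OF E(1)])
  qed (auto simp: car D(2-) E(2-) l(4,5) k(4,5) subspace_add[OF l(1)] subspace_scale[OF l(1)]
      subspace_add[OF k(1)] subspace_scale[OF k(1)]
      mu_add_left mu_add_right mu_scale_left mu_scale_right mu_assoc add.assoc[where ?'a = nat])
qed

lemma graded_subbimodule_of_rep: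
  assumes B: "alg_rep Zb \<beta> B" and M: "bimod_rep Zb \<beta> Zm \<pi> M"
    and W: "stable Zb W" "\<And>n. W n \<subseteq> Zm n"
  shows "graded_subbimodule B M (\<lambda>n. \<pi> n ` W n)"
  unfolding graded_subbimodule_def
proof (intro conjI allI ballI)
  note E = bimod_repD[OF M]
  show "graded_bimodule B M" by (rule graded_bimodule_of_rep[OF B M])
  show "submodule (\<pi> n ` W n) (ring_of_type_algebra :: 'k ring) (gcomp M n)" for n
    using W by (intro lin_onto_submodule[OF E(1)]) (auto simp: stable_def)
  fix i j b v assume "b \<in> gcar B i" "v \<in> \<pi> j ` W j"
  then obtain a w where "b = \<beta> i a" "a \<in> Zb i" "v = \<pi> j w" "w \<in> W j"
    by (auto simp: lin_ontoD(2)[OF alg_repD(1)[OF B]])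
  then show "glact M i j b v \<in> \<pi> (i + j) ` W (i + j)" "gract M j i v b \<in> \<pi> (j + i) ` W (j + i)"
    using W by (auto simp: E(3,5) stable_def subset_iff)
qed

lemma bimod_rep_restrict:
  assumes M: "bimod_rep Zb \<beta> Zm \<pi> M" and W: "stable Zb W" "\<And>n. W n \<subseteq> Zm n"
  shows "bimod_rep Zb \<beta> W \<pi> (gr_restrict M (\<lambda>n. \<pi> n ` W n))"
  unfolding bimod_rep_def
proof (intro conjI allI ballI)
  note E = bimod_repD[OF M]
  show "lin_onto scale (W n) (\<pi> n) (gcomp (gr_restrict M (\<lambda>n. \<pi> n ` W n)) n)" for n
    using W by (simp add: gr_restrict_def lin_onto_restrict[OF E(1)] stable_def)
  show "mu 0 n e v = v" "mu n 0 v e = v" if "v \<in> W n" for n v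
    using that W(2)[of n] E(6,7)[of v n] by auto
  fix i j a v assume a: "a \<in> Zb i" "v \<in> W j"
  then show "mu i j a v \<in> W (i + j)" "mu j i v a \<in> W (j + i)" using W(1) by (auto simp: stable_def)
  have "v \<in> Zm j" using a W(2)[of j] by auto
  with a(1) show "glact (gr_restrict M (\<lambda>n. \<pi> n ` W n)) i j (\<beta> i a) (\<pi> j v) = \<pi> (i + j) (mu i j a v)"
    "gract (gr_restrict M (\<lambda>n. \<pi> n ` W n)) j i (\<pi> j v) (\<beta> i a) = \<pi> (j + i) (mu j i v a)"
    by (auto simp: gr_restrict_def E(3,5))
qed

lemma bimod_rep_quot:
  assumes M: "bimod_rep Zb \<beta> Zm \<pi> M" and W: "stable Zb W" "\<And>n. W n \<subseteq> Zm n"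
  shows "bimod_rep Zb \<beta> Zm (\<lambda>n. coset_proj (gcomp M n) (\<pi> n) (W n)) (gr_quot M (\<lambda>n. \<pi> n ` W n))"
  unfolding bimod_rep_def
proof (intro conjI allI ballI)
  note E = bimod_repD[OF M]
  have W': "subspace (W n)" for n using W by (simp add: stable_def)
  show "lin_onto scale (Zm n) (coset_proj (gcomp M n) (\<pi> n) (W n)) (gcomp (gr_quot M (\<lambda>n. \<pi> n ` W n)) n)" for n
    using W by (simp add: gr_quot_def lin_onto_quot[OF E(1) W'])
  show "mu 0 n e v = v" "mu n 0 v e = v" if "v \<in> Zm n" for n v
    using that E(6,7) by auto
  fix i j a v assume a: "a \<in> Zb i" "v \<in> Zm j"
  then show "mu i j a v \<in> Zm (i + j)" "mu j i v a \<in> Zm (j + i)" by (auto simp: E)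
  show "glact (gr_quot M (\<lambda>n. \<pi> n ` W n)) i j (\<beta> i a) (coset_proj (gcomp M j) (\<pi> j) (W j) v) =
      coset_proj (gcomp M (i + j)) (\<pi> (i + j)) (W (i + j)) (mu i j a v)"
    unfolding gr_quot_def gr_bimod.simps
    by (rule coset_proj_map[OF E(1) W' W(2) E(1) W' W(2)])
      (use a W(1) in \<open>auto simp: E stable_def mu_add_right\<close>)
  show "gract (gr_quot M (\<lambda>n. \<pi> n ` W n)) j i (coset_proj (gcomp M j) (\<pi> j) (W j) v) (\<beta> i a) =
      coset_proj (gcomp M (j + i)) (\<pi> (j + i)) (W (j + i)) (mu j i v a)"
    unfolding gr_quot_def gr_bimod.simps
    by (rule coset_proj_map[OF E(1) W' W(2) E(1) W' W(2), where L = "\<lambda>v. mu j i v a"])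
      (use a W(1) in \<open>auto simp: E stable_def mu_add_left\<close>)
qed

text \<open>
  An isomorphism is given by a relation between representatives, closed under all operations, since a
  representative on one side need not single out one on the other. The condition on kernels makes the
  induced map both well defined and injective.
\<close>

lemma gr_bimod_iso_of_relation:
  assumes B: "alg_rep Zb \<beta> B" and M: "bimod_rep Zb \<beta> Zm \<pi> M" and N: "bimod_rep Zb \<beta> Zn \<kappa> N"
    and R_in: "\<And>n v w. R n v w \<Longrightarrow> v \<in> Zm n \<and> w \<in> Zn n"
    and R_total: "\<And>n v. v \<in> Zm n \<Longrightarrow> \<exists>v' w. R n v' w \<and> \<pi> n v' = \<pi> n v"
    and R_onto: "\<And>n w. w \<in> Zn n \<Longrightarrow> \<exists>v w'. R n v w' \<and> \<kappa> n w' = \<kappa> n w"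
    and R_ker: "\<And>n v w. R n v w \<Longrightarrow> \<pi> n v = \<pi> n 0 \<longleftrightarrow> \<kappa> n w = \<kappa> n 0"
    and R_diff: "\<And>n v w v' w'. \<lbrakk>R n v w; R n v' w'\<rbrakk> \<Longrightarrow> R n (v - v') (w - w')"
    and R_add: "\<And>n v w v' w'. \<lbrakk>R n v w; R n v' w'\<rbrakk> \<Longrightarrow> R n (v + v') (w + w')"
    and R_scale: "\<And>n v w c. R n v w \<Longrightarrow> R n (scale c v) (scale c w)"
    and R_left: "\<And>i j a v w. \<lbrakk>a \<in> Zb i; R j v w\<rbrakk> \<Longrightarrow> R (i + j) (mu i j a v) (mu i j a w)"
    and R_right: "\<And>i j a v w. \<lbrakk>a \<in> Zb i; R j v w\<rbrakk> \<Longrightarrow> R (j + i) (mu j i v a) (mu j i w a)"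
  shows "gr_bimod_iso B M N"
proof -
  note EM = bimod_repD[OF M] and EN = bimod_repD[OF N]
  note k = lin_ontoD[OF EM(1)] and l = lin_ontoD[OF EN(1)]
  have R_eq: "\<pi> n v = \<pi> n v' \<longleftrightarrow> \<kappa> n w = \<kappa> n w'" if "R n v w" "R n v' w'" for n v w v' w'
    using R_ker[OF R_diff[OF that]] R_in[OF that(1)] R_in[OF that(2)]
    by (simp add: lin_onto_eq_iff[OF EM(1), of v n v'] lin_onto_eq_iff[OF EN(1), of w n w'])
  define \<phi> where "\<phi> n x = (SOME y. \<exists>v w. R n v w \<and> x = \<pi> n v \<and> y = \<kappa> n w)" for n x
  have \<phi>: "\<phi> n (\<pi> n v) = \<kappa> n w" if "R n v w" for n v w
  proof -
    have "\<exists>v' w'. R n v' w' \<and> \<pi> n v = \<pi> n v' \<and> \<phi> n (\<pi> n v) = \<kappa> n w'"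
      unfolding \<phi>_def by (rule someI[of _ "\<kappa> n w"]) (use that in blast)
    then show ?thesis using R_eq that by metis
  qed
  have ex: "\<exists>v w. R n v w \<and> x = \<pi> n v" if "x \<in> gcar M n" for x n
    using that R_total by (auto simp: k(2)) metis
  have bij: "bij_betw (\<phi> n) (gcar M n) (gcar N n)" for n
  proof (rule bij_betw_imageI)
    show "inj_on (\<phi> n) (gcar M n)"
      by (rule inj_onI) (metis R_eq \<phi> ex)
    show "\<phi> n ` gcar M n = gcar N n"
    proof (intro equalityI subsetI)
      fix y assume "y \<in> gcar N n"
      then obtain w where w: "w \<in> Zn n" "y = \<kappa> n w" by (auto simp: l(2))
      then obtain v w' where r: "R n v w'" "\<kappa> n w' = y" using R_onto by metis
      then show "y \<in> \<phi> n ` gcar M n" using \<phi>[OF r(1)] R_in[OF r(1)] by (force simp: k(2))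
    next
      fix y assume "y \<in> \<phi> n ` gcar M n"
      then obtain v w where "R n v w" "y = \<phi> n (\<pi> n v)" using ex by blast
      then show "y \<in> gcar N n" using \<phi> R_in by (auto simp: l(2))
    qed
  qed
  show ?thesis
    unfolding gr_bimod_iso_def
  proof (intro exI[of _ \<phi>] conjI allI ballI)
    show "\<phi> n \<in> iso (add_monoid (gcomp M n)) (add_monoid (gcomp N n))" for n
      unfolding iso_def hom_def
    proof (simp add: bij, intro conjI ballI)
      show "\<phi> n \<in> gcar M n \<rightarrow> gcar N n" using bij[of n] by (auto simp: bij_betw_def)
      fix x y assume "x \<in> gcar M n" "y \<in> gcar M n"
      then obtain v w v' w' where r: "R n v w" "x = \<pi> n v" "R n v' w'" "y = \<pi> n v'" using ex by metis
      then show "\<phi> n (x \<oplus>\<^bsub>gcomp M n\<^esub> y) = \<phi> n x \<oplus>\<^bsub>gcomp N n\<^esub> \<phi> n y"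
        using R_in[OF r(1)] R_in[OF r(3)] by (simp add: k(4) l(4) \<phi>[OF R_add] \<phi>[OF r(1)] \<phi>[OF r(3)])
    qed
    show "\<phi> n (c \<odot>\<^bsub>gcomp M n\<^esub> x) = c \<odot>\<^bsub>gcomp N n\<^esub> \<phi> n x" if "x \<in> gcar M n" for n c x
    proof -
      from ex[OF that] obtain v w where r: "R n v w" "x = \<pi> n v" by blast
      then show ?thesis using R_in[OF r(1)] by (simp add: k(5) l(5) \<phi>[OF R_scale] \<phi>[OF r(1)])
    qed
    fix i j b x assume "b \<in> gcar B i" "x \<in> gcar M j"
    then obtain a v w where a: "a \<in> Zb i" "b = \<beta> i a" and r: "R j v w" "x = \<pi> j v"
      using ex by (auto simp: lin_ontoD(2)[OF alg_repD(1)[OF B]]) metis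
    show "\<phi> (i + j) (glact M i j b x) = glact N i j b (\<phi> j x)"
      "\<phi> (j + i) (gract M j i x b) = gract N j i (\<phi> j x) b"
      using a r R_in[OF r(1)] \<phi>[OF R_left[OF a(1) r(1)]] \<phi>[OF R_right[OF a(1) r(1)]]
      by (simp_all add: EM(3,5) EN(3,5) \<phi>[OF r(1)])
  qed
qed

end

section \<open>Hochschild cochains\<close>

text \<open>
  Replaces the entries at \<open>k\<close> and \<open>k + 1\<close> by their product. The recursive form turns the identities between
  faces into inductions on lists.
\<close>

fun contract :: "nat \<Rightarrow> 'a::times list \<Rightarrow> 'a list" where
  "contract 0 (a # b # xs) = (a * b) # xs"
| "contract (Suc k) (a # xs) = a # contract k xs"
| "contract _ xs = xs"

lemma contract_eq: "Suc k < length xs \<Longrightarrow> contract k xs = take k xs @ [xs ! k * xs ! Suc k] @ drop (k + 2) xs"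
  by (induction k xs rule: contract.induct) auto

lemma length_contract: "Suc k < length xs \<Longrightarrow> length (contract k xs) = length xs - 1"
  by (induction k xs rule: contract.induct) auto

lemma contract_contract:
  fixes xs :: "'a::semigroup_mult list"
  shows "\<lbrakk>i \<le> j; Suc (Suc j) < length xs\<rbrakk> \<Longrightarrow> contract i (contract (Suc j) xs) = contract j (contract i xs)"
proof (induction i arbitrary: j xs)
  case 0
  then obtain a b c ys where "xs = a # b # c # ys"
    by (cases xs; cases "tl xs"; cases "tl (tl xs)") auto
  then show ?case by (cases j) (auto simp: mult.assoc)
next
  case (Suc i)
  then show ?case by (cases xs; cases j) auto
qed

lemma butlast_contract: "Suc (Suc k) < length xs \<Longrightarrow> butlast (contract k xs) = contract k (butlast xs)"
proof (induction k xs rule: contract.induct)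
  case (2 k a xs)
  then show ?case using length_contract[of k xs] by auto
qed auto

lemma last_contract: "Suc (Suc k) < length xs \<Longrightarrow> last (contract k xs) = last xs"
proof (induction k xs rule: contract.induct)
  case (2 k a xs)
  then show ?case using length_contract[of k xs] by auto
qed auto

lemma butlast_contract_end: "Suc (Suc k) = length xs \<Longrightarrow> butlast (contract k xs) = butlast (butlast xs)"
proof (induction k xs rule: contract.induct)
  case (2 k a xs)
  moreover from 2 have "length (contract k xs) = Suc k"
    by (simp add: length_contract)
  then have "contract k xs \<noteq> []" by auto
  moreover from 2 have "xs \<noteq> []" "butlast xs \<noteq> []"
    by (cases xs; cases "tl xs"; simp)+
  ultimately show ?case by simp
qed auto

lemma last_contract_end: "Suc (Suc k) = length xs \<Longrightarrow> last (contract k xs) = last (butlast xs) * last xs"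
proof (induction k xs rule: contract.induct)
  case (2 k a xs)
  moreover from 2 have "length (contract k xs) = Suc k"
    by (simp add: length_contract)
  then have "contract k xs \<noteq> []" by auto
  moreover from 2 have "xs \<noteq> []" "butlast xs \<noteq> []"
    by (cases xs; cases "tl xs"; simp)+
  ultimately show ?case by simp
qed auto

lemma take_contract_less: "\<lbrakk>k < i; Suc k < length xs\<rbrakk> \<Longrightarrow> take i (contract k xs) = contract k (take (Suc i) xs)"
  by (induction k xs arbitrary: i rule: contract.induct) (auto simp: take_Cons split: nat.splits)

lemma drop_contract_less: "\<lbrakk>k < i; Suc k < length xs\<rbrakk> \<Longrightarrow> drop i (contract k xs) = drop (Suc i) xs"
  by (induction k xs arbitrary: i rule: contract.induct) (auto simp: drop_Cons split: nat.splits)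

lemma take_contract_ge: "\<lbrakk>i \<le> k; Suc k < length xs\<rbrakk> \<Longrightarrow> take i (contract k xs) = take i xs"
  by (induction k xs arbitrary: i rule: contract.induct) (auto simp: take_Cons split: nat.splits)

lemma drop_contract_ge: "\<lbrakk>i \<le> k; Suc k < length xs\<rbrakk> \<Longrightarrow> drop i (contract k xs) = contract (k - i) (drop i xs)"
  by (induction k xs arbitrary: i rule: contract.induct) (auto simp: drop_Cons split: nat.splits)

lemma map_contract: "(\<And>x y. \<phi> (x * y) = \<phi> x * \<phi> y) \<Longrightarrow> map \<phi> (contract k xs) = contract k (map \<phi> xs)"
  by (induction k xs rule: contract.induct) auto

lemma contract_update_less: "\<lbrakk>i < k; Suc k < length xs\<rbrakk> \<Longrightarrow> contract k (xs[i := a]) = (contract k xs)[i := a]"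
  by (induction k xs arbitrary: i rule: contract.induct) (auto split: nat.splits)

lemma contract_update_left: "Suc k < length xs \<Longrightarrow> contract k (xs[k := a]) = (contract k xs)[k := a * xs ! Suc k]"
  by (induction k xs rule: contract.induct) auto

lemma contract_update_right: "Suc k < length xs \<Longrightarrow> contract k (xs[Suc k := a]) = (contract k xs)[k := xs ! k * a]"
  by (induction k xs rule: contract.induct) auto

lemma contract_update_greater:
  "\<lbrakk>Suc k < i; i < length xs\<rbrakk> \<Longrightarrow> contract k (xs[i := a]) = (contract k xs)[i - 1 := a]"
  by (induction k xs arbitrary: i rule: contract.induct) (auto split: nat.splits)

definition alt_sign :: "nat \<Rightarrow> 'm::ab_group_add \<Rightarrow> 'm" where
  "alt_sign k x = (if even k then x else - x)"

lemma alt_sign_simps [simp]: "alt_sign 0 x = x" "alt_sign (Suc k) x = - alt_sign k x" "alt_sign k 0 = 0" "alt_sign k (- x) = - alt_sign k x"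
  "alt_sign k (x + y) = alt_sign k x + alt_sign k y" "alt_sign k (x - y) = alt_sign k x - alt_sign k y" "alt_sign k (alt_sign k x) = x"
  by (auto simp: alt_sign_def)

lemma alt_sign_sum: "alt_sign k (sum f S) = (\<Sum>x \<in> S. alt_sign k (f x))"
  by (auto simp: alt_sign_def sum_negf)

text \<open>
  The term \<open>(j, i)\<close> with \<open>i < j\<close> cancels against the term \<open>(i, j - 1)\<close>, which has the opposite sign.
\<close>

lemma alternating_double_sum:
  fixes F :: "nat \<Rightarrow> nat \<Rightarrow> 'm::ab_group_add"
  assumes F: "\<And>i j. \<lbrakk>i < j; j \<le> Suc N\<rbrakk> \<Longrightarrow> F j i = F i (j - 1)"
  shows "(\<Sum>j\<le>Suc N. alt_sign j (\<Sum>i\<le>N. alt_sign i (F j i))) = 0"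
proof -
  define P where "P = {..Suc N} \<times> {..N}"
  define P1 where "P1 = {(j, i). i < j \<and> j \<le> Suc N}"
  define P2 where "P2 = {(j, i). j \<le> i \<and> i \<le> N}"
  have P: "P = P1 \<union> P2" "P1 \<inter> P2 = {}" by (auto simp: P_def P1_def P2_def)
  have fin: "finite P1" "finite P2"
    using P(1) by (metis P_def finite_Un finite_SigmaI finite_atMost)+
  have "(\<Sum>j\<le>Suc N. alt_sign j (\<Sum>i\<le>N. alt_sign i (F j i))) = (\<Sum>(j, i) \<in> P. alt_sign j (alt_sign i (F j i)))"
    unfolding P_def by (subst sum.cartesian_product[symmetric]) (simp only: alt_sign_sum)
  also have "\<dots> = (\<Sum>(j, i) \<in> P1. alt_sign j (alt_sign i (F j i))) + (\<Sum>(j, i) \<in> P2. alt_sign j (alt_sign i (F j i)))"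
    unfolding P(1) by (rule sum.union_disjoint[OF fin P(2)])
  also have "(\<Sum>(j, i) \<in> P1. alt_sign j (alt_sign i (F j i))) = (\<Sum>(j, i) \<in> P2. - alt_sign j (alt_sign i (F j i)))"
  proof (rule sum.reindex_bij_witness[of _ "\<lambda>(j, i). (Suc i, j)" "\<lambda>(j, i). (i, j - 1)"], goal_cases)
    case (5 x)
    then obtain i j where x: "x = (j, i)" "i < j" "j \<le> Suc N" by (auto simp: P1_def)
    then obtain k where "j = Suc k" by (cases j) auto
    then show ?case using F[OF x(2,3)] x by (auto simp: alt_sign_def)
  qed (auto simp: P1_def P2_def)
  also have "\<dots> + (\<Sum>(j, i) \<in> P2. alt_sign j (alt_sign i (F j i))) = 0"
    by (simp add: case_prod_unfold flip: sum.distrib)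
  finally show ?thesis .
qed

context AeG_module_algebra
begin

sublocale vA: vector_space "scl A" by (rule A.vector_space)
sublocale vM: vector_space "scl M" by (rule M.vector_space)

lemma lmul_add_left: "lmul M (a + b) x = lmul M a x + lmul M b x"
  and lmul_scl_left: "lmul M (scl A c a) x = scl M c (lmul M a x)"
  using lmul_linear_left[of x] by (simp_all add: Vector_Spaces.linear_iff)

lemma lmul_add_right: "lmul M a (x + y) = lmul M a x + lmul M a y"
  and lmul_scl_right: "lmul M a (scl M c x) = scl M c (lmul M a x)"
  using lmul_linear_right[of a] by (simp_all add: Vector_Spaces.linear_iff)

lemma rmul_add_left: "rmul M (x + y) a = rmul M x a + rmul M y a"
  and rmul_scl_left: "rmul M (scl M c x) a = scl M c (rmul M x a)"
  using rmul_linear_left[of a] by (simp_all add: Vector_Spaces.linear_iff)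

lemma rmul_add_right: "rmul M x (a + b) = rmul M x a + rmul M x b"
  and rmul_scl_right: "rmul M x (scl A c a) = scl M c (rmul M x a)"
  using rmul_linear_right[of x] by (simp_all add: Vector_Spaces.linear_iff)

lemma lmul_0: "lmul M a 0 = 0" and rmul_0: "rmul M 0 a = 0"
  using lmul_scl_right[of a 0 0] rmul_scl_left[of 0 0 a] by simp_all

lemma lmul_minus: "lmul M a (- x) = - lmul M a x" and rmul_minus: "rmul M (- x) a = - rmul M x a"
  using lmul_scl_right[of a "-1" x] rmul_scl_left[of "-1" x a] by simp_all

lemma lmul_sum: "lmul M a (sum f S) = (\<Sum>i \<in> S. lmul M a (f i))"
  by (induction S rule: infinite_finite_induct) (auto simp: lmul_add_right lmul_0)

lemma rmul_sum: "rmul M (sum f S) a = (\<Sum>i \<in> S. rmul M (f i) a)"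
  by (induction S rule: infinite_finite_induct) (auto simp: rmul_add_left rmul_0)

lemma lmul_alt_sign: "lmul M a (alt_sign k x) = alt_sign k (lmul M a x)" and rmul_alt_sign: "rmul M (alt_sign k x) a = alt_sign k (rmul M x a)"
  by (auto simp: alt_sign_def lmul_minus rmul_minus)

lemma scl_alt_sign: "scl M ((-1) ^ k) x = alt_sign k x"
  by (cases "even k") (auto simp: alt_sign_def)

lemma scl_sg2: "scl M c (alt_sign k x) = alt_sign k (scl M c x)"
  by (auto simp: alt_sign_def)

definition face :: "nat \<Rightarrow> nat \<Rightarrow> ('a list \<Rightarrow> 'm) \<Rightarrow> 'a list \<Rightarrow> 'm" where
  "face n k f xs = (if k = 0 then lmul M (hd xs) (f (tl xs))
     else if k \<le> n then f (contract (k - 1) xs) else rmul M (f (butlast xs)) (last xs))"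

lemma hdiff_eq_faces:
  assumes "length xs = Suc n"
  shows "hdiff M n f xs = (\<Sum>k\<le>Suc n. alt_sign k (face n k f xs))"
proof -
  have "(\<Sum>k\<le>Suc n. alt_sign k (face n k f xs)) =
      face n 0 f xs + (\<Sum>k<n. alt_sign (Suc k) (face n (Suc k) f xs)) + alt_sign (Suc n) (face n (Suc n) f xs)"
    by (simp add: sum.atMost_shift)
  also have "(\<Sum>k<n. alt_sign (Suc k) (face n (Suc k) f xs)) =
      (\<Sum>i<n. scl M ((-1) ^ Suc i) (f (take i xs @ [xs ! i * xs ! Suc i] @ drop (i + 2) xs)))"
    by (rule sum.cong) (use assms in \<open>auto simp: face_def contract_eq scl_alt_sign simp del: power_Suc alt_sign_simps(2)\<close>)
  finally show ?thesis
    using assms by (simp add: hdiff_def face_def scl_alt_sign del: power_Suc alt_sign_simps(2))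
qed

lemma hdiff_eq: "hdiff M n f = (\<lambda>xs. if length xs = Suc n then \<Sum>k\<le>Suc n. alt_sign k (face n k f xs) else 0)"
proof (rule ext)
  show "hdiff M n f xs = (if length xs = Suc n then \<Sum>k\<le>Suc n. alt_sign k (face n k f xs) else 0)" for xs
  proof (cases "length xs = Suc n")
    case True
    then show ?thesis using hdiff_eq_faces[OF True, of f] by (simp del: sum.atMost_Suc alt_sign_simps(2))
  qed (simp add: hdiff_def)
qed

lemma face_cong: 
  assumes "\<And>ys. length ys = n \<Longrightarrow> f ys = g ys" "length xs = Suc n"
  shows "face n k f xs = face n k g xs"
  using assms by (auto simp: face_def length_contract)

lemma face_add: "face n k (f + g) xs = face n k f xs + face n k g xs"
  by (auto simp: face_def lmul_add_right rmul_add_left)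

lemma face_scl: "face n k (\<lambda>xs. scl M c (f xs)) xs = scl M c (face n k f xs)"
  by (auto simp: face_def lmul_scl_right rmul_scl_left)

lemma face_sum: "face n k (\<lambda>ys. \<Sum>i \<in> S. alt_sign i (f i ys)) xs = (\<Sum>i \<in> S. alt_sign i (face n k (f i) xs))"
  by (auto simp: face_def lmul_sum rmul_sum lmul_alt_sign rmul_alt_sign)

lemma hdiff_add: "hdiff M n (f + g) = hdiff M n f + hdiff M n g"
  by (auto simp: hdiff_eq face_add fun_eq_iff simp flip: sum.distrib simp del: sum.atMost_Suc)

lemma hdiff_scl: "hdiff M n (\<lambda>xs. scl M c (f xs)) = (\<lambda>xs. scl M c (hdiff M n f xs))"
  by (auto simp: hdiff_eq face_scl fun_eq_iff vM.scale_sum_right scl_sg2 simp del: sum.atMost_Suc)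

text \<open>
  The cosimplicial identities, which express the associativity of the product and of the two actions.
\<close>

lemma face_face:
  assumes ij: "i < j" "j \<le> Suc (Suc n)" and xs: "length xs = Suc (Suc n)"
  shows "face (Suc n) j (face n i f) xs = face (Suc n) i (face n (j - 1) f) xs"
proof -
  obtain l where l: "j = Suc l" using ij by (cases j) auto
  obtain a b ys where ab: "xs = a # b # ys" using xs by (cases xs; cases "tl xs") auto
  show ?thesis
  proof (cases i)
    case 0
    consider "l = 0" "l \<le> n" | k where "l = Suc k" "l \<le> n" | "l = Suc n" using ij l by (cases l) force+
    then show ?thesis
    proof cases
      case 1
      then show ?thesis using 0 l ab by (auto simp: face_def lmul_assoc)
    next
      case 2
      then show ?thesis using 0 l ab by (auto simp: face_def)
    next
      case 3
      then show ?thesis using 0 l ab by (auto simp: face_def lrmul_assoc)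
    qed
  next
    case (Suc k)
    consider "l \<le> n" | "l = Suc n" "k < n" | "l = Suc n" "k = n" using ij l Suc by force
    then show ?thesis
    proof cases
      case 1
      then obtain l' where "l = Suc l'" "k \<le> l'" using Suc ij l by (cases l) auto
      then show ?thesis using 1 Suc l xs contract_contract[of k l' xs] by (auto simp: face_def)
    next
      case 2
      then show ?thesis using Suc l xs by (auto simp: face_def butlast_contract last_contract)
    next
      case 3
      then show ?thesis using Suc l xs
        by (auto simp: face_def butlast_contract_end last_contract_end rmul_assoc)
    qed
  qed
qed

lemma hdiff_hdiff: "hdiff M (Suc n) (hdiff M n f) = 0"
proof
  fix xs
  show "hdiff M (Suc n) (hdiff M n f) xs = 0 xs"
  proof (cases "length xs = Suc (Suc n)")
    case True
    have "hdiff M (Suc n) (hdiff M n f) xs = (\<Sum>j\<le>Suc (Suc n). alt_sign j (face (Suc n) j (hdiff M n f) xs))"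
      by (rule hdiff_eq_faces[OF True])
    also have "\<dots> = (\<Sum>j\<le>Suc (Suc n). alt_sign j (\<Sum>i\<le>Suc n. alt_sign i (face (Suc n) j (face n i f) xs)))"
    proof (rule sum.cong[OF refl])
      fix j
      have "face (Suc n) j (hdiff M n f) xs =
          face (Suc n) j (\<lambda>ys. \<Sum>i\<le>Suc n. alt_sign i (face n i f ys)) xs"
        by (rule face_cong[OF hdiff_eq_faces True])
      then show "alt_sign j (face (Suc n) j (hdiff M n f) xs) =
          alt_sign j (\<Sum>i\<le>Suc n. alt_sign i (face (Suc n) j (face n i f) xs))"
        by (simp only: face_sum)
    qed
    also have "\<dots> = 0"
      by (rule alternating_double_sum) (rule face_face[OF _ _ True])
    finally show ?thesis by simp
  qed (simp add: hdiff_def)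
qed

lemma face_cup_left:
  assumes "k \<le> i" "length xs = Suc (i + j)"
  shows "face (i + j) k (cup i j f g) xs = face i k f (take (Suc i) xs) * g (drop (Suc i) xs)"
proof (cases k)
  case 0
  then show ?thesis using assms
    by (cases xs) (auto simp: face_def cup_def mult_lmul)
next
  case (Suc l)
  then show ?thesis using assms
    by (auto simp: face_def cup_def length_contract take_contract_less drop_contract_less)
qed

lemma face_cup_right:
  assumes "0 < k" "k \<le> Suc j" "length xs = Suc (i + j)"
  shows "face (i + j) (i + k) (cup i j f g) xs = f (take i xs) * face j k g (drop i xs)"
proof (cases "k = Suc j")
  case True
  have "xs \<noteq> []" "drop i xs \<noteq> []" using assms by auto
  then show ?thesis using assms True
    by (auto simp: face_def cup_def mult_rmul take_butlast drop_butlast butlast_drop[symmetric])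
next
  case False
  then obtain l where "k = Suc l" "l < j" using assms by (cases k) auto
  then show ?thesis using assms
    by (auto simp: face_def cup_def length_contract take_contract_ge drop_contract_ge)
qed

text \<open>
  The faces \<open>0, \<dots>, i\<close> of the product act on \<open>f\<close>, the others on \<open>g\<close>. The right-hand side has two more terms,
  the last face of \<open>f\<close> and the first face of \<open>g\<close>; they cancel because the product of the coefficients is
  balanced over the algebra.
\<close>

lemma hdiff_cup:
  "hdiff M (i + j) (cup i j f g) = cup (Suc i) j (hdiff M i f) g + alt_sign i (cup i (Suc j) f (hdiff M j g))"
proof
  fix xs
  show "hdiff M (i + j) (cup i j f g) xs =
    (cup (Suc i) j (hdiff M i f) g + alt_sign i (cup i (Suc j) f (hdiff M j g))) xs"
  proof (cases "length xs = Suc (i + j)")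
    case False
    then show ?thesis by (auto simp: hdiff_def cup_def alt_sign_def)
  next
    case True
    let ?F = "\<lambda>k. alt_sign k (face (i + j) k (cup i j f g) xs)"
    let ?t = "take (Suc i) xs" and ?d = "drop (Suc i) xs"
    have lens: "length ?t = Suc i" "length (drop i xs) = Suc j" using True by auto
    have t: "butlast ?t = take i xs" "last ?t = xs ! i" "hd (drop i xs) = xs ! i" "tl (drop i xs) = ?d"
      using True by (auto simp: take_Suc_conv_app_nth hd_drop_conv_nth drop_Suc tl_drop)
    have "hdiff M (i + j) (cup i j f g) xs = (\<Sum>k\<le>i + Suc j. ?F k)"
      using hdiff_eq_faces[OF True] by simp
    also have "\<dots> = (\<Sum>k\<le>i. ?F k) + (\<Sum>k\<le>j. ?F (Suc (i + k)))"
    proof -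
      have "(\<Sum>k\<le>i + Suc j. ?F k) = (\<Sum>k\<in>{..i} \<union> {Suc i..i + Suc j}. ?F k)"
        by (rule sum.cong) auto
      also have "\<dots> = (\<Sum>k\<le>i. ?F k) + (\<Sum>k\<in>{Suc i..i + Suc j}. ?F k)"
        by (rule sum.union_disjoint) auto
      also have "(\<Sum>k\<in>{Suc i..i + Suc j}. ?F k) = (\<Sum>k\<le>j. ?F (Suc (i + k)))"
        by (rule sum.reindex_bij_witness[of _ "\<lambda>k. Suc (i + k)" "\<lambda>k. k - Suc i"]) auto
      finally show ?thesis .
    qed
    also have "(\<Sum>k\<le>i. ?F k) = (\<Sum>k\<le>i. alt_sign k (face i k f ?t)) * g ?d"
      unfolding sum_distrib_right
      by (rule sum.cong) (use True in \<open>auto simp: face_cup_left alt_sign_def\<close>)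
    also have "(\<Sum>k\<le>i. alt_sign k (face i k f ?t)) = hdiff M i f ?t - alt_sign (Suc i) (rmul M (f (take i xs)) (xs ! i))"
      using hdiff_eq_faces[OF lens(1), of f] t by (simp add: face_def)
    also have "(\<Sum>k\<le>j. ?F (Suc (i + k))) =
        (\<Sum>k\<le>j. alt_sign i (f (take i xs) * alt_sign (Suc k) (face j (Suc k) g (drop i xs))))"
      by (rule sum.cong) (use True face_cup_right[of "Suc _" j xs i f g] in \<open>auto simp: alt_sign_def\<close>)
    also have "\<dots> = alt_sign i (f (take i xs) * (\<Sum>k\<le>j. alt_sign (Suc k) (face j (Suc k) g (drop i xs))))"
      by (simp only: alt_sign_sum sum_distrib_left)
    also have "(\<Sum>k\<le>j. alt_sign (Suc k) (face j (Suc k) g (drop i xs))) =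
        hdiff M j g (drop i xs) - lmul M (xs ! i) (g ?d)"
      using hdiff_eq_faces[OF lens(2), of g] t by (simp add: face_def sum.atMost_Suc_shift del: sum.atMost_Suc)
    finally show ?thesis
      using True lens mult_balanced[of "f (take i xs)" "xs ! i" "g ?d"]
      by (auto simp: cup_def algebra_simps alt_sign_def)
  qed
qed

lemma cup_add_left: "cup i j (f + f') g = cup i j f g + cup i j f' (g :: 'a list \<Rightarrow> 'm)"
  by (auto simp: cup_def fun_eq_iff distrib_right)

lemma cup_add_right: "cup i j f (g + g') = cup i j f g + cup i j f (g' :: 'a list \<Rightarrow> 'm)"
  by (auto simp: cup_def fun_eq_iff distrib_left)

lemma cup_0_left: "cup i j 0 g = (0 :: 'a list \<Rightarrow> 'm)" and cup_0_right: "cup i j f 0 = (0 :: 'a list \<Rightarrow> 'm)"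
  by (auto simp: cup_def fun_eq_iff)

lemma cup_assoc:
  "cup (i + j) l (cup i j f g) h = (cup i (j + l) f (cup j l g h) :: 'a list \<Rightarrow> 'm)"
  by (auto simp: cup_def fun_eq_iff mult.assoc take_drop add.commute add.left_commute)

definition sc :: "'k \<Rightarrow> ('a list \<Rightarrow> 'm) \<Rightarrow> 'a list \<Rightarrow> 'm" where
  "sc c f = (\<lambda>xs. scl M c (f xs))"

sublocale fM: vector_space sc
  by unfold_locales (auto simp: sc_def fun_eq_iff vM.scale_right_distrib vM.scale_left_distrib)

lemma cup_sc_left: "cup i j (sc c f) g = sc c (cup i j f g)"
  by (auto simp: cup_def sc_def fun_eq_iff M.scl_mult_left)

lemma cup_sc_right: "cup i j f (sc c g) = sc c (cup i j f g)"
  by (auto simp: cup_def sc_def fun_eq_iff M.scl_mult_right)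

lemma hdiff_sc: "hdiff M n (sc c f) = sc c (hdiff M n f)"
  unfolding sc_def by (rule hdiff_scl)

definition lin :: "('a \<Rightarrow> 'm) \<Rightarrow> bool" where
  "lin \<phi> \<longleftrightarrow> (\<forall>x y. \<phi> (x + y) = \<phi> x + \<phi> y) \<and> (\<forall>c x. \<phi> (scl A c x) = scl M c (\<phi> x))"

lemma linear_iff_lin: "Vector_Spaces.linear (scl A) (scl M) \<phi> \<longleftrightarrow> lin \<phi>"
  by (simp add: Vector_Spaces.linear_iff lin_def A.vector_space M.vector_space)

abbreviation CC :: "nat \<Rightarrow> ('a list \<Rightarrow> 'm) set" where
  "CC n \<equiv> carrier (Cochains A M n)"

lemma CC_iff: "f \<in> CC n \<longleftrightarrow> (\<forall>xs. length xs \<noteq> n \<longrightarrow> f xs = 0) \<and>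
    (\<forall>xs i. length xs = n \<and> i < n \<longrightarrow> lin (\<lambda>a. f (xs[i := a])))"
  by (simp add: Cochains_def linear_iff_lin)

lemma CC_I: "\<lbrakk>\<And>xs. length xs \<noteq> n \<Longrightarrow> f xs = 0;
    \<And>xs i. \<lbrakk>length xs = n; i < n\<rbrakk> \<Longrightarrow> lin (\<lambda>a. f (xs[i := a]))\<rbrakk> \<Longrightarrow> f \<in> CC n"
  by (auto simp: CC_iff)

lemma CC_out: "\<lbrakk>f \<in> CC n; length xs \<noteq> n\<rbrakk> \<Longrightarrow> f xs = 0"
  by (auto simp: CC_iff)

lemma CC_lin: "\<lbrakk>f \<in> CC n; length xs = n; i < n\<rbrakk> \<Longrightarrow> lin (\<lambda>a. f (xs[i := a]))"
  by (auto simp: CC_iff)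

lemma lin_0: "lin (\<lambda>a. 0)"
  and lin_add: "\<lbrakk>lin \<phi>; lin \<psi>\<rbrakk> \<Longrightarrow> lin (\<lambda>a. \<phi> a + \<psi> a)"
  and lin_minus: "lin \<phi> \<Longrightarrow> lin (\<lambda>a. - \<phi> a)"
  and lin_scl: "lin \<phi> \<Longrightarrow> lin (\<lambda>a. scl M c (\<phi> a))"
  and lin_lmul: "lin \<phi> \<Longrightarrow> lin (\<lambda>a. lmul M b (\<phi> a))"
  and lin_rmul: "lin \<phi> \<Longrightarrow> lin (\<lambda>a. rmul M (\<phi> a) b)"
  and lin_mult_left: "lin \<phi> \<Longrightarrow> lin (\<lambda>a. \<phi> (b * a))"
  and lin_mult_right: "lin \<phi> \<Longrightarrow> lin (\<lambda>a. \<phi> (a * b))"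
  and lin_times_left: "lin \<phi> \<Longrightarrow> lin (\<lambda>a. x * \<phi> a)"
  and lin_times_right: "lin \<phi> \<Longrightarrow> lin (\<lambda>a. \<phi> a * x)"
  by (auto simp: lin_def vM.scale_right_distrib lmul_add_right lmul_scl_right rmul_add_left rmul_scl_left
      distrib_left distrib_right A.scl_mult_left A.scl_mult_right M.scl_mult_left M.scl_mult_right mult.commute)

lemma lin_alt_sign: "lin \<phi> \<Longrightarrow> lin (\<lambda>a. alt_sign k (\<phi> a))"
  by (cases "even k") (auto simp: alt_sign_def lin_minus)

lemma lin_sum: "(\<And>i. i \<in> S \<Longrightarrow> lin (\<phi> i)) \<Longrightarrow> lin (\<lambda>a. \<Sum>i \<in> S. \<phi> i a)"
  by (induction S rule: infinite_finite_induct) (auto simp: lin_0 lin_add)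

lemma CC_0: "0 \<in> CC n"
  by (auto simp: CC_iff lin_0)

lemma CC_add: "\<lbrakk>f \<in> CC n; g \<in> CC n\<rbrakk> \<Longrightarrow> f + g \<in> CC n"
  by (auto simp: CC_iff lin_add)

lemma CC_sc: "f \<in> CC n \<Longrightarrow> sc c f \<in> CC n"
  by (auto simp: CC_iff lin_scl sc_def)

lemma subspace_CC: "fM.subspace (CC n)"
  by (auto simp: fM.subspace_def CC_0 CC_add CC_sc)

lemma lin_face:
  assumes f: "f \<in> CC n" and xs: "length xs = Suc n" "i < Suc n" and k: "k \<le> Suc n"
  shows "lin (\<lambda>a. face n k f (xs[i := a]))"
proof -
  consider "k = 0" "i = 0" | i' where "k = 0" "i = Suc i'" | l where "k = Suc l" "k \<le> n"
    | "k = Suc n" "i < n" | "k = Suc n" "i = n"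
    using k xs(2) by (cases k; cases i) force+
  then show ?thesis
  proof cases
    case 1
    obtain b ys where "xs = b # ys" using xs by (cases xs) auto
    then show ?thesis using 1 by (auto simp: face_def lin_def lmul_add_left lmul_scl_left)
  next
    case 2
    obtain b ys where "xs = b # ys" using xs by (cases xs) auto
    then show ?thesis using 2 xs CC_lin[OF f, of ys i'] by (auto simp: face_def lin_lmul)
  next
    case 3
    have len: "length (contract l xs) = n" using 3 xs by (simp add: length_contract)
    consider "i < l" | "i = l" | "i = Suc l" | "Suc l < i" by linarith
    then show ?thesis
    proof cases
      case 1
      then show ?thesis using 3 xs CC_lin[OF f len] by (simp add: face_def contract_update_less)
    next
      case 2
      then show ?thesis using 3 xs lin_mult_right[OF CC_lin[OF f len, of l]]
        by (simp add: face_def contract_update_left)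
    next
      case i: 3
      then show ?thesis using 3 xs lin_mult_left[OF CC_lin[OF f len, of l]]
        by (simp add: face_def contract_update_right)
    next
      case 4
      then show ?thesis using 3 xs CC_lin[OF f len, of "i - 1"] by (simp add: face_def contract_update_greater)
    qed
  next
    case 4
    then have "last (xs[i := a]) = last xs" for a
      using xs by (subst (1 2) last_conv_nth) (auto simp: nth_list_update)
    then show ?thesis using 4 xs CC_lin[OF f, of "butlast xs" i]
      by (simp add: face_def butlast_list_update lin_rmul)
  next
    case 5
    have "last (xs[i := a]) = a" for a
      using xs 5 by (subst last_conv_nth) auto
    then show ?thesis using 5 xs
      by (simp add: face_def butlast_list_update lin_def rmul_add_right rmul_scl_right)
  qed
qed

lemma CC_hdiff: "f \<in> CC n \<Longrightarrow> hdiff M n f \<in> CC (Suc n)"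
proof (rule CC_I)
  show "length xs \<noteq> Suc n \<Longrightarrow> hdiff M n f xs = 0" for xs by (simp add: hdiff_def)
  fix xs :: "'a list" and i assume *: "f \<in> CC n" "length xs = Suc n" "i < Suc n"
  show "lin (\<lambda>a. hdiff M n f (xs[i := a]))"
    unfolding hdiff_eq using * by (auto intro!: lin_sum lin_alt_sign lin_face simp del: sum.atMost_Suc)
qed

lemma CC_cup: "\<lbrakk>f \<in> CC i; g \<in> CC j\<rbrakk> \<Longrightarrow> cup i j f g \<in> CC (i + j)"
proof (rule CC_I)
  show "length xs \<noteq> i + j \<Longrightarrow> cup i j f g xs = 0" for xs by (simp add: cup_def)
  fix xs :: "'a list" and k assume *: "f \<in> CC i" "g \<in> CC j" "length xs = i + j" "k < i + j"
  show "lin (\<lambda>a. cup i j f g (xs[k := a]))"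
  proof (cases "k < i")
    case True
    then show ?thesis using * CC_lin[OF *(1), of "take i xs" k]
      by (auto simp: cup_def take_update_swap intro!: lin_times_right)
  next
    case False
    then show ?thesis using * CC_lin[OF *(2), of "drop i xs" "k - i"]
      by (auto simp: cup_def drop_update_swap intro!: lin_times_left)
  qed
qed

lemma cup_unit: 
  assumes "f \<in> CC n"
  shows "cup 0 n unit_cochain f = f" "cup n 0 f unit_cochain = f"
  using CC_out[OF assms] by (auto simp: cup_def unit_cochain_def fun_eq_iff)

lemma CC_unit: "unit_cochain \<in> CC 0"
  by (rule CC_I) (auto simp: unit_cochain_def)

lemma hdiff_unit: "hdiff M 0 unit_cochain = 0"
proof
  fix xs :: "'a list"
  have "lmul M a 1 = rmul M 1 a" for a using mult_balanced[of 1 a 1] by simp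
  then show "hdiff M 0 unit_cochain xs = 0 xs"
    by (cases xs) (auto simp: hdiff_eq face_def unit_cochain_def)
qed

end

section \<open>Powers of \<open>1 - R\<close> in characteristic \<open>p\<close>\<close>

context vector_space
begin

lemma funpow_one_minus:
  fixes T R :: "'b \<Rightarrow> 'b"
  assumes T: "\<And>x. T x = x - R x"
    and R: "\<And>x y. R (x + y) = R x + R y" "\<And>c x. R (scale c x) = scale c (R x)"
  shows "(T ^^ n) x = (\<Sum>k\<le>n. scale (of_nat (n choose k)) (alt_sign k ((R ^^ k) x)))"
proof (induction n)
  case (Suc n)
  have R0: "R 0 = 0" using R(2)[of 0 0] by simp
  have R_minus: "R (- y) = - R y" for y using R(2)[of "-1" y] by simp
  have R_sum: "R (sum f S) = (\<Sum>i \<in> S. R (f i))" for f :: "nat \<Rightarrow> 'b" and S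
    by (induction S rule: infinite_finite_induct) (auto simp: R R0)
  let ?c = "\<lambda>n k. scale (of_nat (n choose k))" and ?x = "\<lambda>k. alt_sign k ((R ^^ k) x)"
  have R_x: "R (?x k) = - ?x (Suc k)" for k by (auto simp: alt_sign_def R_minus)
  have "(\<Sum>k\<le>Suc n. ?c (Suc n) k (?x k)) = x + (\<Sum>k\<le>n. ?c n k (?x (Suc k)) + ?c n (Suc k) (?x (Suc k)))"
    by (subst sum.atMost_Suc_shift) (simp add: scale_left_distrib)
  also have "\<dots> = (x + (\<Sum>k\<le>n. ?c n (Suc k) (?x (Suc k)))) + (\<Sum>k\<le>n. ?c n k (?x (Suc k)))"
    by (simp only: sum.distrib add_ac)
  also have "x + (\<Sum>k\<le>n. ?c n (Suc k) (?x (Suc k))) = (\<Sum>k\<le>Suc n. ?c n k (?x k))"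
    by (subst sum.atMost_Suc_shift) (simp only: binomial_n_0 of_nat_1 scale_one alt_sign_simps(1) funpow_0)
  also have "\<dots> = (T ^^ n) x" by (simp add: Suc binomial_eq_0)
  also have "(\<Sum>k\<le>n. ?c n k (?x (Suc k))) = - R ((T ^^ n) x)"
    by (simp only: Suc R_sum R(2) R_x scale_minus_right sum_negf minus_minus)
  finally show ?case using T[of "(T ^^ n) x"] by (simp del: sum.atMost_Suc)
qed simp

text \<open>
  In characteristic \<open>p\<close> only the outer terms of the binomial expansion of \<open>(1 - R)^p\<close> survive; iterating this
  treats all powers of \<open>p\<close>.
\<close>

lemma funpow_one_minus_CHAR:
  fixes T R :: "'b \<Rightarrow> 'b"
  assumes p: "CHAR('a) = p" "Factorial_Ring.prime p"
    and T: "\<And>x. T x = x - R x"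
    and R: "\<And>x y. R (x + y) = R x + R y" "\<And>c x. R (scale c x) = scale c (R x)"
  shows "(T ^^ (p ^ r)) x = x - (R ^^ (p ^ r)) x"
  using T R
proof (induction r arbitrary: T R x)
  case (Suc r)
  have Tp: "(T ^^ p) y = y - (R ^^ p) y" for y
  proof -
    have "(T ^^ p) y = (\<Sum>k\<in>{0, p}. scale (of_nat (p choose k)) (alt_sign k ((R ^^ k) y)))"
      unfolding funpow_one_minus[OF Suc.prems]
    proof (rule sum.mono_neutral_right)
      show "\<forall>k\<in>{..p} - {0, p}. scale (of_nat (p choose k)) (alt_sign k ((R ^^ k) y)) = 0"
      proof
        fix k assume "k \<in> {..p} - {0, p}"
        then have "p dvd (p choose k)" using p(2) by (intro dvd_choose_prime) auto
        then have "(of_nat (p choose k) :: 'a) = 0" using p(1) by (simp add: of_nat_eq_0_iff_char_dvd)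
        then show "scale (of_nat (p choose k)) (alt_sign k ((R ^^ k) y)) = 0" by simp
      qed
    qed auto
    also have "\<dots> = y + alt_sign p ((R ^^ p) y)"
      using prime_gt_0_nat[OF p(2)] by simp
    also have "alt_sign p z = - z" for z :: 'b
    proof (cases "p = 2")
      case True
      then have "(of_nat 2 :: 'a) = 0" using p(1) of_nat_CHAR[where ?'a = 'a] by metis
      then have "scale (1 + 1) z = 0" by simp
      then have "z + z = 0" by (simp only: scale_left_distrib scale_one)
      then show ?thesis by (simp add: alt_sign_def eq_neg_iff_add_eq_0)
    next
      case False
      then have "odd p" using p(2) prime_odd_nat prime_ge_2_nat[OF p(2)] by force
      then show ?thesis by (simp add: alt_sign_def)
    qed
    finally show ?thesis by simp
  qed
  have Rp: "(R ^^ k) (y + z) = (R ^^ k) y + (R ^^ k) z" "(R ^^ k) (scale c y) = scale c ((R ^^ k) y)" for k y z c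
    by (induction k) (auto simp: Suc.prems)
  have "((T ^^ p) ^^ (p ^ r)) x = x - ((R ^^ p) ^^ (p ^ r)) x"
    by (rule Suc.IH[OF Tp Rp])
  then show ?case by (simp add: funpow_mult)
qed simp

end

context AeG_module_algebra
begin

sublocale reps: graded_reps sc cup unit_cochain
  by unfold_locales (auto simp: cup_add_left cup_add_right cup_sc_left cup_sc_right cup_assoc)

section \<open>Cohomology of subalgebras of the Hochschild complex\<close>

definition subcomplex :: "(nat \<Rightarrow> ('a list \<Rightarrow> 'm) set) \<Rightarrow> nat \<Rightarrow> ('k, 'a list \<Rightarrow> 'm) module" where
  "subcomplex K n = (Cochains A M n)\<lparr>carrier := K n\<rparr>"

abbreviation "Zs K n \<equiv> cocycles (subcomplex K) (hdiff M) n"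
abbreviation "Bs K n \<equiv> coboundaries (subcomplex K) (hdiff M) n"

text \<open>
  The class of \<open>z\<close> in the cohomology of the subcomplex \<open>K\<close>. The same cochain has classes for several \<open>K\<close>, hence the
  explicit argument.
\<close>

definition cls :: "(nat \<Rightarrow> ('a list \<Rightarrow> 'm) set) \<Rightarrow> nat \<Rightarrow> ('a list \<Rightarrow> 'm) \<Rightarrow> ('a list \<Rightarrow> 'm) set" where
  "cls K n z = (\<lambda>b. b + z) ` Bs K n"

lemma Cochains_simps [simp]: "\<zero>\<^bsub>Cochains A M n\<^esub> = 0" "f \<oplus>\<^bsub>Cochains A M n\<^esub> g = f + g"
  "c \<odot>\<^bsub>Cochains A M n\<^esub> f = sc c f"
  by (auto simp: Cochains_def sc_def fun_eq_iff)

lemma subcomplex_simps [simp]: "\<zero>\<^bsub>subcomplex K n\<^esub> = 0" "f \<oplus>\<^bsub>subcomplex K n\<^esub> g = f + g"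
  "c \<odot>\<^bsub>subcomplex K n\<^esub> f = sc c f" "carrier (subcomplex K n) = K n"
  by (auto simp: subcomplex_def)

lemma Zs_iff: "z \<in> Zs K n \<longleftrightarrow> z \<in> K n \<and> hdiff M n z = 0"
  by (auto simp: cocycles_def)

lemma Bs_0: "Bs K 0 = {0}" and Bs_Suc: "Bs K (Suc n) = hdiff M n ` K n"
  by (simp_all add: coboundaries_def)

definition dg_subalgebra :: "(nat \<Rightarrow> ('a list \<Rightarrow> 'm) set) \<Rightarrow> bool" where
  "dg_subalgebra K \<longleftrightarrow> (\<forall>n. fM.subspace (K n) \<and> K n \<subseteq> CC n) \<and> (\<forall>n. \<forall>f \<in> K n. hdiff M n f \<in> K (Suc n)) \<and>
     (\<forall>i j. \<forall>f \<in> K i. \<forall>g \<in> K j. cup i j f g \<in> K (i + j)) \<and> unit_cochain \<in> K 0"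

lemma dg_subalgebraD:
  assumes "dg_subalgebra K"
  shows "fM.subspace (K n)" "K n \<subseteq> CC n" "f \<in> K n \<Longrightarrow> hdiff M n f \<in> K (Suc n)"
    "\<lbrakk>f \<in> K i; g \<in> K j\<rbrakk> \<Longrightarrow> cup i j f g \<in> K (i + j)" "unit_cochain \<in> K 0"
  using assms by (auto simp: dg_subalgebra_def)

lemma hdiff_0: "hdiff M n 0 = 0" 
  using hdiff_sc[of n 0 0] by simp

lemma subspace_Zs: "dg_subalgebra K \<Longrightarrow> fM.subspace (Zs K n)"
  using dg_subalgebraD(1)[of K n] by (auto simp: fM.subspace_def Zs_iff hdiff_0 hdiff_add hdiff_sc)

lemma subspace_Bs: "dg_subalgebra K \<Longrightarrow> fM.subspace (Bs K n)"
proof (cases n)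
  case (Suc k)
  assume K: "dg_subalgebra K"
  show ?thesis
    unfolding Suc Bs_Suc fM.subspace_def
  proof (intro conjI ballI allI)
    show "0 \<in> hdiff M k ` K k" using hdiff_0 fM.subspace_0[OF dg_subalgebraD(1)[OF K]] by (metis imageI)
    show "x + y \<in> hdiff M k ` K k" if "x \<in> hdiff M k ` K k" "y \<in> hdiff M k ` K k" for x y
      using that fM.subspace_add[OF dg_subalgebraD(1)[OF K]] by (auto simp flip: hdiff_add)
    show "sc c x \<in> hdiff M k ` K k" if "x \<in> hdiff M k ` K k" for x c
      using that fM.subspace_scale[OF dg_subalgebraD(1)[OF K]] by (auto simp flip: hdiff_sc)
  qed
qed (auto simp: Bs_0 fM.subspace_def)

lemma Bs_subset: "dg_subalgebra K \<Longrightarrow> Bs K n \<subseteq> Zs K n"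
  by (cases n) (auto simp: Bs_0 Bs_Suc Zs_iff hdiff_hdiff hdiff_0 dg_subalgebraD(3) fM.subspace_0 dg_subalgebraD(1))

lemma cup_Zs:
  assumes K: "dg_subalgebra K" and "f \<in> Zs K i" "g \<in> Zs K j"
  shows "cup i j f g \<in> Zs K (i + j)"
  using assms(2,3) by (auto simp: Zs_iff dg_subalgebraD(4)[OF K] hdiff_cup cup_0_left cup_0_right)

lemma alt_sign_sc: "alt_sign n f = sc ((-1) ^ n) f"
  by (cases "even n") (auto simp: alt_sign_def)

lemma cup_alt_sign_right: "cup i j f (alt_sign n g) = alt_sign n (cup i j f (g :: 'a list \<Rightarrow> 'm))"
  by (simp add: alt_sign_sc cup_sc_right)

lemma hdiff_alt_sign: "hdiff M i (alt_sign n f) = alt_sign n (hdiff M i f)"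
  by (simp add: alt_sign_sc hdiff_sc)

lemma alt_sign_mem: "fM.subspace S \<Longrightarrow> f \<in> S \<Longrightarrow> alt_sign n f \<in> S"
  by (simp add: alt_sign_sc fM.subspace_scale)

lemma cup_Bs_left:
  assumes K: "dg_subalgebra K" and b: "b \<in> Bs K i" and g: "g \<in> Zs K j"
  shows "cup i j b g \<in> Bs K (i + j)"
proof (cases i)
  case 0
  then show ?thesis using b fM.subspace_0[OF subspace_Bs[OF K]] by (simp add: Bs_0 cup_0_left)
next
  case (Suc k)
  then obtain f where f: "f \<in> K k" "b = hdiff M k f" using b by (auto simp: Bs_Suc)
  have "hdiff M (k + j) (cup k j f g) = cup i j b g"
    using g f Suc by (simp add: hdiff_cup Zs_iff cup_0_right)
  moreover have "cup k j f g \<in> K (k + j)" using f g dg_subalgebraD(4)[OF K] by (simp add: Zs_iff)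
  ultimately have "cup i j b g \<in> hdiff M (k + j) ` K (k + j)" by (metis imageI)
  then show ?thesis using Suc by (simp add: Bs_Suc)
qed

lemma cup_Bs_right:
  assumes K: "dg_subalgebra K" and f: "f \<in> Zs K i" and b: "b \<in> Bs K j"
  shows "cup i j f b \<in> Bs K (i + j)"
proof (cases j)
  case 0
  then show ?thesis using b fM.subspace_0[OF subspace_Bs[OF K]] by (simp add: Bs_0 cup_0_right)
next
  case (Suc k)
  then obtain g where g: "g \<in> K k" "b = hdiff M k g" using b by (auto simp: Bs_Suc)
  have "hdiff M (i + k) (cup i k f (alt_sign i g)) = cup i j f b"
    using g f Suc by (simp add: hdiff_cup Zs_iff cup_0_left hdiff_alt_sign cup_alt_sign_right)
  moreover have "cup i k f (alt_sign i g) \<in> K (i + k)"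
    using f g dg_subalgebraD(4)[OF K] alt_sign_mem[OF dg_subalgebraD(1)[OF K]] by (simp add: Zs_iff)
  ultimately have "cup i j f b \<in> hdiff M (i + k) ` K (i + k)" by (metis imageI)
  then show ?thesis using Suc by (simp add: Bs_Suc)
qed

lemma lin_onto_subcomplex:
  assumes W: "fM.subspace W"
  shows "lin_onto sc W id ((subcomplex K n)\<lparr>carrier := W\<rparr>)"
  using W by (auto simp: lin_onto_def)

lemma cls_coset_proj: "cls K n = coset_proj ((subcomplex K n)\<lparr>carrier := W\<rparr>) id (Bs K n)"
  by (rule ext) (auto simp: cls_def coset_proj_def a_r_coset_def')

lemma lin_onto_cls:
  assumes K: "dg_subalgebra K"
  shows "lin_onto sc (Zs K n) (cls K n) (gcomp (cohomology (subcomplex K) (hdiff M) cup unit_cochain) n)"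
  using fM.lin_onto_quot[OF lin_onto_subcomplex[where K = K and n = n, OF subspace_Zs[OF K, of n]] subspace_Bs[OF K] Bs_subset[OF K]]
  by (simp add: cohomology_def cls_coset_proj[where W = "Zs K n"])

lemma cls_eq_0_iff:
  assumes K: "dg_subalgebra K" and z: "z \<in> Zs K n"
  shows "cls K n z = cls K n 0 \<longleftrightarrow> z \<in> Bs K n"
  using fM.coset_proj_eq_0_iff[OF lin_onto_subcomplex[where K = K and n = n, OF subspace_Zs[OF K, of n]] subspace_Bs[OF K] Bs_subset[OF K] z]
  by (simp add: cls_coset_proj[where W = "Zs K n"])

lemma cls_eq_iff:
  assumes K: "dg_subalgebra K" and z: "z \<in> Zs K n" "z' \<in> Zs K n"
  shows "cls K n z = cls K n z' \<longleftrightarrow> z - z' \<in> Bs K n"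
  using fM.lin_onto_eq_iff[OF lin_onto_cls[OF K] z] cls_eq_0_iff[OF K fM.subspace_diff[OF subspace_Zs[OF K] z]]
  by simp

lemma gmult_cls:
  assumes K: "dg_subalgebra K" and z: "z \<in> Zs K i" "w \<in> Zs K j"
  shows "gmult (cohomology (subcomplex K) (hdiff M) cup unit_cochain) i j (cls K i z) (cls K j w) =
    cls K (i + j) (cup i j z w)"
proof -
  let ?B = "Bs K (i + j)"
  have sub: "x + y \<in> ?B" if "x \<in> ?B" "y \<in> ?B" for x y
    using that fM.subspace_add[OF subspace_Bs[OF K]] by blast
  have "gmult (cohomology (subcomplex K) (hdiff M) cup unit_cochain) i j (cls K i z) (cls K j w) =
     (\<Union>b \<in> ?B. \<Union>x \<in> Bs K i. \<Union>y \<in> Bs K j. {b + cup i j (x + z) (y + w)})"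
    by (auto simp: cohomology_def set_add_def' cls_def) blast+
  also have "\<dots> = (\<lambda>b. b + cup i j z w) ` ?B"
  proof (intro equalityI subsetI)
    fix u assume "u \<in> (\<Union>b \<in> ?B. \<Union>x \<in> Bs K i. \<Union>y \<in> Bs K j. {b + cup i j (x + z) (y + w)})"
    then obtain b x y where u: "b \<in> ?B" "x \<in> Bs K i" "y \<in> Bs K j" "u = b + cup i j (x + z) (y + w)" by blast
    have "cup i j (x + z) (y + w) = cup i j x (y + w) + cup i j z y + cup i j z w"
      by (simp add: cup_add_left cup_add_right algebra_simps)
    moreover have "y + w \<in> Zs K j"
      using u(3) z(2) Bs_subset[OF K] fM.subspace_add[OF subspace_Zs[OF K]] by blast
    then have "b + cup i j x (y + w) + cup i j z y \<in> ?B"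
      using u cup_Bs_left[OF K] cup_Bs_right[OF K z(1)] by (intro sub) auto
    ultimately show "u \<in> (\<lambda>b. b + cup i j z w) ` ?B"
      using u(4) by (auto simp: image_iff algebra_simps)
  next
    fix u assume "u \<in> (\<lambda>b. b + cup i j z w) ` ?B"
    then obtain b where "b \<in> ?B" "u = b + cup i j (0 + z) (0 + w)" by auto
    then show "u \<in> (\<Union>b \<in> ?B. \<Union>x \<in> Bs K i. \<Union>y \<in> Bs K j. {b + cup i j (x + z) (y + w)})"
      using fM.subspace_0[OF subspace_Bs[OF K]] by blast
  qed
  finally show ?thesis by (simp add: cls_def)
qed

lemma alg_rep_cohomology:
  assumes K: "dg_subalgebra K"
  shows "reps.alg_rep (Zs K) (cls K) (cohomology (subcomplex K) (hdiff M) cup unit_cochain)"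
  unfolding reps.alg_rep_def
proof (intro conjI allI ballI)
  show "unit_cochain \<in> Zs K 0" using dg_subalgebraD(5)[OF K] by (simp add: Zs_iff hdiff_unit)
  show "gone (cohomology (subcomplex K) (hdiff M) cup unit_cochain) = cls K 0 unit_cochain"
    by (auto simp: cohomology_def cls_def a_r_coset_def')
  show "cup 0 n unit_cochain a = a" "cup n 0 a unit_cochain = a" if "a \<in> Zs K n" for n a
    using that dg_subalgebraD(2)[OF K] cup_unit[of a n] by (auto simp: Zs_iff)
qed (simp_all add: lin_onto_cls[OF K] cup_Zs[OF K] gmult_cls[OF K])

section \<open>The group action on cochains\<close>

lemma group_G: "group G"
  using A.action by (simp add: group_action_def group_hom_def)

lemma act_A_comp: "\<lbrakk>g \<in> carrier G; g' \<in> carrier G\<rbrakk> \<Longrightarrow> act A (g \<otimes>\<^bsub>G\<^esub> g') x = act A g (act A g' x)"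
  using group_action.composition_rule[OF A.action] by simp

lemma act_M_comp: "\<lbrakk>g \<in> carrier G; g' \<in> carrier G\<rbrakk> \<Longrightarrow> act M (g \<otimes>\<^bsub>G\<^esub> g') x = act M g (act M g' x)"
  using group_action.composition_rule[OF M.action] by simp

lemma act_A_one: "act A \<one>\<^bsub>G\<^esub> x = x"
  using group_action.id_eq_one[OF A.action] by (metis UNIV_I restrict_apply')

lemma act_M_one: "act M \<one>\<^bsub>G\<^esub> x = x"
  using group_action.id_eq_one[OF M.action] by (metis UNIV_I restrict_apply')

lemma act_A_inv: "g \<in> carrier G \<Longrightarrow> act A g (act A (inv\<^bsub>G\<^esub> g) x) = x"
  by (simp add: act_A_comp[symmetric] group.inv_closed[OF group_G] group.r_inv[OF group_G] act_A_one)

lemma act_A_add: "g \<in> carrier G \<Longrightarrow> act A g (x + y) = act A g x + act A g y"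
  and act_A_scl: "g \<in> carrier G \<Longrightarrow> act A g (scl A c x) = scl A c (act A g x)"
  using A.act_linear[of g] by (simp_all add: Vector_Spaces.linear_iff)

lemma act_M_add: "g \<in> carrier G \<Longrightarrow> act M g (x + y) = act M g x + act M g y"
  and act_M_scl: "g \<in> carrier G \<Longrightarrow> act M g (scl M c x) = scl M c (act M g x)"
  using M.act_linear[of g] by (simp_all add: Vector_Spaces.linear_iff)

lemma act_M_0: "g \<in> carrier G \<Longrightarrow> act M g 0 = 0"
  using act_M_scl[of g 0 0] by simp

lemma act_M_minus: "g \<in> carrier G \<Longrightarrow> act M g (- x) = - act M g x"
  using act_M_scl[of g "-1" x] by simp

lemma act_M_diff: "g \<in> carrier G \<Longrightarrow> act M g (x - y) = act M g x - act M g y"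
  using act_M_add[of g x "- y"] by (simp add: act_M_minus)

lemma act_M_alt_sign: "g \<in> carrier G \<Longrightarrow> act M g (alt_sign k x) = alt_sign k (act M g x)"
  by (auto simp: alt_sign_def act_M_minus)

lemma act_M_sum: "g \<in> carrier G \<Longrightarrow> act M g (sum f S) = (\<Sum>i \<in> S. act M g (f i))"
  by (induction S rule: infinite_finite_induct) (auto simp: act_M_add act_M_0)

abbreviation cact :: "'g \<Rightarrow> ('a list \<Rightarrow> 'm) \<Rightarrow> 'a list \<Rightarrow> 'm" where
  "cact \<equiv> coch_act G A M"

lemma cact_comp:
  assumes "g \<in> carrier G" "g' \<in> carrier G"
  shows "cact (g \<otimes>\<^bsub>G\<^esub> g') f = cact g (cact g' f)"
proof -
  interpret group G by (rule group_G)
  have "act A (inv\<^bsub>G\<^esub> g' \<otimes>\<^bsub>G\<^esub> inv\<^bsub>G\<^esub> g) = act A (inv\<^bsub>G\<^esub> g') \<circ> act A (inv\<^bsub>G\<^esub> g)"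
    using assms by (auto simp: act_A_comp)
  then show ?thesis
    using assms by (intro ext) (simp add: coch_act_def act_M_comp inv_mult_group)
qed

lemma cact_one: "cact \<one>\<^bsub>G\<^esub> f = f"
proof -
  interpret group G by (rule group_G)
  have "act A \<one>\<^bsub>G\<^esub> = id" by (rule ext) (simp add: act_A_one)
  then show ?thesis by (intro ext) (simp add: coch_act_def act_M_one)
qed

context
  fixes g assumes g: "g \<in> carrier G"
begin

lemma cact_add: "cact g (f + f') = cact g f + cact g f'"
  using g by (simp add: coch_act_def fun_eq_iff act_M_add)

lemma cact_diff: "cact g (f - f') = cact g f - cact g f'"
  using g by (simp add: coch_act_def fun_eq_iff act_M_diff)

lemma cact_0: "cact g 0 = 0"
  using g by (simp add: coch_act_def fun_eq_iff act_M_0)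

lemma cact_sc: "cact g (sc c f) = sc c (cact g f)"
  using g by (simp add: coch_act_def fun_eq_iff act_M_scl sc_def)

lemma cact_sum: "cact g (sum F S) = (\<Sum>i \<in> S. cact g (F i))"
  by (induction S rule: infinite_finite_induct)
    (simp_all only: sum.infinite sum.empty sum.insert cact_add cact_0 not_False_eq_True)

lemma cact_unit: "cact g unit_cochain = unit_cochain"
  using g by (simp add: coch_act_def fun_eq_iff unit_cochain_def M.act_one act_M_0)

lemma cact_cup: "cact g (cup i j f f') = cup i j (cact g f) (cact g f')"
  using g by (auto simp: coch_act_def fun_eq_iff cup_def M.act_mult act_M_0 take_map drop_map)

lemma cact_face:
  assumes "length xs = Suc n"
  shows "face n k (cact g f) xs = act M g (face n k f (map (act A (inv\<^bsub>G\<^esub> g)) xs))"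
proof -
  have "inv\<^bsub>G\<^esub> g \<in> carrier G" "xs \<noteq> []" using g assms by (auto simp: group.inv_closed[OF group_G])
  then show ?thesis using g
    by (auto simp: face_def coch_act_def act_lmul act_rmul act_A_inv hd_map last_map map_tl map_butlast
        map_contract A.act_mult)
qed

lemma cact_hdiff: "cact g (hdiff M n f) = hdiff M n (cact g f)"
proof
  fix xs
  have "cact g (hdiff M n f) xs = act M g (hdiff M n f (map (act A (inv\<^bsub>G\<^esub> g)) xs))"
    by (simp only: coch_act_def)
  also have "\<dots> = hdiff M n (cact g f) xs"
    using g by (simp add: hdiff_eq cact_face act_M_sum act_M_alt_sign act_M_0 del: sum.atMost_Suc)
  finally show "cact g (hdiff M n f) xs = hdiff M n (cact g f) xs" .
qed

lemma cact_CC: "f \<in> CC n \<Longrightarrow> cact g f \<in> CC n"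
proof (rule CC_I)
  assume f: "f \<in> CC n"
  show "length xs \<noteq> n \<Longrightarrow> cact g f xs = 0" for xs
    using f g by (simp add: coch_act_def CC_out act_M_0)
  fix xs :: "'a list" and i assume "length xs = n" "i < n"
  then have *: "lin (\<lambda>a. f ((map (act A (inv\<^bsub>G\<^esub> g)) xs)[i := a]))" using CC_lin[OF f] by simp
  have "inv\<^bsub>G\<^esub> g \<in> carrier G" using g by (simp add: group.inv_closed[OF group_G])
  then show "lin (\<lambda>a. cact g f (xs[i := a]))"
    using * g by (auto simp: lin_def coch_act_def map_update act_A_add act_A_scl act_M_add act_M_scl)
qed

end

definition fixed_cochains :: "'g set \<Rightarrow> nat \<Rightarrow> ('a list \<Rightarrow> 'm) set" where
  "fixed_cochains S n = fixed_by cact S (CC n)"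

lemma fixed_cochains_iff: "f \<in> fixed_cochains S n \<longleftrightarrow> f \<in> CC n \<and> (\<forall>g \<in> S. cact g f = f)"
  by (auto simp: fixed_cochains_def fixed_by_def)

lemma dg_subalgebra_fixed_cochains: "S \<subseteq> carrier G \<Longrightarrow> dg_subalgebra (fixed_cochains S)"
  using subspace_CC unfolding dg_subalgebra_def fM.subspace_def
  by (auto simp: fixed_cochains_iff subset_iff cact_add cact_0 cact_sc cact_cup cact_hdiff cact_unit CC_hdiff CC_cup CC_unit)

lemma subcomplex_empty: "subcomplex (fixed_cochains {}) = Cochains A M"
  by (rule ext) (simp add: subcomplex_def fixed_cochains_def fixed_by_def)

lemma subcomplex_carrier: "subcomplex (fixed_cochains (carrier G)) = inv_Cochains G A M"
  by (rule ext) (simp add: subcomplex_def fixed_cochains_def inv_Cochains_def)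

lemma cact_pow: "g \<in> carrier G \<Longrightarrow> (cact g ^^ k) f = cact (g [^]\<^bsub>G\<^esub> k) f"
proof (induction k)
  case (Suc k)
  interpret group G by (rule group_G)
  have "g [^]\<^bsub>G\<^esub> Suc k = g \<otimes>\<^bsub>G\<^esub> g [^]\<^bsub>G\<^esub> k" using Suc.prems by (rule nat_pow_Suc2)
  then show ?case using Suc by (simp add: cact_comp)
qed (simp add: cact_one)

end

section \<open>Degenerated modules\<close>

locale degenerated_module = AeG_module_algebra G A M
  for G :: "'g monoid" and A :: "('g, 'k::field, 'a::{ring,monoid_mult}) mod_alg"
    and M :: "('g, 'k, 'a, 'm::{ring,monoid_mult}) bimod_alg" +
  fixes H \<rho> :: "'g set" and p q r :: nat and m :: 'm and h :: "'a \<Rightarrow> 'm"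
  assumes char: "CHAR('k) = p" "p > 0"
    and q: "q = p ^ r"
    and finite_G: "finite (carrier G)"
    and normal_H: "H \<lhd> G" and card_H: "\<not> p dvd card H"
    and quotient: "card (carrier (G Mod H)) = q" "\<rho> \<in> carrier (G Mod H)"
      "generate (G Mod H) {\<rho>} = carrier (G Mod H)"
    and deg: "degenerated G H \<rho> q A M m h"
begin

sublocale normal H G by (rule normal_H)

definition g0 :: 'g where "g0 = (SOME g. g \<in> \<rho>)"

lemma g0: "g0 \<in> carrier G" "\<rho> = H #>\<^bsub>G\<^esub> g0"
proof -
  obtain g where g: "g \<in> carrier G" "\<rho> = H #>\<^bsub>G\<^esub> g" using quotient(2) by (auto simp: carrier_FactGroup)
  then have "g \<in> \<rho>" using rcos_self[OF g(1) subgroup_axioms] by simp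
  then have "g0 \<in> \<rho>" unfolding g0_def by (rule someI)
  then have *: "g0 \<in> H #>\<^bsub>G\<^esub> g" using g by simp
  then show "g0 \<in> carrier G" using r_coset_subset_G[OF subset g(1)] by blast
  show "\<rho> = H #>\<^bsub>G\<^esub> g0" using repr_independence[OF * g(1) subgroup_axioms] g(2) by simp
qed

lemma q_pos: "0 < q" using char(2) q by simp

lemma G_decomposition:
  assumes g: "g \<in> carrier G"
  shows "\<exists>x \<in> H. \<exists>k::nat. g = x \<otimes>\<^bsub>G\<^esub> (g0 [^]\<^bsub>G\<^esub> k)"
proof -
  interpret Q: group "G Mod H" by (rule factorgroup_is_group)
  have fin: "finite (carrier (G Mod H))"
    using finite_G by (simp add: carrier_FactGroup)
  have "H #>\<^bsub>G\<^esub> g \<in> generate (G Mod H) {\<rho>}" using g quotient(3) by (auto simp: carrier_FactGroup)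
  then obtain k :: nat where "H #>\<^bsub>G\<^esub> g = \<rho> [^]\<^bsub>G Mod H\<^esub> k"
    using Q.generate_pow_on_finite_carrier[OF fin quotient(2)] by auto
  then have "H #>\<^bsub>G\<^esub> g = H #>\<^bsub>G\<^esub> (g0 [^]\<^bsub>G\<^esub> k)" using FactGroup_pow[OF g0(1)] g0(2) by simp
  then have "g \<in> H #>\<^bsub>G\<^esub> (g0 [^]\<^bsub>G\<^esub> k)" using rcos_self[OF g subgroup_axioms] by simp
  then show ?thesis by (auto simp: r_coset_def)
qed

lemma g0_pow_q: "g0 [^]\<^bsub>G\<^esub> q \<in> H"
proof -
  interpret Q: group "G Mod H" by (rule factorgroup_is_group)
  have "\<rho> [^]\<^bsub>G Mod H\<^esub> q = H"
    using Q.pow_order_eq_1[OF quotient(2)] quotient(1) by (simp add: Coset.order_def)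
  then have "H #>\<^bsub>G\<^esub> (g0 [^]\<^bsub>G\<^esub> q) = H" using FactGroup_pow[OF g0(1)] g0(2) by simp
  then show ?thesis using coset_join1 g0(1) subgroup_axioms by blast
qed

lemma H_carrier: "x \<in> H \<Longrightarrow> x \<in> carrier G"
  using subset by blast

text \<open>
  Invariance modulo a stable subspace \<open>W\<close> propagates from \<open>H\<close> and \<open>g0\<close> to the group that they generate. With
  \<open>W = 0\<close> this describes the invariant cochains, with the coboundaries for \<open>W\<close> the invariant classes.
\<close>

lemma invariance_mod:
  assumes W: "fM.subspace W" "\<And>g w. \<lbrakk>g \<in> carrier G; w \<in> W\<rbrakk> \<Longrightarrow> cact g w \<in> W"
    and z: "\<And>x. x \<in> H \<Longrightarrow> cact x z - z \<in> W" "cact g0 z - z \<in> W" and g: "g \<in> carrier G"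
  shows "cact g z - z \<in> W"
proof -
  have comp: "cact (x \<otimes>\<^bsub>G\<^esub> y) z - z \<in> W"
    if "cact x z - z \<in> W" "cact y z - z \<in> W" "x \<in> carrier G" "y \<in> carrier G" for x y
  proof -
    have "cact (x \<otimes>\<^bsub>G\<^esub> y) z - z = cact x (cact y z - z) + (cact x z - z)"
      using that by (simp add: cact_comp cact_diff)
    moreover have "cact x (cact y z - z) + (cact x z - z) \<in> W"
      using that W by (intro fM.subspace_add) auto
    ultimately show ?thesis by (simp only:)
  qed
  define gp where "gp k = g0 [^]\<^bsub>G\<^esub> (k::nat)" for k
  have gp: "gp 0 = \<one>\<^bsub>G\<^esub>" "gp (Suc k) = gp k \<otimes>\<^bsub>G\<^esub> g0" "gp k \<in> carrier G" for k
    using g0(1) by (simp_all add: gp_def)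
  have pow: "cact (gp k) z - z \<in> W" for k
  proof -
    define P where "P g \<longleftrightarrow> cact g z - z \<in> W" for g
    have "cact \<one>\<^bsub>G\<^esub> z - z = 0" unfolding cact_one by (rule diff_self)
    then have 0: "P (gp 0)" unfolding P_def gp(1) using fM.subspace_0[OF W(1)] by metis
    have "P (gp (Suc k))" if "P (gp k)" for k
      using comp[OF _ z(2) gp(3) g0(1)] that unfolding P_def gp(2) by blast
    then have "P (gp k)" using 0 by (induction k) auto
    then show ?thesis unfolding P_def .
  qed
  obtain x k where "x \<in> H" "g = x \<otimes>\<^bsub>G\<^esub> gp k" using G_decomposition[OF g] by (auto simp: gp_def)
  then show ?thesis using comp[OF z(1) pow] gp(3) H_carrier by auto
qed

definition T :: "('a list \<Rightarrow> 'm) \<Rightarrow> 'a list \<Rightarrow> 'm" where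
  "T f = f - cact g0 f"

lemma T_diff: "T (f - f') = T f - T f'"
  unfolding T_def cact_diff[OF g0(1)] by (simp add: algebra_simps)

lemma T_zero: "T 0 = 0"
  by (simp add: T_def cact_0 g0(1))

lemma funpow_T_zero: "(T ^^ k) 0 = 0"
  by (induction k) (simp_all add: T_zero[unfolded zero_fun_def])

lemma T_sc: "T (sc c f) = sc c (T f)"
  by (simp add: T_def cact_sc g0(1) fM.scale_right_diff_distrib)

lemma hdiff_diff: "hdiff M n (f - f') = hdiff M n f - hdiff M n f'"
  using hdiff_add[of n "f - f'" f'] by (simp add: eq_diff_eq)

lemma cup_diff_right: "cup i j f (g - g') = cup i j f g - (cup i j f g' :: 'a list \<Rightarrow> 'm)"
  using cup_add_right[of i j f "g - g'" g'] by (simp add: eq_diff_eq)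

lemma cup_diff_left: "cup i j (f - f') g = cup i j f g - (cup i j f' g :: 'a list \<Rightarrow> 'm)"
  using cup_add_left[of i j "f - f'" f' g] by (simp add: eq_diff_eq)

lemma hdiff_uminus: "hdiff M n (- f) = - hdiff M n f"
  using hdiff_diff[of n 0 f] by (simp add: hdiff_0)

lemma T_uminus: "T (- f) = - T f"
  using T_diff[of 0 f] by (simp add: T_zero)

lemma cup_uminus_right: "cup i j f (- g) = - (cup i j f g :: 'a list \<Rightarrow> 'm)"
  using cup_diff_right[of i j f 0 g] by (simp add: cup_0_right)

lemma T_hdiff: "T (hdiff M n f) = hdiff M n (T f)"
  by (simp add: T_def cact_hdiff g0(1) hdiff_diff)

lemma T_cup_left: "cact g0 a = a \<Longrightarrow> T (cup i j a f) = cup i j a (T f)"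
  by (simp add: T_def cact_cup g0(1) cup_diff_right)

lemma T_cup_right: "cact g0 a = a \<Longrightarrow> T (cup i j f a) = cup i j (T f) a"
  by (simp add: T_def cact_cup g0(1) cup_diff_left)

lemma funpow_T_cup_left: "cact g0 a = a \<Longrightarrow> (T ^^ k) (cup i j a f) = cup i j a ((T ^^ k) f)"
  by (induction k) (auto simp: T_cup_left)

abbreviation "CG \<equiv> fixed_cochains (carrier G)"
abbreviation "CH \<equiv> fixed_cochains H"
abbreviation "C0 \<equiv> fixed_cochains {}"

lemma dgs: "dg_subalgebra CG" "dg_subalgebra CH" "dg_subalgebra C0"
  by (rule dg_subalgebra_fixed_cochains; use subset in blast)+

lemma CH_cact_g0: 
  assumes "f \<in> CH n"
  shows "cact g0 f \<in> CH n"
  unfolding fixed_cochains_iff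
proof (intro conjI ballI)
  show "cact g0 f \<in> CC n" using assms g0(1) by (simp add: fixed_cochains_iff cact_CC)
  fix x assume x: "x \<in> H"
  define y where "y = inv\<^bsub>G\<^esub> g0 \<otimes>\<^bsub>G\<^esub> x \<otimes>\<^bsub>G\<^esub> g0"
  have y: "y \<in> H" unfolding y_def by (rule inv_op_closed1[OF g0(1) x])
  have "x \<otimes>\<^bsub>G\<^esub> g0 = g0 \<otimes>\<^bsub>G\<^esub> y"
    unfolding y_def using x g0(1) H_carrier by (simp add: m_assoc[symmetric])
  then have "cact x (cact g0 f) = cact g0 (cact y f)"
    using x y g0(1) H_carrier by (simp add: cact_comp[symmetric])
  then show "cact x (cact g0 f) = cact g0 f" using y assms by (simp add: fixed_cochains_iff)
qed

lemma CG_eq: "CG n = {f \<in> CH n. T f = 0}"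
proof (intro equalityI subsetI)
  fix f assume f: "f \<in> {f \<in> CH n. T f = 0}"
  have "cact g f - f \<in> {0}" if "g \<in> carrier G" for g
    by (rule invariance_mod[OF _ _ _ _ that])
      (use f in \<open>auto simp: fixed_cochains_iff T_def cact_0 fM.subspace_def\<close>)
  then show "f \<in> CG n" using f by (simp add: fixed_cochains_iff)
qed (use H_carrier g0(1) in \<open>auto simp: fixed_cochains_iff T_def\<close>)

lemma CG_g0: "f \<in> CG n \<Longrightarrow> cact g0 f = f"
  using g0(1) by (simp add: fixed_cochains_iff)

lemma p_prime: "Factorial_Ring.prime p"
  using char prime_CHAR_semidom[where ?'a = 'k] by simp

text \<open>
  \<open>T^q = 1 - g0^q\<close> by \<open>funpow_one_minus_CHAR\<close>, and \<open>g0^q\<close> lies in \<open>H\<close>.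
\<close>

lemma T_nilpotent: "f \<in> CH n \<Longrightarrow> (T ^^ q) f = 0"
proof -
  assume f: "f \<in> CH n"
  have "(T ^^ (p ^ r)) f = f - (cact g0 ^^ (p ^ r)) f"
    by (rule fM.funpow_one_minus_CHAR[OF char(1) p_prime]) (auto simp: T_def cact_add cact_sc g0(1))
  then show ?thesis using f g0_pow_q g0(1) by (simp add: q[symmetric] cact_pow fixed_cochains_iff)
qed

definition m_cochain :: "'a list \<Rightarrow> 'm" where "m_cochain xs = (if xs = [] then m else 0)"
definition h_cochain :: "'a list \<Rightarrow> 'm" where "h_cochain xs = (if length xs = 1 then h (hd xs) else 0)"

lemma act_m: "x \<in> H \<Longrightarrow> act M x m = m"
  and act_h: "x \<in> H \<Longrightarrow> act M x (h (act A (inv\<^bsub>G\<^esub> x) a)) = h a"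
  and lin_h: "lin h"
  and h_mult: "h (a * b) = lmul M a (h b) + rmul M (h a) b"
  and norm_m: "(Delta (-) (act M) \<rho> ^^ (q - 1)) m = 1"
  and Delta_h: "h a - act M g0 (h (act A (inv\<^bsub>G\<^esub> g0) a)) + (lmul M a m - rmul M m a) = 0"
proof -
  have m: "m \<in> fixed_by (act M) H UNIV" and hD: "h \<in> fixed_by (hom_act G A M) H (Der A M)"
    and n: "(Delta (-) (act M) \<rho> ^^ (q - 1)) m = 1"
    and d: "Delta (\<lambda>f f' a. f a - f' a) (hom_act G A M) \<rho> h a + inner_der M m a = 0"
    using deg unfolding degenerated_def by blast+
  show "x \<in> H \<Longrightarrow> act M x m = m" using m unfolding fixed_by_def by blast
  have "x \<in> H \<Longrightarrow> hom_act G A M x h = h" using hD unfolding fixed_by_def by blast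
  then show "x \<in> H \<Longrightarrow> act M x (h (act A (inv\<^bsub>G\<^esub> x) a)) = h a"
    unfolding hom_act_def by metis
  have "h \<in> Der A M" using hD unfolding fixed_by_def by blast
  then show "lin h" "h (a * b) = lmul M a (h b) + rmul M (h a) b"
    unfolding Der_def linear_iff_lin by blast+
  show "(Delta (-) (act M) \<rho> ^^ (q - 1)) m = 1" by (rule n)
  show "h a - act M g0 (h (act A (inv\<^bsub>G\<^esub> g0) a)) + (lmul M a m - rmul M m a) = 0"
    using d unfolding Delta_def coset_act_def hom_act_def inner_der_def g0_def by simp
qed

lemma m_cochain_CH: "m_cochain \<in> CH 0"
  unfolding fixed_cochains_iff
proof (intro conjI ballI)
  show "m_cochain \<in> CC 0" by (rule CC_I) (auto simp: m_cochain_def)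
  show "cact x m_cochain = m_cochain" if "x \<in> H" for x
    using that act_m[OF that] H_carrier by (auto simp: coch_act_def m_cochain_def fun_eq_iff act_M_0)
qed

lemma h_cochain_CH: "h_cochain \<in> CH 1"
  unfolding fixed_cochains_iff
proof (intro conjI ballI)
  show "h_cochain \<in> CC 1"
  proof (rule CC_I)
    fix xs :: "'a list" and i :: nat assume "length xs = 1" "i < 1"
    then show "lin (\<lambda>a. h_cochain (xs[i := a]))" using lin_h by (cases xs) (auto simp: h_cochain_def)
  qed (auto simp: h_cochain_def)
  fix x assume x: "x \<in> H"
  show "cact x h_cochain = h_cochain"
    using x H_carrier act_h[OF x] by (auto simp: coch_act_def h_cochain_def fun_eq_iff act_M_0 length_Suc_conv)
qed

lemma hdiff_h_cochain: "hdiff M 1 h_cochain = 0"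
proof
  fix xs :: "'a list"
  show "hdiff M 1 h_cochain xs = 0 xs"
  proof (cases "length xs = 2")
    case True
    then obtain a b where "xs = [a, b]" by (auto simp: numeral_2_eq_2 length_Suc_conv)
    then show ?thesis by (simp add: hdiff_eq face_def h_cochain_def h_mult)
  qed (simp add: hdiff_def)
qed

lemma T_h_cochain: "T h_cochain = - hdiff M 0 m_cochain"
proof
  fix xs :: "'a list"
  show "T h_cochain xs = (- hdiff M 0 m_cochain) xs"
  proof (cases "length xs = 1")
    case True
    then obtain a where "xs = [a]" by (auto simp: length_Suc_conv)
    then show ?thesis using Delta_h[of a]
      by (simp add: T_def coch_act_def h_cochain_def hdiff_eq face_def m_cochain_def algebra_simps)
  qed (simp add: hdiff_def T_def coch_act_def h_cochain_def g0(1) act_M_0)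
qed

lemma funpow_T_m_cochain: "(T ^^ k) m_cochain = (\<lambda>xs. if xs = [] then (Delta (-) (act M) \<rho> ^^ k) m else 0)"
  by (induction k)
    (auto simp: m_cochain_def fun_eq_iff T_def coch_act_def g0(1) act_M_0 Delta_def coset_act_def simp flip: g0_def)

lemma norm_m_cochain: "(T ^^ (q - 1)) m_cochain = unit_cochain"
  unfolding funpow_T_m_cochain norm_m unit_cochain_def by (rule refl)

text \<open>
  \<open>T\<close> is linear over fixed cochains, so the norm of \<open>x \<smile> m\<close> is \<open>x\<close> times the norm of \<open>m\<close>, which is \<open>1\<close>.
\<close>

lemma norm_cup_m_cochain:
  assumes "x \<in> CG k"
  shows "(T ^^ (q - 1)) (cup k 0 x m_cochain) = x"
proof -
  have "x \<in> CC k" using assms by (simp add: fixed_cochains_iff)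
  then show ?thesis
    unfolding funpow_T_cup_left[OF CG_g0[OF assms]] norm_m_cochain by (rule cup_unit)
qed

definition E :: "nat \<Rightarrow> ('a list \<Rightarrow> 'm) set" where
  "E n = (case n of 0 \<Rightarrow> {0} | Suc k \<Rightarrow> CH k)"

definition D :: "nat \<Rightarrow> ('a list \<Rightarrow> 'm) \<Rightarrow> 'a list \<Rightarrow> 'm" where
  "D n = (case n of 0 \<Rightarrow> (\<lambda>_. 0) | Suc k \<Rightarrow> hdiff M k)"

lemma E_simps [simp]: "E 0 = {0}" "E (Suc n) = CH n"
  and D_simps [simp]: "D 0 f = 0" "D (Suc n) f = hdiff M n f"
  by (auto simp: E_def D_def)

lemma subspace_CH: "fM.subspace (CH n)" by (rule dg_subalgebraD(1)[OF dgs(2)])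

lemma subspace_E: "fM.subspace (E n)"
  by (cases n) (simp_all add: subspace_CH fM.subspace_single_0)

lemma CH_zero: "0 \<in> CH n"
  by (rule fM.subspace_0[OF subspace_CH])

sublocale cx: norm_complex E D T q
proof
  show "0 < q" by (rule q_pos)
  show "0 \<in> E n" for n by (rule fM.subspace_0[OF subspace_E])
  show "x - y \<in> E n" if "x \<in> E n" "y \<in> E n" for x y n by (rule fM.subspace_diff[OF subspace_E that])
  show "D n x \<in> E (Suc n)" if "x \<in> E n" for x n
    using that by (cases n) (auto simp: CH_zero dg_subalgebraD(3)[OF dgs(2)])
  show "D n (x - y) = D n x - D n y" for n x y by (cases n) (auto simp: hdiff_diff)
  show "D (Suc n) (D n x) = 0" for n x by (cases n) (auto simp: hdiff_hdiff hdiff_0)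
  show "T x \<in> E n" if "x \<in> E n" for x n
    using that by (cases n) (auto simp: T_zero T_def CH_cact_g0 cact_0 g0(1) fM.subspace_diff[OF subspace_CH])
  show "T (x - y) = T x - T y" for x y by (rule T_diff)
  show "T (D n x) = D n (T x)" for n x by (cases n) (auto simp: T_zero T_hdiff)
  show "(T ^^ q) x = 0" if "x \<in> E n" for x n
    using that T_nilpotent T_nilpotent[OF CH_zero] by (cases n) auto
  fix n x assume x: "x \<in> E n" "T x = 0"
  show "\<exists>b \<in> E n. (T ^^ (q - 1)) b = x"
  proof (cases n)
    case 0
    then show ?thesis using x by (simp add: funpow_T_zero)
  next
    case (Suc k)
    then have xG: "x \<in> CG k" using x by (simp add: CG_eq)
    have "(T ^^ (q - 1)) (cup k 0 x m_cochain) = x"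
      by (rule norm_cup_m_cochain[OF xG])
    moreover have "cup k 0 x m_cochain \<in> CH k" using dg_subalgebraD(4)[OF dgs(2), of x k m_cochain 0] x Suc m_cochain_CH by simp
    ultimately show ?thesis using Suc by auto
  qed
  assume Dx: "D n x = 0"
  show "\<exists>b \<in> E n. \<exists>z \<in> E (Suc n). D (Suc n) z = 0 \<and> (T ^^ (q - 1)) b = x \<and> D n b = T z"
  proof (cases n)
    case 0
    then show ?thesis using x by (auto simp: funpow_T_zero CH_zero T_zero hdiff_0 intro!: bexI[of _ 0])
  next
    case (Suc k)
    then have xG: "x \<in> CG k" using x by (simp add: CG_eq)
    have dx: "hdiff M k x = 0" using Dx Suc by simp
    \<comment> \<open>The Leibniz rule gives \<open>d (x \<smile> m) = \<plusminus> x \<smile> dm\<close>, and \<open>dm = - T h\<close> by degeneracy; this fixes the sign of \<open>z\<close>.\<close>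
    define b z where "b = cup k 0 x m_cochain" and "z = - alt_sign k (cup k 1 x h_cochain)"
    have "(T ^^ (q - 1)) b = x"
      unfolding b_def by (rule norm_cup_m_cochain[OF xG])
    moreover have "b \<in> CH k" using dg_subalgebraD(4)[OF dgs(2), of x k m_cochain 0] x Suc m_cochain_CH by (simp add: b_def)
    moreover have "cup k 1 x h_cochain \<in> CH (Suc k)"
      using dg_subalgebraD(4)[OF dgs(2), of x k h_cochain 1] x Suc h_cochain_CH by simp
    then have "z \<in> CH (Suc k)"
      unfolding z_def by (intro fM.subspace_neg[OF subspace_CH] alt_sign_mem[OF subspace_CH])
    moreover have "hdiff M (k + 1) (cup k 1 x h_cochain) = 0"
      unfolding hdiff_cup dx hdiff_h_cochain by (simp add: cup_0_left cup_0_right)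
    then have "hdiff M (Suc k) z = 0"
      by (simp add: z_def hdiff_uminus hdiff_alt_sign)
    moreover have "hdiff M k b = T z"
    proof -
      have "T z = - alt_sign k (cup k 1 x (T h_cochain))"
        by (simp only: z_def T_uminus alt_sign_sc T_sc T_cup_left[OF CG_g0[OF xG]])
      also have "\<dots> = alt_sign k (cup k 1 x (hdiff M 0 m_cochain))"
        by (simp only: T_h_cochain cup_uminus_right alt_sign_simps minus_minus)
      also have "\<dots> = hdiff M k b"
        using hdiff_cup[of k 0 x m_cochain] by (simp add: dx b_def cup_0_left)
      finally show ?thesis by simp
    qed
    ultimately show ?thesis using Suc by auto
  qed
qed simp

section \<open>Averaging\<close>

definition avg :: "('a list \<Rightarrow> 'm) \<Rightarrow> 'a list \<Rightarrow> 'm" where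
  "avg f = sc (inverse (of_nat (card H))) (\<Sum>x \<in> H. cact x f)"

lemma card_H_nonzero: "(of_nat (card H) :: 'k) \<noteq> 0"
  using card_H char(1) by (simp add: of_nat_eq_0_iff_char_dvd)

text \<open>
  Averaging moves a cochain within its class as soon as the class is \<open>H\<close>-invariant, and it commutes with
  the differential. Hence the cohomology of the \<open>H\<close>-invariant cochains is the space of \<open>H\<close>-invariant classes.
\<close>

lemma avg_mod:
  assumes W: "fM.subspace W" "\<And>x. x \<in> H \<Longrightarrow> cact x f - f \<in> W"
  shows "avg f - f \<in> W"
proof -
  have "(\<Sum>x \<in> H. cact x f - f) = (\<Sum>x \<in> H. cact x f) - sc (of_nat (card H)) f"
    by (simp add: sum_subtractf fM.scale_left_distrib fM.sum_constant_scale)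
  then have "sc (inverse (of_nat (card H))) (\<Sum>x \<in> H. cact x f - f) = avg f - f"
    using card_H_nonzero by (simp add: avg_def fM.scale_right_diff_distrib)
  moreover have "(\<Sum>x \<in> H. cact x f - f) \<in> W" using W by (intro fM.subspace_sum) auto
  ultimately show ?thesis using fM.subspace_scale[OF W(1)] by metis
qed

lemma avg_invariant:
  assumes "f \<in> CC n"
  shows "avg f \<in> CH n"
  unfolding fixed_cochains_iff
proof (intro conjI ballI)
  show "avg f \<in> CC n"
    unfolding avg_def using assms H_carrier subspace_CC
    by (intro fM.subspace_scale fM.subspace_sum) (auto simp: cact_CC)
  fix y assume y: "y \<in> H"
  have "cact y (\<Sum>x \<in> H. cact x f) = (\<Sum>x \<in> H. cact (y \<otimes>\<^bsub>G\<^esub> x) f)"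
    using y H_carrier by (simp add: cact_sum cact_comp)
  also have "\<dots> = (\<Sum>x \<in> H. cact x f)"
    by (rule sum.reindex_bij_witness[of _ "\<lambda>x. inv\<^bsub>G\<^esub> y \<otimes>\<^bsub>G\<^esub> x" "\<lambda>x. y \<otimes>\<^bsub>G\<^esub> x"])
      (use y H_carrier in \<open>auto simp: m_assoc[symmetric] m_closed\<close>)
  finally show "cact y (avg f) = avg f" using y H_carrier by (simp add: avg_def cact_sc)
qed

lemma avg_fixed: "f \<in> CH n \<Longrightarrow> avg f = f"
  using avg_mod[of "{0}" f] by (auto simp: fixed_cochains_iff fM.subspace_def)

lemma hdiff_sum: "hdiff M n (sum F S) = (\<Sum>i \<in> S. hdiff M n (F i))"
  by (induction S rule: infinite_finite_induct)
    (simp_all only: sum.infinite sum.empty sum.insert hdiff_add hdiff_0 not_False_eq_True)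

lemma hdiff_avg: "hdiff M n (avg f) = avg (hdiff M n f)"
  using H_carrier by (simp add: avg_def hdiff_sc hdiff_sum cact_hdiff)

end

section \<open>Invariant cocycles and multiplication by them\<close>

context degenerated_module
begin

abbreviation "cl \<equiv> cls C0"
abbreviation "cl_up \<equiv> cls CG"

lemma Z_eq: "cx.Z (Suc n) = Zs CH n"
  by (auto simp: cx.Z_def Zs_iff)

lemma ZG_eq: "Zs CG n = {z \<in> cx.Z (Suc n). T z = 0}"
  by (auto simp: Z_eq Zs_iff CG_eq)

lemma BG_eq: "Bs CG n = cx.Xlevel 1 n"
  unfolding cx.Xlevel_1 by (cases n) (auto simp: Bs_0 Bs_Suc CG_eq T_zero)

lemma BH_eq: "Bs CH n = D n ` E n"
  by (cases n) (auto simp: Bs_0 Bs_Suc)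

lemma CG_CH: "CG n \<subseteq> CH n" and CH_C0: "CH n \<subseteq> C0 n"
  by (auto simp: CG_eq fixed_cochains_iff)

lemma Bs_mono: "(\<And>n. K n \<subseteq> K' n) \<Longrightarrow> Bs K n \<subseteq> Bs K' n"
  by (cases n) (auto simp: Bs_0 Bs_Suc)

lemma Zs_mono: "(\<And>n. K n \<subseteq> K' n) \<Longrightarrow> Zs K n \<subseteq> Zs K' n"
  unfolding subset_iff Zs_iff by blast

lemma CH_coboundary:
  assumes "z \<in> CH n" "z \<in> Bs C0 n"
  shows "z \<in> D n ` E n"
proof (cases n)
  case 0
  then show ?thesis using assms by (simp add: Bs_0)
next
  case (Suc k)
  then obtain c where c: "c \<in> CC k" "z = hdiff M k c" using assms by (auto simp: Bs_Suc fixed_cochains_iff)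
  have "z = hdiff M k (avg c)" using avg_fixed[OF assms(1)] c(2) by (simp add: hdiff_avg)
  then show ?thesis using avg_invariant[OF c(1)] Suc by auto
qed

lemma cl_eq_iff_CH:
  assumes "z \<in> Zs CH n" "z' \<in> Zs CH n"
  shows "cl n z = cl n z' \<longleftrightarrow> z - z' \<in> D n ` E n"
proof -
  have "z - z' \<in> CH n" using assms fM.subspace_diff[OF subspace_CH] by (auto simp: Zs_iff)
  then have "z - z' \<in> Bs C0 n \<longleftrightarrow> z - z' \<in> D n ` E n"
    using CH_coboundary Bs_mono[of CH C0 n, OF CH_C0] by (auto simp: BH_eq[symmetric])
  then show ?thesis using cls_eq_iff[OF dgs(3)] assms Zs_mono[of CH C0 n, OF CH_C0] by blast
qed

lemma subspace_of_diff:
  assumes "0 \<in> S" "\<And>x y. \<lbrakk>x \<in> S; y \<in> S\<rbrakk> \<Longrightarrow> x - y \<in> S" "\<And>c x. x \<in> S \<Longrightarrow> sc c x \<in> S"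
  shows "fM.subspace S"
proof -
  have "x + y \<in> S" if "x \<in> S" "y \<in> S" for x y
    using assms(2)[OF that(1) assms(2)[OF assms(1) that(2)]] by simp
  then show ?thesis using assms by (auto simp: fM.subspace_def)
qed

lemma chain_sc: "cx.chain_map n n (sc c) (sc c)"
proof -
  have "D n (sc c y) = sc c (D n y)" for n y by (cases n) (auto simp: hdiff_sc)
  then show ?thesis
    unfolding cx.chain_map_def cx.Z_def using fM.subspace_scale[OF subspace_E]
    by (auto simp: T_sc simp del: E_simps D_simps)
qed

text \<open>
  Multiplication by a fixed cocycle from the left commutes with the differential only up to the sign
  \<open>(-1)^i\<close>; the component in the lower degree is twisted by it.
\<close>

lemma chain_left:
  assumes a: "a \<in> Zs CG i"
  shows "cx.chain_map n (i + n) (case n of 0 \<Rightarrow> (\<lambda>_. 0) | Suc k \<Rightarrow> (\<lambda>y. alt_sign i (cup i k a y))) (cup i n a)"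
proof -
  have aG: "a \<in> CG i" "a \<in> CH i" "hdiff M i a = 0" using a CG_CH by (auto simp: Zs_iff)
  have aZ: "a \<in> Zs CH i" using aG by (simp add: Zs_iff)
  let ?L = "case n of 0 \<Rightarrow> (\<lambda>_. 0) | Suc k \<Rightarrow> (\<lambda>y. alt_sign i (cup i k a y))"
  have L: "?L y \<in> E (i + n) \<and> D (i + n) (?L y) = cup i n a (D n y) \<and> T (?L y) = ?L (T y)"
    if y: "y \<in> E n" for y
  proof (cases n)
    case 0
    then show ?thesis using fM.subspace_0[OF subspace_E] by (simp add: cx.D_0 cup_0_right T_zero)
  next
    case (Suc k)
    have "cup i k a y \<in> CH (i + k)" using dg_subalgebraD(4)[OF dgs(2) aG(2)] y Suc by simp
    moreover have "hdiff M (i + k) (alt_sign i (cup i k a y)) = cup i (Suc k) a (hdiff M k y)"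
      unfolding hdiff_alt_sign hdiff_cup aG(3) by (simp add: cup_0_left)
    moreover have "T (alt_sign i (cup i k a y)) = alt_sign i (cup i k a (T y))"
      unfolding alt_sign_sc T_sc T_cup_left[OF CG_g0[OF aG(1)]] ..
    ultimately show ?thesis using Suc alt_sign_mem[OF subspace_CH] by simp
  qed
  have "?L 0 = 0" by (cases n) (simp_all add: cup_0_right)
  then show ?thesis
    unfolding cx.chain_map_def Z_eq using L cup_Zs[OF dgs(2) aZ] T_cup_left[OF CG_g0[OF aG(1)]] cup_0_right
    by blast
qed

lemma chain_right:
  assumes a: "a \<in> Zs CG i"
  shows "cx.chain_map n (n + i) (case n of 0 \<Rightarrow> (\<lambda>_. 0) | Suc k \<Rightarrow> (\<lambda>y. cup k i y a)) (\<lambda>z. cup n i z a)"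
proof -
  have aG: "a \<in> CG i" "a \<in> CH i" "hdiff M i a = 0" using a CG_CH by (auto simp: Zs_iff)
  have aZ: "a \<in> Zs CH i" using aG by (simp add: Zs_iff)
  let ?L = "case n of 0 \<Rightarrow> (\<lambda>_. 0) | Suc k \<Rightarrow> (\<lambda>y. cup k i y a)"
  have L: "?L y \<in> E (n + i) \<and> D (n + i) (?L y) = cup n i (D n y) a \<and> T (?L y) = ?L (T y)"
    if y: "y \<in> E n" for y
  proof (cases n)
    case 0
    then show ?thesis using fM.subspace_0[OF subspace_E] by (simp add: cx.D_0 cup_0_left T_zero)
  next
    case (Suc k)
    have "cup k i y a \<in> CH (k + i)" using dg_subalgebraD(4)[OF dgs(2) _ aG(2)] y Suc by simp
    moreover have "hdiff M (k + i) (cup k i y a) = cup (Suc k) i (hdiff M k y) a"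
      unfolding hdiff_cup aG(3) by (simp add: cup_0_right)
    moreover have "T (cup k i y a) = cup k i (T y) a"
      by (rule T_cup_right[OF CG_g0[OF aG(1)]])
    ultimately show ?thesis using Suc by simp
  qed
  have "?L 0 = 0" by (cases n) (simp_all add: cup_0_left)
  then show ?thesis
    unfolding cx.chain_map_def Z_eq using L cup_Zs[OF dgs(2) _ aZ] T_cup_right[OF CG_g0[OF aG(1)]] cup_0_left
    by blast
qed

lemma stable_Xlevel: "reps.stable (Zs CG) (cx.Xlevel l)"
  unfolding reps.stable_def
proof (intro conjI allI ballI)
  show "fM.subspace (cx.Xlevel l n)" for n
  proof (rule subspace_of_diff)
    show "0 \<in> cx.Xlevel l n" using cx.Xlevel_I[of 0 n l] by (simp add: cx.zero_in cx.Tp_0 cx.D_0 cx.T_0)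
  qed (use cx.Xlevel_diff cx.Xlevel_chain_map[OF chain_sc] in auto)
qed (use cx.Xlevel_chain_map[OF chain_left] cx.Xlevel_chain_map[OF chain_right] in auto)

lemma stable_Ylevel: "reps.stable (Zs CG) (cx.Ylevel i)"
  unfolding reps.stable_def
proof (intro conjI allI ballI)
  show "fM.subspace (cx.Ylevel i n)" for n
  proof (rule subspace_of_diff)
    show "0 \<in> cx.Ylevel i n" using cx.zigzag_0 unfolding cx.Ylevel_def by blast
  qed (use cx.Ylevel_diff cx.Ylevel_chain_map[OF chain_sc] in auto)
qed (use cx.Ylevel_chain_map[OF chain_left] cx.Ylevel_chain_map[OF chain_right] in auto)

lemma stable_invariant_class: "reps.stable (Zs CG) cx.invariant_class"
  using stable_Ylevel[of 0] cx.Ylevel_first by (simp add: reps.stable_def)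

lemma stable_invariant_rep: "reps.stable (Zs CG) cx.invariant_rep"
  using stable_Ylevel[of "q - 1"] cx.Ylevel_last by (simp add: reps.stable_def)

text \<open>
  This is the statement that the kernel \<open>X\<close> of the comparison map has square zero. If \<open>x = dy\<close> and \<open>x' = dy'\<close>,
  then \<open>x x'\<close> is up to sign the coboundary of \<open>w = x y'\<close>, but \<open>w\<close> need not be fixed. However
  \<open>T w = x (T y') = d (y (T y'))\<close> has norm \<open>T^q w = 0\<close>, so it is \<open>T \<zeta>\<close> for a cocycle \<open>\<zeta>\<close>. The cochain
  \<open>w - \<zeta>\<close> is fixed and has the same coboundary as \<open>w\<close>.
\<close>

lemma Xlevel_mult:
  assumes x: "x \<in> cx.Xlevel q i" and x': "x' \<in> cx.Xlevel q j"
  shows "cup i j x x' \<in> Bs CG (i + j)"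
proof (cases "i = 0 \<or> j = 0")
  case True
  then have "x = 0 \<or> x' = 0" using x x' by (auto simp: cx.Xlevel_q)
  then show ?thesis
    using fM.subspace_0[OF subspace_Bs[OF dgs(1)]] by (auto simp: cup_0_left cup_0_right)
next
  case False
  then obtain k k' where k: "i = Suc k" "j = Suc k'" by (metis not0_implies_Suc)
  obtain y y' where y: "y \<in> CH k" "x = hdiff M k y" "T x = 0" and y': "y' \<in> CH k'" "x' = hdiff M k' y'" "T x' = 0"
    using x x' k by (auto simp: cx.Xlevel_q)
  have xG: "x \<in> CG (Suc k)" using y dg_subalgebraD(3)[OF dgs(2)] by (simp add: CG_eq)
  have xH: "x \<in> CH (Suc k)" using xG CG_CH by blast
  define g where "g = cup k k' y (T y')"
  define w where "w = cup (Suc k) k' x y'"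
  have Ty': "T y' \<in> CH k'" using cx.T_in[of y' "Suc k'"] y' by simp
  have g: "g \<in> CH (k + k')" unfolding g_def by (rule dg_subalgebraD(4)[OF dgs(2) y(1) Ty'])
  have w: "w \<in> CH (Suc (k + k'))" using dg_subalgebraD(4)[OF dgs(2) xH y'(1)] by (simp add: w_def)
  have "hdiff M k' (T y') = 0" using y' by (simp add: T_hdiff[symmetric])
  then have dg: "hdiff M (k + k') g = T w"
    by (simp add: g_def w_def hdiff_cup y(2)[symmetric] cup_0_right T_cup_left CG_g0[OF xG])
  have "(T ^^ (q - 1)) (T w) = (T ^^ q) w"
    using q_pos by (simp add: cx.Tp_T del: funpow.simps)
  also have "\<dots> = 0" by (rule T_nilpotent[OF w])
  finally obtain \<zeta> where \<zeta>: "\<zeta> \<in> cx.Z (Suc (Suc (k + k')))" "T w = T \<zeta>"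
    using cx.coboundary_in_T_image[of g "Suc (k + k')"] g dg by auto
  define c where "c = w - \<zeta>"
  have c: "c \<in> CG (Suc (k + k'))"
    using w \<zeta> fM.subspace_diff[OF subspace_CH, of w] by (simp add: c_def CG_eq T_diff Z_eq Zs_iff)
  have dx: "hdiff M (Suc k) x = 0" unfolding y(2) by (rule hdiff_hdiff)
  have "hdiff M (Suc k + k') w = alt_sign (Suc k) (cup (Suc k) (Suc k') x x')"
    unfolding w_def hdiff_cup dx by (simp add: cup_0_left y'(2))
  then have "hdiff M (Suc (k + k')) c = alt_sign (Suc k) (cup (Suc k) (Suc k') x x')"
    using \<zeta> by (simp add: c_def hdiff_diff Z_eq Zs_iff)
  then have "cup i j x x' = hdiff M (Suc (k + k')) (alt_sign (Suc k) c)"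
    unfolding k hdiff_alt_sign by (simp only: alt_sign_simps(7))
  moreover have "alt_sign (Suc k) c \<in> CG (Suc (k + k'))" by (rule alt_sign_mem[OF dg_subalgebraD(1)[OF dgs(1)] c])
  ultimately show ?thesis unfolding k add_Suc add_Suc_right Bs_Suc by blast
qed

section \<open>The comparison map, its kernel and its cokernel\<close>

lemma HH_eq: "HH A M = cohomology (subcomplex C0) (hdiff M) cup unit_cochain"
  by (simp add: HH_def subcomplex_empty)

lemma HH_up_eq: "HH_up G A M = cohomology (subcomplex CG) (hdiff M) cup unit_cochain"
  by (simp add: HH_up_def subcomplex_carrier)

lemmas rep_HH = alg_rep_cohomology[OF dgs(3), folded HH_eq]
lemmas rep_HH_up = alg_rep_cohomology[OF dgs(1), folded HH_up_eq]
lemmas lin_HH = reps.alg_repD(1)[OF rep_HH]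
lemmas lin_HH_up = reps.alg_repD(1)[OF rep_HH_up]

lemma ZG_C0: "Zs CG n \<subseteq> Zs C0 n"
  by (rule Zs_mono) (use CG_CH CH_C0 in blast)

lemma Theta_cl_up: "Theta A M n (cl_up n z) = cl n z"
proof -
  have sub: "Bs CG n \<subseteq> Bs C0 n" by (rule Bs_mono) (use CG_CH CH_C0 in blast)
  have B: "fM.subspace (Bs C0 n)" by (rule subspace_Bs[OF dgs(3)])
  have "Theta A M n (cl_up n z) = (\<Union>b \<in> Bs C0 n. \<Union>b' \<in> Bs CG n. {b + (b' + z)})"
    by (auto simp: Theta_def set_add_def' cls_def subcomplex_empty[symmetric])
  also have "\<dots> = (\<lambda>b. b + z) ` Bs C0 n"
  proof (intro equalityI subsetI)
    fix u assume "u \<in> (\<Union>b \<in> Bs C0 n. \<Union>b' \<in> Bs CG n. {b + (b' + z)})"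
    then obtain b b' where "b \<in> Bs C0 n" "b' \<in> Bs CG n" "u = (b + b') + z" by (auto simp: add.assoc)
    then show "u \<in> (\<lambda>b. b + z) ` Bs C0 n" using sub fM.subspace_add[OF B] by blast
  next
    fix u assume "u \<in> (\<lambda>b. b + z) ` Bs C0 n"
    then obtain b where "b \<in> Bs C0 n" "u = b + (0 + z)" by auto
    then show "u \<in> (\<Union>b \<in> Bs C0 n. \<Union>b' \<in> Bs CG n. {b + (b' + z)})"
      using fM.subspace_0[OF subspace_Bs[OF dgs(1)]] by blast
  qed
  finally show ?thesis by (simp add: cls_def)
qed

lemma gcar_HH_up: "gcar (HH_up G A M) n = cl_up n ` Zs CG n"
  by (rule fM.lin_ontoD(2)[OF lin_HH_up])

lemma gcar_HH: "gcar (HH A M) n = cl n ` Zs C0 n"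
  by (rule fM.lin_ontoD(2)[OF lin_HH])

lemma gcar_AG: "gcar (AG G A M) n = cl n ` Zs CG n"
  by (simp add: AG_def gr_restrict_def gcar_HH_up image_image Theta_cl_up)

lemma gcomp_AG: "gcomp (AG G A M) n = (gcomp (HH A M) n)\<lparr>carrier := cl n ` Zs CG n\<rparr>"
  by (simp add: AG_def gr_restrict_def gcar_HH_up image_image Theta_cl_up)

lemma rep_AG: "reps.alg_rep (Zs CG) cl (AG G A M)"
  unfolding reps.alg_rep_def
proof (intro conjI allI ballI)
  show "lin_onto sc (Zs CG n) (cl n) (gcomp (AG G A M) n)" for n
    unfolding gcomp_AG by (rule fM.lin_onto_restrict[OF lin_HH subspace_Zs[OF dgs(1)] ZG_C0])
  show "cup i j a b \<in> Zs CG (i + j)" if "a \<in> Zs CG i" "b \<in> Zs CG j" for i j a b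
    by (rule cup_Zs[OF dgs(1) that])
  show "gmult (AG G A M) i j (cl i a) (cl j b) = cl (i + j) (cup i j a b)" if "a \<in> Zs CG i" "b \<in> Zs CG j" for i j a b
    using reps.alg_repD(3)[OF rep_HH, of a i b j] that ZG_C0[of i] ZG_C0[of j]
    by (simp add: AG_def gr_restrict_def subset_iff)
  show "unit_cochain \<in> Zs CG 0" by (rule reps.alg_repD(4)[OF rep_HH_up])
  show "gone (AG G A M) = cl 0 unit_cochain"
    using reps.alg_repD(5)[OF rep_HH] by (simp add: AG_def gr_restrict_def)
  show "cup 0 n unit_cochain a = a" "cup n 0 a unit_cochain = a" if "a \<in> Zs CG n" for n a
    using reps.alg_repD(6,7)[OF rep_HH_up that] .
qed

lemma Xlevel_ZG: "cx.Xlevel l n \<subseteq> Zs CG n"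
  using cx.Xlevel_in by (auto simp: ZG_eq)

text \<open>
  The lift chosen by \<open>AG_lift\<close> differs from the given representative by an element of the kernel \<open>X\<close>; since \<open>X\<close>
  has square zero, it acts on \<open>X\<close> in the same way.
\<close>

lemma AG_lift_cl:
  assumes a: "a \<in> Zs CG i"
  shows "\<exists>a' \<in> Zs CG i. AG_lift G A M i (cl i a) = cl_up i a' \<and> a' - a \<in> cx.Xlevel q i"
proof -
  let ?P = "\<lambda>b'. b' \<in> gcar (HH_up G A M) i \<and> Theta A M i b' = cl i a"
  have "?P (cl_up i a)" using a by (simp add: gcar_HH_up Theta_cl_up)
  then have "?P (AG_lift G A M i (cl i a))" unfolding AG_lift_def by (rule someI)
  then obtain a' where a': "a' \<in> Zs CG i" "AG_lift G A M i (cl i a) = cl_up i a'" "cl i a' = cl i a"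
    by (auto simp: gcar_HH_up Theta_cl_up)
  have H: "a \<in> Zs CH i" "a' \<in> Zs CH i" using a a'(1) by (auto simp: ZG_eq Z_eq)
  then have "a' - a \<in> D i ` E i" using a'(3) cl_eq_iff_CH by blast
  moreover have "T (a' - a) = 0" using a a' by (simp add: ZG_eq T_diff)
  ultimately show ?thesis using a' by (auto simp: cx.Xlevel_q)
qed

lemma gcomp_XG: "gcomp (XG G A M) n = (gcomp (HH_up G A M) n)\<lparr>carrier := cl_up n ` cx.Xlevel q n\<rparr>"
proof -
  have "Theta A M n (cl_up n z) = \<zero>\<^bsub>gcomp (HH A M) n\<^esub> \<longleftrightarrow> z \<in> cx.Xlevel q n" if z: "z \<in> Zs CG n" for z
  proof -
    have H: "z \<in> Zs CH n" "0 \<in> Zs CH n"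
      using z fM.subspace_0[OF subspace_Zs[OF dgs(2)]] by (auto simp: ZG_eq Z_eq)
    have "Theta A M n (cl_up n z) = \<zero>\<^bsub>gcomp (HH A M) n\<^esub> \<longleftrightarrow> cl n z = cl n 0"
      by (simp add: Theta_cl_up fM.lin_ontoD(3)[OF lin_HH])
    also have "\<dots> \<longleftrightarrow> z \<in> D n ` E n" using cl_eq_iff_CH[OF H] by simp
    finally show ?thesis using z by (auto simp: cx.Xlevel_q ZG_eq)
  qed
  then have "{x \<in> gcar (HH_up G A M) n. Theta A M n x = \<zero>\<^bsub>gcomp (HH A M) n\<^esub>} = cl_up n ` cx.Xlevel q n"
    using Xlevel_ZG[of q n] unfolding gcar_HH_up by blast
  then show ?thesis by (simp add: XG_def gr_restrict_def)
qed

lemma cl_up_cong_Xlevel: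
  assumes "a \<in> Zs CG i" "a' \<in> Zs CG i" "a' - a \<in> cx.Xlevel q i" "x \<in> cx.Xlevel q j"
  shows "cl_up (i + j) (cup i j a' x) = cl_up (i + j) (cup i j a x)"
    "cl_up (j + i) (cup j i x a') = cl_up (j + i) (cup j i x a)"
proof -
  have x: "x \<in> Zs CG j" using assms(4) Xlevel_ZG by blast
  show "cl_up (i + j) (cup i j a' x) = cl_up (i + j) (cup i j a x)"
    using assms x Xlevel_mult[OF assms(3,4)] by (simp add: cls_eq_iff[OF dgs(1)] cup_Zs[OF dgs(1)] cup_diff_left)
  show "cl_up (j + i) (cup j i x a') = cl_up (j + i) (cup j i x a)"
    using assms x Xlevel_mult[OF assms(4,3)] by (simp add: cls_eq_iff[OF dgs(1)] cup_Zs[OF dgs(1)] cup_diff_right)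
qed

lemma rep_XG: "reps.bimod_rep (Zs CG) cl (cx.Xlevel q) cl_up (XG G A M)"
  unfolding reps.bimod_rep_def
proof (intro conjI allI ballI)
  have S: "fM.subspace (cx.Xlevel q n)" for n using stable_Xlevel by (simp add: reps.stable_def)
  show "lin_onto sc (cx.Xlevel q n) (cl_up n) (gcomp (XG G A M) n)" for n
    unfolding gcomp_XG by (rule fM.lin_onto_restrict[OF lin_HH_up S Xlevel_ZG])
  show "cup 0 n unit_cochain v = v" "cup n 0 v unit_cochain = v" if "v \<in> cx.Xlevel q n" for n v
    using that Xlevel_ZG reps.alg_repD(6,7)[OF rep_HH_up] by blast+
  fix i j a v assume a: "a \<in> Zs CG i" and v: "v \<in> cx.Xlevel q j"
  show "cup i j a v \<in> cx.Xlevel q (i + j)" "cup j i v a \<in> cx.Xlevel q (j + i)"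
    using stable_Xlevel a v by (auto simp: reps.stable_def)
  obtain a' where a': "a' \<in> Zs CG i" "AG_lift G A M i (cl i a) = cl_up i a'" "a' - a \<in> cx.Xlevel q i"
    using AG_lift_cl[OF a] by blast
  have vZ: "v \<in> Zs CG j" using v Xlevel_ZG by blast
  show "glact (XG G A M) i j (cl i a) (cl_up j v) = cl_up (i + j) (cup i j a v)"
    using reps.alg_repD(3)[OF rep_HH_up a'(1) vZ] cl_up_cong_Xlevel(1)[OF a a'(1,3) v] by (simp add: XG_def a'(2))
  show "gract (XG G A M) j i (cl_up j v) (cl i a) = cl_up (j + i) (cup j i v a)"
    using reps.alg_repD(3)[OF rep_HH_up vZ a'(1)] cl_up_cong_Xlevel(2)[OF a a'(1,3) v] by (simp add: XG_def a'(2))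
qed

lemma cact_Bs_C0:
  assumes g: "g \<in> carrier G" and b: "b \<in> Bs C0 n"
  shows "cact g b \<in> Bs C0 n"
proof (cases n)
  case 0
  then show ?thesis using b g by (simp add: Bs_0 cact_0)
next
  case (Suc k)
  then obtain c where "c \<in> CC k" "b = hdiff M k c" using b by (auto simp: Bs_Suc fixed_cochains_iff)
  then show ?thesis using g Suc by (auto simp: Bs_Suc fixed_cochains_iff cact_hdiff cact_CC)
qed

lemma HH_act_cl:
  assumes g: "g \<in> carrier G"
  shows "HH_act G A M g (cl n z) = cl n (cact g z)"
proof -
  have "cact g ` Bs C0 n = Bs C0 n"
  proof (intro equalityI subsetI)
    fix b assume b: "b \<in> Bs C0 n"
    have "b = cact g (cact (inv\<^bsub>G\<^esub> g) b)" using g by (simp add: cact_comp[symmetric] cact_one)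
    then show "b \<in> cact g ` Bs C0 n" using cact_Bs_C0[OF inv_closed[OF g] b] by blast
  qed (use cact_Bs_C0[OF g] in blast)
  moreover have "(\<lambda>b. cact g b + cact g z) ` Bs C0 n = (\<lambda>b. b + cact g z) ` (cact g ` Bs C0 n)"
    by (simp only: image_image)
  ultimately have "(\<lambda>b. cact g b + cact g z) ` Bs C0 n = (\<lambda>b. b + cact g z) ` Bs C0 n"
    by (simp only:)
  then show ?thesis by (simp add: HH_act_def cls_def image_image cact_add[OF g])
qed

lemma cact_Zs_C0: "\<lbrakk>g \<in> carrier G; z \<in> Zs C0 n\<rbrakk> \<Longrightarrow> cact g z \<in> Zs C0 n"
  by (auto simp: Zs_iff fixed_cochains_iff cact_CC cact_hdiff[symmetric] cact_0)

lemma HH_act_cl_eq: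
  assumes "g \<in> carrier G" "z \<in> Zs C0 n"
  shows "HH_act G A M g (cl n z) = cl n z \<longleftrightarrow> cact g z - z \<in> Bs C0 n"
  using assms by (simp add: HH_act_cl cls_eq_iff[OF dgs(3)] cact_Zs_C0)

lemma ZH_C0: "Zs CH n \<subseteq> Zs C0 n"
  by (rule Zs_mono[OF CH_C0])

lemma HH_inv_H: "HH_inv G H A M n = cl n ` Zs CH n"
proof (intro equalityI subsetI)
  fix v assume "v \<in> HH_inv G H A M n"
  then obtain z where z: "z \<in> Zs C0 n" "v = cl n z" "\<And>x. x \<in> H \<Longrightarrow> cact x z - z \<in> Bs C0 n"
    using H_carrier HH_act_cl_eq by (auto simp: HH_inv_def fixed_by_def gcar_HH)
  have "avg z - z \<in> Bs C0 n" by (rule avg_mod[OF subspace_Bs[OF dgs(3)] z(3)])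
  moreover have "hdiff M n (avg z) = 0"
    using z(1) avg_fixed[OF CH_zero] by (simp add: hdiff_avg Zs_iff)
  then have "avg z \<in> Zs CH n" using z(1) avg_invariant by (auto simp: Zs_iff fixed_cochains_iff)
  ultimately show "v \<in> cl n ` Zs CH n"
    using z cls_eq_iff[OF dgs(3), of "avg z" n z] ZH_C0 by blast
next
  fix v assume "v \<in> cl n ` Zs CH n"
  then obtain z where z: "z \<in> Zs CH n" "v = cl n z" by blast
  then have zK: "z \<in> Zs C0 n" using ZH_C0 by blast
  have "HH_act G A M x v = v" if "x \<in> H" for x
    using that z H_carrier HH_act_cl[of x n z] by (simp add: Zs_iff fixed_cochains_iff)
  then show "v \<in> HH_inv G H A M n" using z zK by (auto simp: HH_inv_def fixed_by_def gcar_HH)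
qed

lemma invariant_class_ZH: "cx.invariant_class n \<subseteq> Zs CH n"
  by (auto simp: cx.invariant_class_def Z_eq)

lemma HH_inv_G: "HH_inv G (carrier G) A M n = cl n ` cx.invariant_class n"
proof (intro equalityI subsetI)
  fix v assume v: "v \<in> HH_inv G (carrier G) A M n"
  then have "v \<in> HH_inv G H A M n" using subset by (auto simp: HH_inv_def fixed_by_def)
  then obtain z where z: "z \<in> Zs CH n" "v = cl n z" by (auto simp: HH_inv_H)
  have "cact g0 z - z \<in> Bs C0 n"
    using v z(2) g0(1) HH_act_cl_eq[OF g0(1) subsetD[OF ZH_C0 z(1)]] by (simp add: HH_inv_def fixed_by_def)
  then have "- (cact g0 z - z) \<in> Bs C0 n" by (rule fM.subspace_neg[OF subspace_Bs[OF dgs(3)]])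
  then have "T z \<in> Bs C0 n" by (simp add: T_def)
  moreover have "T z \<in> CH n" using cx.T_in[of z "Suc n"] z by (simp add: Zs_iff)
  ultimately have "z \<in> cx.invariant_class n" using CH_coboundary z(1) by (auto simp: cx.invariant_class_def Z_eq)
  then show "v \<in> cl n ` cx.invariant_class n" using z by blast
next
  fix v assume "v \<in> cl n ` cx.invariant_class n"
  then obtain z where z: "z \<in> cx.invariant_class n" "v = cl n z" by blast
  then have zH: "z \<in> Zs CH n" and "T z \<in> Bs CH n" by (auto simp: cx.invariant_class_def Z_eq BH_eq)
  then have "T z \<in> Bs C0 n" using Bs_mono[of CH C0 n, OF CH_C0] by blast
  then have "- T z \<in> Bs C0 n" by (rule fM.subspace_neg[OF subspace_Bs[OF dgs(3)]])
  then have T: "cact g0 z - z \<in> Bs C0 n" by (simp add: T_def)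
  have H_inv: "cact x z - z \<in> Bs C0 n" if "x \<in> H" for x
    using zH that fM.subspace_0[OF subspace_Bs[OF dgs(3)]] by (simp add: Zs_iff fixed_cochains_iff)
  have "cact g z - z \<in> Bs C0 n" if "g \<in> carrier G" for g
    by (rule invariance_mod[OF subspace_Bs[OF dgs(3)] cact_Bs_C0 H_inv T that])
  then show "v \<in> HH_inv G (carrier G) A M n"
    unfolding HH_inv_def fixed_by_def gcar_HH z(2)
    using subsetD[OF ZH_C0 zH] HH_act_cl_eq[OF _ subsetD[OF ZH_C0 zH]] by blast
qed

definition YB where
  "YB = \<lparr>gcomp = gcomp (gr_restrict (HH A M) (HH_inv G (carrier G) A M)),
      glact = gmult (HH A M), gract = gmult (HH A M)\<rparr>"

lemma rep_YB: "reps.bimod_rep (Zs CG) cl cx.invariant_class cl YB"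
  unfolding reps.bimod_rep_def
proof (intro conjI allI ballI)
  have S: "fM.subspace (cx.invariant_class n)" for n using stable_invariant_class by (simp add: reps.stable_def)
  have sub: "cx.invariant_class n \<subseteq> Zs C0 n" for n using invariant_class_ZH ZH_C0 by blast
  have "gcomp YB n = (gcomp (HH A M) n)\<lparr>carrier := cl n ` cx.invariant_class n\<rparr>" for n
    by (simp add: YB_def gr_restrict_def HH_inv_G)
  then show "lin_onto sc (cx.invariant_class n) (cl n) (gcomp YB n)" for n
    using fM.lin_onto_restrict[OF lin_HH S sub] by simp
  show "cup 0 n unit_cochain v = v" "cup n 0 v unit_cochain = v" if "v \<in> cx.invariant_class n" for n v
    using that sub reps.alg_repD(6,7)[OF rep_HH] by blast+
  fix i j a v assume a: "a \<in> Zs CG i" and v: "v \<in> cx.invariant_class j"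
  show "cup i j a v \<in> cx.invariant_class (i + j)" "cup j i v a \<in> cx.invariant_class (j + i)"
    using stable_invariant_class a v by (auto simp: reps.stable_def)
  show "glact YB i j (cl i a) (cl j v) = cl (i + j) (cup i j a v)"
    "gract YB j i (cl j v) (cl i a) = cl (j + i) (cup j i v a)"
    using reps.alg_repD(3)[OF rep_HH] subsetD[OF ZG_C0 a] subsetD[OF sub v] by (simp_all add: YB_def)
qed

definition y_cl where "y_cl n = coset_proj (gcomp YB n) (cl n) (cx.invariant_rep n)"

lemma invariant_rep_invariant_class: "cx.invariant_rep n \<subseteq> cx.invariant_class n"
  using cx.invariant_rep_subset cx.Ylevel_sub by blast

lemma gcar_AG_invariant_rep: "gcar (AG G A M) n = cl n ` cx.invariant_rep n"
proof (intro equalityI subsetI)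
  fix v assume "v \<in> gcar (AG G A M) n"
  then obtain z where z: "z \<in> Zs CG n" "v = cl n z" by (auto simp: gcar_AG)
  have "z \<in> cx.invariant_rep n" unfolding cx.invariant_rep_def
    by (intro CollectI exI[of _ z] exI[of _ 0]) (use z(1) cx.zero_in in \<open>simp add: ZG_eq cx.D_0\<close>)
  then show "v \<in> cl n ` cx.invariant_rep n" using z by blast
next
  fix v assume "v \<in> cl n ` cx.invariant_rep n"
  then obtain z c where z: "z \<in> cx.Z (Suc n)" "T z = 0" "c \<in> E n" "v = cl n (z + D n c)"
    by (auto simp: cx.invariant_rep_def)
  then have zz: "z \<in> Zs CG n" "z \<in> Zs CH n" "z + D n c \<in> Zs CH n"
    using cx.Z_add[OF z(1) cx.D_in_Z[OF z(3)]] by (auto simp: ZG_eq Z_eq)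
  have "cl n (z + D n c) = cl n z" using cl_eq_iff_CH[OF zz(3,2)] z(3) by simp
  then show "v \<in> gcar (AG G A M) n" using z(4) zz(1) by (simp add: gcar_AG)
qed

lemma YG_eq: "YG G A M = gr_quot YB (\<lambda>n. cl n ` cx.invariant_rep n)"
  by (simp add: YG_def YB_def gcar_AG_invariant_rep)

lemma rep_YG: "reps.bimod_rep (Zs CG) cl cx.invariant_class y_cl (YG G A M)"
  unfolding YG_eq y_cl_def[abs_def] by (rule reps.bimod_rep_quot[OF rep_YB stable_invariant_rep invariant_rep_invariant_class])

lemma y_cl_eq_0_iff:
  assumes z: "z \<in> cx.invariant_class n"
  shows "y_cl n z = y_cl n 0 \<longleftrightarrow> z \<in> cx.invariant_rep n"
proof -
  have S: "fM.subspace (cx.invariant_rep n)" using stable_invariant_rep by (simp add: reps.stable_def)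
  have "y_cl n z = y_cl n 0 \<longleftrightarrow> cl n z \<in> cl n ` cx.invariant_rep n"
    unfolding y_cl_def
    by (rule fM.coset_proj_eq_0_iff[OF reps.bimod_repD(1)[OF rep_YB] S invariant_rep_invariant_class z])
  also have "\<dots> \<longleftrightarrow> z \<in> cx.invariant_rep n"
  proof
    assume "cl n z \<in> cl n ` cx.invariant_rep n"
    then obtain w where w: "w \<in> cx.invariant_rep n" "cl n z = cl n w" by blast
    have "z - w \<in> D n ` E n"
      using w z invariant_rep_invariant_class invariant_class_ZH cl_eq_iff_CH by blast
    then obtain c where "c \<in> E n" "z - w = D n c" by blast
    then have "z - w \<in> cx.invariant_rep n"
      unfolding cx.invariant_rep_def
      by (intro CollectI exI[of _ 0] exI[of _ c])
        (simp add: Z_eq T_zero fM.subspace_0[OF subspace_Zs[OF dgs(2)]])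
    then have "(z - w) + w \<in> cx.invariant_rep n" using w(1) by (rule fM.subspace_add[OF S])
    then show "z \<in> cx.invariant_rep n" by simp
  qed blast
  finally show ?thesis .
qed

lemma y_cl_mem_iff:
  assumes z: "z \<in> cx.invariant_class n"
  shows "y_cl n z \<in> y_cl n ` cx.Ylevel i n \<longleftrightarrow> z \<in> cx.Ylevel i n"
proof
  assume "y_cl n z \<in> y_cl n ` cx.Ylevel i n"
  then obtain w where w: "w \<in> cx.Ylevel i n" "y_cl n z = y_cl n w" by blast
  have S: "fM.subspace (cx.Ylevel i n)" "fM.subspace (cx.invariant_class n)"
    using stable_Ylevel stable_invariant_class by (auto simp: reps.stable_def)
  have wY: "w \<in> cx.invariant_class n" using w cx.Ylevel_sub by blast
  then have "y_cl n (z - w) = y_cl n 0"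
    using w(2) fM.lin_onto_eq_iff[OF reps.bimod_repD(1)[OF rep_YG] z] by blast
  then have "z - w \<in> cx.invariant_rep n" using y_cl_eq_0_iff fM.subspace_diff[OF S(2) z wY] by blast
  then have "(z - w) + w \<in> cx.Ylevel i n" using w(1) cx.invariant_rep_subset by (blast intro: fM.subspace_add[OF S(1)])
  then show "z \<in> cx.Ylevel i n" by simp
qed blast

lemma cl_up_eq_0_iff: "x \<in> cx.Xlevel q n \<Longrightarrow> cl_up n x = cl_up n 0 \<longleftrightarrow> x \<in> cx.Xlevel 1 n"
  unfolding BG_eq[symmetric] by (rule cls_eq_0_iff[OF dgs(1) subsetD[OF Xlevel_ZG]])

lemma cl_up_mem_iff:
  assumes x: "x \<in> cx.Xlevel q n" and l: "1 \<le> l"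
  shows "cl_up n x \<in> cl_up n ` cx.Xlevel l n \<longleftrightarrow> x \<in> cx.Xlevel l n"
proof
  assume "cl_up n x \<in> cl_up n ` cx.Xlevel l n"
  then obtain w where w: "w \<in> cx.Xlevel l n" "cl_up n x = cl_up n w" by blast
  then have "x - w \<in> cx.Xlevel 1 n"
    using cls_eq_iff[OF dgs(1) subsetD[OF Xlevel_ZG x] subsetD[OF Xlevel_ZG w(1)]] by (simp only: BG_eq)
  then have "x - w \<in> cx.Xlevel l n" using cx.Xlevel_mono[OF l] by blast
  moreover have "fM.subspace (cx.Xlevel l n)" using stable_Xlevel by (simp add: reps.stable_def)
  ultimately have "(x - w) + w \<in> cx.Xlevel l n" using w(1) by (intro fM.subspace_add)
  then show "x \<in> cx.Xlevel l n" by simp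
qed blast

section \<open>The two filtrations\<close>

text \<open>
  The case distinctions in \<open>Xf\<close> and \<open>Yf\<close> implement the conventions \<open>X_(-1) = X\<close> and \<open>Y_q = 0\<close>.
\<close>

definition Xf :: "int \<Rightarrow> nat \<Rightarrow> ('a list \<Rightarrow> 'm) set set" where
  "Xf j n = (if j < 0 then gcar (XG G A M) n else cl_up n ` cx.Xlevel (q - nat j) n)"

definition Yf :: "int \<Rightarrow> nat \<Rightarrow> ('a list \<Rightarrow> 'm) set set set" where
  "Yf j n = (if int q \<le> j then gzero (YG G A M) n else y_cl n ` cx.Ylevel (nat j) n)"

lemma gcar_XG: "gcar (XG G A M) n = cl_up n ` cx.Xlevel q n"
  by (rule fM.lin_ontoD(2)[OF reps.bimod_repD(1)[OF rep_XG]])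

lemma gcar_YG: "gcar (YG G A M) n = y_cl n ` cx.invariant_class n"
  by (rule fM.lin_ontoD(2)[OF reps.bimod_repD(1)[OF rep_YG]])

lemma gzero_XG: "gzero (XG G A M) n = cl_up n ` cx.Xlevel 1 n"
proof -
  have "0 \<in> cx.Xlevel 1 n" using stable_Xlevel fM.subspace_0 by (auto simp: reps.stable_def)
  moreover have "cl_up n x = cl_up n 0" if "x \<in> cx.Xlevel 1 n" for x
    using that cl_up_eq_0_iff cx.Xlevel_mono[of 1 q n] q_pos by auto
  ultimately have "cl_up n ` cx.Xlevel 1 n = {cl_up n 0}" by blast
  then show ?thesis by (simp add: fM.lin_ontoD(3)[OF reps.bimod_repD(1)[OF rep_XG]])
qed

lemma gzero_YG: "gzero (YG G A M) n = y_cl n ` cx.invariant_rep n"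
proof -
  have "0 \<in> cx.invariant_rep n" using stable_invariant_rep fM.subspace_0 by (auto simp: reps.stable_def)
  moreover have "y_cl n x = y_cl n 0" if "x \<in> cx.invariant_rep n" for x
    using that y_cl_eq_0_iff invariant_rep_invariant_class by blast
  ultimately have "y_cl n ` cx.invariant_rep n = {y_cl n 0}" by blast
  then show ?thesis by (simp add: fM.lin_ontoD(3)[OF reps.bimod_repD(1)[OF rep_YG]])
qed

lemma filtration_X: "graded_filtration (AG G A M) (XG G A M) (q - 1) Xf"
  unfolding graded_filtration_def
proof (intro conjI ballI allI)
  show "Xf 0 = gcar (XG G A M)" by (simp add: fun_eq_iff Xf_def gcar_XG)
  have e: "nat (int (q - 1)) = q - 1" "q - (q - 1) = 1" "(int (q - 1) < 0) = False" using q_pos by auto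
  show "Xf (int (q - 1)) = gzero (XG G A M)"
    by (rule ext) (simp only: Xf_def e if_False gzero_XG)
  fix i assume i: "i \<in> {0..int (q - 1)}"
  have "Xf i = (\<lambda>n. cl_up n ` cx.Xlevel (q - nat i) n)" using i by (simp add: fun_eq_iff Xf_def)
  then show "graded_subbimodule (AG G A M) (XG G A M) (Xf i)"
    using reps.graded_subbimodule_of_rep[OF rep_AG rep_XG stable_Xlevel cx.Xlevel_mono] by simp
next
  fix i n assume i: "i \<in> {0..<int (q - 1)}"
  have "q - nat (i + 1) \<le> q - nat i" by simp
  from image_mono[OF cx.Xlevel_mono[OF this]] i show "Xf (i + 1) n \<subseteq> Xf i n"
    by (simp add: Xf_def)
qed

lemma filtration_Y: "graded_filtration (AG G A M) (YG G A M) (q - 1) Yf"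
  unfolding graded_filtration_def
proof (intro conjI ballI allI)
  show "Yf 0 = gcar (YG G A M)" using q_pos by (simp add: fun_eq_iff Yf_def gcar_YG cx.Ylevel_first)
  have e: "nat (int (q - 1)) = q - 1" "(int q \<le> int (q - 1)) = False" using q_pos by auto
  show "Yf (int (q - 1)) = gzero (YG G A M)"
    by (rule ext) (simp only: Yf_def e if_False gzero_YG cx.Ylevel_last)
  fix i assume i: "i \<in> {0..int (q - 1)}"
  have "Yf i = (\<lambda>n. y_cl n ` cx.Ylevel (nat i) n)" using i q_pos by (auto simp add: fun_eq_iff Yf_def)
  then show "graded_subbimodule (AG G A M) (YG G A M) (Yf i)"
    using reps.graded_subbimodule_of_rep[OF rep_AG rep_YG stable_Ylevel cx.Ylevel_sub] by simp
next
  fix i n assume i: "i \<in> {0..<int (q - 1)}"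
  then have "(int q \<le> i) = False" "(int q \<le> i + 1) = False" by auto
  moreover have "nat i \<le> nat (i + 1)" by simp
  from image_mono[OF cx.Ylevel_mono[OF this]] have "y_cl n ` cx.Ylevel (nat (i + 1)) n \<subseteq> y_cl n ` cx.Ylevel (nat i) n" .
  ultimately show "Yf (i + 1) n \<subseteq> Yf i n" by (simp only: Yf_def if_False)
qed

definition layer_rel where "layer_rel i n z x \<longleftrightarrow> (\<exists>y. cx.zigzag i n z y \<and> x = D n y)"

lemma layer_rel_diff: "\<lbrakk>layer_rel i n z x; layer_rel i n z' x'\<rbrakk> \<Longrightarrow> layer_rel i n (z - z') (x - x')"
  unfolding layer_rel_def using cx.zigzag_diff cx.D_diff by metis

lemma layer_rel_add: "\<lbrakk>layer_rel i n z x; layer_rel i n z' x'\<rbrakk> \<Longrightarrow> layer_rel i n (z + z') (x + x')"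
  unfolding layer_rel_def using cx.zigzag_add cx.D_add by metis

lemma layer_rel_chain:
  assumes "cx.chain_map n n' L0 L1" "layer_rel i n z x"
  shows "layer_rel i n' (L1 z) (L1 x)"
proof -
  obtain y where y: "cx.zigzag i n z y" "x = D n y" using assms(2) by (auto simp: layer_rel_def)
  then have "y \<in> E n" by (auto elim: cx.zigzagE)
  then show ?thesis using cx.zigzag_chain_map[OF assms(1) y(1)] cx.L_D[OF assms(1)] y(2)
    unfolding layer_rel_def by metis
qed

lemma layer_rel_closed:
  "layer_rel i n z x \<Longrightarrow> layer_rel i n (sc c z) (sc c x)"
  "\<lbrakk>a \<in> Zs CG j; layer_rel i n z x\<rbrakk> \<Longrightarrow> layer_rel i (j + n) (cup j n a z) (cup j n a x)"
  "\<lbrakk>a \<in> Zs CG j; layer_rel i n z x\<rbrakk> \<Longrightarrow> layer_rel i (n + j) (cup n j z a) (cup n j x a)"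
  using layer_rel_chain[OF chain_sc] layer_rel_chain[OF chain_left] layer_rel_chain[OF chain_right] by blast+

lemma layer_rel_in: "layer_rel i n z x \<Longrightarrow> z \<in> cx.Ylevel i n \<and> x \<in> cx.Xlevel (i + 2) n"
  using cx.zigzag_Xlevel by (auto simp: layer_rel_def cx.Ylevel_def)

lemma layer_rel_total: "z \<in> cx.Ylevel i n \<Longrightarrow> \<exists>x. layer_rel i n z x" "x \<in> cx.Xlevel (i + 2) n \<Longrightarrow> \<exists>z. layer_rel i n z x"
  using cx.Xlevel_zigzag by (auto simp: layer_rel_def cx.Ylevel_def)

lemma layer_rel_ker: "\<lbrakk>layer_rel i n z x; i + 2 \<le> q\<rbrakk> \<Longrightarrow> z \<in> cx.Ylevel (Suc i) n \<longleftrightarrow> x \<in> cx.Xlevel (Suc i) n"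
  using cx.zigzag_kernel by (auto simp: layer_rel_def)

text \<open>
  The relation \<open>layer_rel k\<close> on cochains induces the isomorphism between the layers.
\<close>

lemma iso_layers:
  assumes k: "k + 2 \<le> q"
  shows "gr_bimod_iso (AG G A M)
     (gr_subquot (YG G A M) (\<lambda>n. y_cl n ` cx.Ylevel k n) (\<lambda>n. y_cl n ` cx.Ylevel (Suc k) n))
     (gr_subquot (XG G A M) (\<lambda>n. cl_up n ` cx.Xlevel (k + 2) n) (\<lambda>n. cl_up n ` cx.Xlevel (Suc k) n))"
proof -
  let ?Y = "gr_restrict (YG G A M) (\<lambda>n. y_cl n ` cx.Ylevel k n)"
  let ?X = "gr_restrict (XG G A M) (\<lambda>n. cl_up n ` cx.Xlevel (k + 2) n)"
  have repY: "reps.bimod_rep (Zs CG) cl (cx.Ylevel k) y_cl ?Y"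
    by (rule reps.bimod_rep_restrict[OF rep_YG stable_Ylevel cx.Ylevel_sub])
  have subX: "cx.Xlevel (k + 2) n \<subseteq> cx.Xlevel q n" "cx.Xlevel (Suc k) n \<subseteq> cx.Xlevel (k + 2) n" for n
    using k by (auto intro!: cx.Xlevel_mono)
  have repX: "reps.bimod_rep (Zs CG) cl (cx.Xlevel (k + 2)) cl_up ?X"
    by (rule reps.bimod_rep_restrict[OF rep_XG stable_Xlevel subX(1)])
  have S: "fM.subspace (cx.Ylevel (Suc k) n)" "fM.subspace (cx.Xlevel (Suc k) n)" for n
    using stable_Ylevel stable_Xlevel by (auto simp: reps.stable_def)
  show ?thesis
  proof (rule reps.gr_bimod_iso_of_relation[OF rep_AG
        reps.bimod_rep_quot[OF repY stable_Ylevel cx.Ylevel_Suc] reps.bimod_rep_quot[OF repX stable_Xlevel subX(2)],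
        where R = "layer_rel k"])
    fix n z x assume r: "layer_rel k n z x"
    have in': "z \<in> cx.Ylevel k n" "x \<in> cx.Xlevel (k + 2) n" using layer_rel_in[OF r] by auto
    then have in'': "z \<in> cx.invariant_class n" "x \<in> cx.Xlevel q n" using cx.Ylevel_sub subX(1) by blast+
    show "coset_proj (gcomp ?Y n) (y_cl n) (cx.Ylevel (Suc k) n) z = coset_proj (gcomp ?Y n) (y_cl n) (cx.Ylevel (Suc k) n) 0 \<longleftrightarrow>
      coset_proj (gcomp ?X n) (cl_up n) (cx.Xlevel (Suc k) n) x = coset_proj (gcomp ?X n) (cl_up n) (cx.Xlevel (Suc k) n) 0"
      unfolding fM.coset_proj_eq_0_iff[OF reps.bimod_repD(1)[OF repY] S(1) cx.Ylevel_Suc in'(1)]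
        fM.coset_proj_eq_0_iff[OF reps.bimod_repD(1)[OF repX] S(2) subX(2) in'(2)]
        y_cl_mem_iff[OF in''(1)]
      using cl_up_mem_iff[OF in''(2), of "Suc k"] layer_rel_ker[OF r k] by simp
  next
    fix n z assume "z \<in> cx.Ylevel k n"
    then show "\<exists>z' x. layer_rel k n z' x \<and> coset_proj (gcomp ?Y n) (y_cl n) (cx.Ylevel (Suc k) n) z' =
        coset_proj (gcomp ?Y n) (y_cl n) (cx.Ylevel (Suc k) n) z"
      using layer_rel_total(1)[of z k n] by auto
  next
    fix n x assume "x \<in> cx.Xlevel (k + 2) n"
    then show "\<exists>z x'. layer_rel k n z x' \<and> coset_proj (gcomp ?X n) (cl_up n) (cx.Xlevel (Suc k) n) x' =
        coset_proj (gcomp ?X n) (cl_up n) (cx.Xlevel (Suc k) n) x"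
      using layer_rel_total(2)[of x k n] by auto
  qed (fact layer_rel_in layer_rel_diff layer_rel_add layer_rel_closed)+
qed

context
  fixes i :: nat
  assumes i: "i \<le> q - 1"
    and hyp: "\<And>n. (HH_Delta G \<rho> A M n ^^ i) ` HH_inv G H A M n = HH_inv G (carrier G) A M n"
begin

lemma HH_Delta_cl:
  assumes z: "z \<in> Zs CH n"
  shows "HH_Delta G \<rho> A M n (cl n z) = cl n (T z)"
proof -
  interpret V: abelian_group "gcomp (HH A M) n" by (rule fM.lin_onto_abelian_group[OF lin_HH])
  have zK: "z \<in> Zs C0 n" "cact g0 z \<in> Zs C0 n" "T z \<in> Zs C0 n"
    using subsetD[OF ZH_C0 z] cact_Zs_C0[OF g0(1)] fM.subspace_diff[OF subspace_Zs[OF dgs(3)]]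
    unfolding T_def by blast+
  then have c: "cl n z \<in> gcar (HH A M) n" "cl n (cact g0 z) \<in> gcar (HH A M) n" "cl n (T z) \<in> gcar (HH A M) n"
    by (auto simp: gcar_HH)
  have "HH_Delta G \<rho> A M n (cl n z) = cl n z \<ominus>\<^bsub>gcomp (HH A M) n\<^esub> cl n (cact g0 z)"
    by (simp add: HH_Delta_def Delta_def coset_act_def g0_def[symmetric] HH_act_cl[OF g0(1)])
  moreover have "cl n z = cl n (T z) \<oplus>\<^bsub>gcomp (HH A M) n\<^esub> cl n (cact g0 z)"
    using fM.lin_ontoD(4)[OF lin_HH zK(3,2)] by (simp add: T_def)
  ultimately show ?thesis using c by (simp add: V.minus_eq V.a_assoc V.r_neg)
qed

lemma HH_Delta_pow_cl:
  assumes z: "z \<in> Zs CH n"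
  shows "(HH_Delta G \<rho> A M n ^^ k) (cl n z) = cl n ((T ^^ k) z)"
proof (induction k)
  case (Suc k)
  have "(T ^^ k) z \<in> Zs CH n" using cx.Z_Tp[of z "Suc n" k] z by (simp add: Z_eq)
  then show ?case using Suc by (simp add: HH_Delta_cl)
qed simp

lemma hyp_im:
  assumes "z \<in> cx.invariant_class n"
  shows "\<exists>w \<in> cx.Z (Suc n). \<exists>c \<in> E n. z = (T ^^ i) w + D n c"
proof -
  have "cl n z \<in> (HH_Delta G \<rho> A M n ^^ i) ` HH_inv G H A M n" using hyp assms by (simp add: HH_inv_G)
  then obtain w where w: "w \<in> Zs CH n" "cl n z = cl n ((T ^^ i) w)"
    using HH_Delta_pow_cl by (auto simp: HH_inv_H)
  moreover have "(T ^^ i) w \<in> Zs CH n" "z \<in> Zs CH n" using w(1) cx.Z_Tp[of w "Suc n" i] subsetD[OF invariant_class_ZH assms] by (simp_all add: Z_eq)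
  ultimately obtain c where "c \<in> E n" "z - (T ^^ i) w = D n c" using cl_eq_iff_CH by blast
  then have "c \<in> E n" "z = (T ^^ i) w + D n c" by (auto simp: algebra_simps)
  then show ?thesis using w(1) unfolding Z_eq by blast
qed

lemma hyp_ker:
  assumes w: "w \<in> cx.Z (Suc n)"
  shows "\<exists>c \<in> E n. (T ^^ Suc i) w = D n c"
proof -
  have wZ: "w \<in> Zs CH n" "(T ^^ i) w \<in> Zs CH n" using w cx.Z_Tp[OF w] by (auto simp: Z_eq)
  have "(HH_Delta G \<rho> A M n ^^ i) (cl n w) \<in> HH_inv G (carrier G) A M n"
    unfolding hyp[symmetric] HH_inv_H using wZ by blast
  then obtain z where z: "z \<in> cx.invariant_class n" "cl n ((T ^^ i) w) = cl n z"
    using HH_Delta_pow_cl[OF wZ(1)] by (auto simp: HH_inv_G)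
  then obtain c where c: "c \<in> E n" "(T ^^ i) w - z = D n c"
    using cl_eq_iff_CH[OF wZ(2)] invariant_class_ZH by blast
  obtain b where b: "b \<in> E n" "T z = D n b" using z(1) by (auto simp: cx.invariant_class_def)
  have "(T ^^ i) w = z + D n c" using c(2) by (simp add: algebra_simps)
  then have "(T ^^ Suc i) w = D n (b + T c)"
    using b(2) by (simp add: cx.T_add cx.D_add cx.T_D)
  then show ?thesis using b(1) c(1) cx.add_in cx.T_in by blast
qed

lemma i_less: "i < q" using i q_pos by simp

lemma Ylevel_full: "cx.Ylevel i n = cx.invariant_class n"
  by (rule cx.Ylevel_full[OF i_less hyp_im hyp_ker])

lemma Xlevel_vanish: "cx.Xlevel (Suc i) n \<subseteq> cx.Xlevel 1 n"
  by (rule cx.Xlevel_vanish[OF i_less hyp_im hyp_ker])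

lemma Xlevel_full: "i + 2 \<le> q \<Longrightarrow> cx.Xlevel q n \<subseteq> cx.Xlevel (i + 2) n"
  by (rule cx.Xlevel_full[OF i_less hyp_im hyp_ker])

lemma Ylevel_vanish: "i + 2 \<le> q \<Longrightarrow> cx.Ylevel (Suc i) n = cx.invariant_rep n"
  by (rule cx.Ylevel_vanish[OF i_less hyp_im hyp_ker])

lemma Xlevel_1_eq: "cx.Xlevel (Suc i) n = cx.Xlevel 1 n"
  using Xlevel_vanish cx.Xlevel_mono[of 1 "Suc i" n] by auto

lemma collapse:
  "Xf (int q - 1 - int i) = gzero (XG G A M)"
  "Yf (int i + 1) = gzero (YG G A M)"
  "Xf (int q - 2 - int i) = gcar (XG G A M)"
  "Yf (int i) = gcar (YG G A M)"
proof -
  have n1: "nat (int q - 1 - int i) = q - Suc i" "q - (q - Suc i) = Suc i" using i_less by auto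
  show "Xf (int q - 1 - int i) = gzero (XG G A M)"
    using i_less by (simp add: fun_eq_iff Xf_def n1 Xlevel_1_eq gzero_XG)
  have n2: "nat (int i + 1) = Suc i" by simp
  show "Yf (int i + 1) = gzero (YG G A M)"
    unfolding fun_eq_iff Yf_def n2 using Ylevel_vanish by (auto simp: gzero_YG)
  show "Yf (int i) = gcar (YG G A M)"
    using i_less by (simp add: fun_eq_iff Yf_def Ylevel_full gcar_YG)
  show "Xf (int q - 2 - int i) = gcar (XG G A M)"
  proof (cases "i + 2 \<le> q")
    case True
    then have n3: "nat (int q - 2 - int i) = q - (i + 2)" "q - (q - (i + 2)) = i + 2" by auto
    have "cx.Xlevel (i + 2) n = cx.Xlevel q n" for n
      using Xlevel_full[OF True] cx.Xlevel_mono[OF True] by blast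
    then show ?thesis using True by (simp add: fun_eq_iff Xf_def n3 gcar_XG del: add_2_eq_Suc')
  qed (auto simp: fun_eq_iff Xf_def)
qed

text \<open>
  For \<open>i \<le> q - 2\<close> each filtration has at most one nonzero layer, and these two layers are the whole modules
  \<open>Y\<close> and \<open>X\<close>. For \<open>i = q - 1\<close> both modules are zero.
\<close>

lemma iso_collapse: "gr_bimod_iso (AG G A M) (XG G A M) (YG G A M)"
proof (cases "i + 2 \<le> q")
  case True
  have X: "cx.Xlevel (i + 2) n = cx.Xlevel q n" for n using Xlevel_full[OF True] cx.Xlevel_mono[OF True] by blast
  show ?thesis
  proof (rule reps.gr_bimod_iso_of_relation[OF rep_AG rep_XG rep_YG, where R = "\<lambda>n x z. layer_rel i n z x"])
    show "x \<in> cx.Xlevel q n \<and> z \<in> cx.invariant_class n" if "layer_rel i n z x" for n x z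
      using layer_rel_in[OF that] X Ylevel_full by simp
    show "cl_up n x = cl_up n 0 \<longleftrightarrow> y_cl n z = y_cl n 0" if "layer_rel i n z x" for n x z
      using layer_rel_ker[OF that True] layer_rel_in[OF that] X Ylevel_full Ylevel_vanish[OF True] Xlevel_1_eq
      by (simp add: y_cl_eq_0_iff cl_up_eq_0_iff)
    show "\<exists>x' z. layer_rel i n z x' \<and> cl_up n x' = cl_up n x" if "x \<in> cx.Xlevel q n" for n x
      using that layer_rel_total(2)[of x i n] X by auto
    show "\<exists>x z'. layer_rel i n z' x \<and> y_cl n z' = y_cl n z" if "z \<in> cx.invariant_class n" for n z
      using that layer_rel_total(1)[of z i n] Ylevel_full by auto
  qed (fact layer_rel_diff layer_rel_add layer_rel_closed)+
next
  case False
  then have iq: "Suc i = q" using i_less by simp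
  have X: "cx.Xlevel q n = cx.Xlevel 1 n" for n using Xlevel_1_eq iq by simp
  have Y: "cx.invariant_class n = cx.invariant_rep n" for n using Ylevel_full cx.Ylevel_last iq by (metis diff_Suc_1)
  have S: "fM.subspace (cx.Xlevel q n)" "fM.subspace (cx.invariant_class n)" for n
    using stable_Xlevel[of q] stable_invariant_class by (simp_all add: reps.stable_def)
  have cl_X: "cup j n a x \<in> cx.Xlevel q (j + n)" "cup n j x a \<in> cx.Xlevel q (n + j)"
    if "a \<in> Zs CG j" "x \<in> cx.Xlevel q n" for j n a x
    using stable_Xlevel[of q] that by (simp_all add: reps.stable_def)
  have cl_Y: "cup j n a x \<in> cx.invariant_class (j + n)" "cup n j x a \<in> cx.invariant_class (n + j)"
    if "a \<in> Zs CG j" "x \<in> cx.invariant_class n" for j n a x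
    using stable_invariant_class that by (simp_all add: reps.stable_def)
  show ?thesis
  proof (rule reps.gr_bimod_iso_of_relation[OF rep_AG rep_XG rep_YG,
        where R = "\<lambda>n x z. x \<in> cx.Xlevel q n \<and> z \<in> cx.invariant_class n"])
    have 0: "0 \<in> cx.Xlevel q n" "0 \<in> cx.invariant_class n" for n
      using S fM.subspace_0 by blast+
    show "\<exists>x' z. (x' \<in> cx.Xlevel q n \<and> z \<in> cx.invariant_class n) \<and> cl_up n x' = cl_up n x" if "x \<in> cx.Xlevel q n" for n x
      using that 0 by blast
    show "\<exists>x z'. (x \<in> cx.Xlevel q n \<and> z' \<in> cx.invariant_class n) \<and> y_cl n z' = y_cl n z" if "z \<in> cx.invariant_class n" for n z
      using that 0 by blast
    show "cl_up n x = cl_up n 0 \<longleftrightarrow> y_cl n z = y_cl n 0" if "x \<in> cx.Xlevel q n \<and> z \<in> cx.invariant_class n" for n x z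
    proof -
      have "cl_up n x = cl_up n 0" using cl_up_eq_0_iff[of x n] that X[of n] by blast
      moreover have "y_cl n z = y_cl n 0" using y_cl_eq_0_iff[of z n] that Y[of n] by blast
      ultimately show ?thesis by blast
    qed
  qed (auto simp: fM.subspace_diff[OF S(1)] fM.subspace_diff[OF S(2)] fM.subspace_add[OF S(1)]
      fM.subspace_add[OF S(2)] fM.subspace_scale[OF S(1)] fM.subspace_scale[OF S(2)] cl_X cl_Y)
qed

end

lemma iso_Yf_Xf:
  assumes "i \<in> {0..int q - 2}"
  shows "gr_bimod_iso (AG G A M) (gr_subquot (YG G A M) (Yf i) (Yf (i + 1)))
    (gr_subquot (XG G A M) (Xf (int q - 2 - i)) (Xf (int q - 1 - i)))"
proof -
  obtain k where k: "i = int k" "k + 2 \<le> q" using assms by (cases i) auto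
  have n: "nat (int q - 2 - int k) = q - (k + 2)" "q - (q - (k + 2)) = k + 2"
      "nat (int q - 1 - int k) = q - Suc k" "q - (q - Suc k) = Suc k" "nat (int k + 1) = Suc k"
    using k(2) by auto
  have e: "Yf i = (\<lambda>n. y_cl n ` cx.Ylevel k n)" "Yf (i + 1) = (\<lambda>n. y_cl n ` cx.Ylevel (Suc k) n)"
      "Xf (int q - 2 - i) = (\<lambda>n. cl_up n ` cx.Xlevel (k + 2) n)"
      "Xf (int q - 1 - i) = (\<lambda>n. cl_up n ` cx.Xlevel (Suc k) n)"
    unfolding Yf_def[abs_def] Xf_def[abs_def] k(1) n using k(2) by (auto simp: fun_eq_iff)
  show ?thesis unfolding e by (rule iso_layers[OF k(2)])
qed

lemma Xf_Yf_conventions: "Xf (-1) = gcar (XG G A M)" "Yf (int q) = gzero (YG G A M)"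
  by (simp_all add: fun_eq_iff Xf_def Yf_def)

end

theorem theorem13p1:
  fixes G :: "'g monoid" and H :: "'g set" and \<rho> :: "'g set"
    and p q r :: nat
    and A :: "('g, 'k::field, 'a::{ring,monoid_mult}) mod_alg"
    and M :: "('g, 'k, 'a, 'm::{ring,monoid_mult}) bimod_alg"
    and m :: 'm and h :: "'a \<Rightarrow> 'm"
  assumes char: "CHAR('k) = p" "p > 0"
    and q: "q = p ^ r"
    and G: "group G" "finite (carrier G)"
    and H: "H \<lhd> G" "\<not> p dvd card H"
    and quotient: "card (carrier (G Mod H)) = q" "\<rho> \<in> carrier (G Mod H)"
      "generate (G Mod H) {\<rho>} = carrier (G Mod H)"
    and A: "kG_module_algebra G A"
    and M: "AeG_module_algebra G A M" "degenerated G H \<rho> q A M m h"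
  shows "\<exists>Xf Yf.
    graded_filtration (AG G A M) (XG G A M) (q - 1) Xf \<and>
    graded_filtration (AG G A M) (YG G A M) (q - 1) Yf \<and>
    (\<forall>i \<in> {0..int q - 2}.
       gr_bimod_iso (AG G A M)
         (gr_subquot (YG G A M) (Yf i) (Yf (i + 1)))
         (gr_subquot (XG G A M) (Xf (int q - 2 - i)) (Xf (int q - 1 - i)))) \<and>
    Xf (-1) = gcar (XG G A M) \<and> Yf (int q) = gzero (YG G A M) \<and>
    (\<forall>i \<le> q - 1.
       (\<forall>n. (HH_Delta G \<rho> A M n ^^ i) ` HH_inv G H A M n = HH_inv G (carrier G) A M n) \<longrightarrow>
       Xf (int q - 1 - int i) = gzero (XG G A M) \<and>
       Yf (int i + 1) = gzero (YG G A M) \<and>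
       Xf (int q - 2 - int i) = gcar (XG G A M) \<and>
       gr_bimod_iso (AG G A M) (XG G A M) (YG G A M) \<and>
       Yf (int i) = gcar (YG G A M))"
proof -
  interpret degenerated_module G A M H \<rho> p q r m h
    by (intro degenerated_module.intro degenerated_module_axioms.intro) (fact assms)+
  show ?thesis
  proof (intro exI[of _ Xf] exI[of _ Yf] conjI allI ballI impI)
    fix i assume "i \<le> q - 1"
      and "\<forall>n. (HH_Delta G \<rho> A M n ^^ i) ` HH_inv G H A M n = HH_inv G (carrier G) A M n"
    then have i: "i \<le> q - 1"
      "\<And>n. (HH_Delta G \<rho> A M n ^^ i) ` HH_inv G H A M n = HH_inv G (carrier G) A M n" by blast+
    show "Xf (int q - 1 - int i) = gzero (XG G A M)" "Yf (int i + 1) = gzero (YG G A M)"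
      "Xf (int q - 2 - int i) = gcar (XG G A M)" "Yf (int i) = gcar (YG G A M)"
      by (rule collapse[OF i])+
    show "gr_bimod_iso (AG G A M) (XG G A M) (YG G A M)" by (rule iso_collapse[OF i])
  qed (rule filtration_X filtration_Y iso_Yf_Xf Xf_Yf_conventions | assumption)+
qed

end
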